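(* For every $1\le p\le\infty$, the class of separable $\mathcal L_p$-spaces is a $G_{\delta\sigma}$-set in $\mathcal P$ and in any admissible topology; that is, $\{\mu\in\mathcal P: X_\mu\text{ is an }\mathcal L_p\text{-space}\}$ is $G_{\delta\sigma}$ in $\mathcal P$, and for every admissible topology $\tau$ on $SB$ the set $\{F\in SB: F\text{ is an }\mathcal L_p\text{-space}\}$ is $G_{\delta\sigma}$ in $(SB,\tau)$.
   Context: All Banach spaces are real. Let $V$ be the vector space over $\mathbb Q$ of all finitely supported sequences of rational numbers. $\mathcal P$ denotes the space of all pseudonorms on $V$, a closed subset of $\mathbb R^V$ with the inherited (Polish) topology of pointwise convergence. Each $\mu\in\mathcal P$ is identified with its unique extension to a pseudonorm on the real vector space $c_{00}$ of finitely supported real sequences, and $X_\mu$ denotes the completion of the quotient of $(c_{00},\mu)$ by $\{x\in c_{00}:\mu(x)=0\}$. $G_{\delta\sigma}$-sets are countable unions of $G_\delta$-sets. A Banach space $X$ is an $\mathcal L_{p,\lambda}$-space ($1\le p\le\infty$, $\lambda\ge1$) if every finite-dimensional subspace of $X$ is contained in another finite-dimensional subspace of $X$ whose Banach–Mazur distance ($\inf\|T\|\|T^{-1}\|$ over surjective isomorphisms) to the space $\ell_p^n$ of the same dimension $n$ is at most $\lambda$. $X$ is an $\mathcal L_p$-space if it is an $\mathcal L_{p,\lambda}$-space for some $\lambda\ge1$ (in particular, every finite-dimensional space is an $\mathcal L_p$-space). $SB$ is the set of all closed linear subspaces of $C(2^\omega)$. For an open $U\subseteq C(2^\omega)$ let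 $E^+(U)=\{F\in SB: F\cap U\ne\emptyset\}$. A Polish topology $\tau$ on $SB$ is admissible (in the sense of Godefroy and Saint-Raymond) if (i) $E^+(U)$ is $\tau$-open for every open $U\subseteq C(2^\omega)$, and (ii) there is a subbasis of $\tau$ each of whose members is a countable union of sets of the form $E^+(U)\setminus E^+(W)$ with $U,W\subseteq C(2^\omega)$ open. *)

theory Defs
  imports "HOL-Analysis.Analysis" "HOL-Library.Poly_Mapping"
begin

section \<open>Normed spaces with explicit carriers\<close>

text \<open>
  The space \<open>X\<^sub>\<mu>\<close> depends on \<open>\<mu>\<close>, so it cannot be a type. Real (semi)normed spaces are therefore
  records consisting of a carrier and the operations, which only matter on the carrier.
\<close>

record 'a nspace =
  vecs :: "'a set"
  vzero :: 'a
  vadd :: "'a \<Rightarrow> 'a \<Rightarrow> 'a"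
  vscale :: "real \<Rightarrow> 'a \<Rightarrow> 'a"
  vnorm :: "'a \<Rightarrow> real"

definition vdist :: "'a nspace \<Rightarrow> 'a \<Rightarrow> 'a \<Rightarrow> real" where
  "vdist X x y = vnorm X (vadd X x (vscale X (-1) y))"

definition nspace_of :: "'a::real_normed_vector set \<Rightarrow> 'a nspace" where
  "nspace_of S = \<lparr>vecs = S, vzero = 0, vadd = (+), vscale = scaleR, vnorm = norm\<rparr>"

subsection \<open>Subspaces and dimension\<close>

definition linear_subspace :: "'a nspace \<Rightarrow> 'a set \<Rightarrow> bool" where
  "linear_subspace X E \<longleftrightarrow> E \<subseteq> vecs X \<and> vzero X \<in> E \<and>
     (\<forall>x\<in>E. \<forall>y\<in>E. vadd X x y \<in> E) \<and> (\<forall>r. \<forall>x\<in>E. vscale X r x \<in> E)"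

definition restrict_to :: "'a nspace \<Rightarrow> 'a set \<Rightarrow> 'a nspace" where
  "restrict_to X E = X\<lparr>vecs := E\<rparr>"

text \<open>\<open>lincomb X c b n\<close> is the sum of \<open>c i\<close> times \<open>b i\<close> over \<open>i < n\<close>, formed in \<open>X\<close>.\<close>

primrec lincomb :: "'a nspace \<Rightarrow> (nat \<Rightarrow> real) \<Rightarrow> (nat \<Rightarrow> 'a) \<Rightarrow> nat \<Rightarrow> 'a" where
  "lincomb X c b 0 = vzero X"
| "lincomb X c b (Suc n) = vadd X (lincomb X c b n) (vscale X (c n) (b n))"

definition spanned_by_size :: "'a nspace \<Rightarrow> nat \<Rightarrow> bool" where
  "spanned_by_size X n \<longleftrightarrow>
     (\<exists>b. (\<forall>i<n. b i \<in> vecs X) \<and> vecs X = range (\<lambda>c. lincomb X c b n))"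

definition finite_dimensional :: "'a nspace \<Rightarrow> bool" where
  "finite_dimensional X \<longleftrightarrow> (\<exists>n. spanned_by_size X n)"

definition vdim :: "'a nspace \<Rightarrow> nat" where
  "vdim X = (LEAST n. spanned_by_size X n)"

subsection \<open>Banach--Mazur distance\<close>

definition isomorphisms :: "'a nspace \<Rightarrow> 'b nspace \<Rightarrow> ('a \<Rightarrow> 'b) set" where
  "isomorphisms X Y = {T. bij_betw T (vecs X) (vecs Y) \<and>
     (\<forall>x\<in>vecs X. \<forall>y\<in>vecs X. T (vadd X x y) = vadd Y (T x) (T y)) \<and>
     (\<forall>r. \<forall>x\<in>vecs X. T (vscale X r x) = vscale Y r (T x)) \<and>
     (\<exists>C. \<forall>x\<in>vecs X. vnorm Y (T x) \<le> C * vnorm X x) \<and>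
     (\<exists>C. \<forall>x\<in>vecs X. vnorm X x \<le> C * vnorm Y (T x))}"

definition opnorm :: "'a nspace \<Rightarrow> 'b nspace \<Rightarrow> ('a \<Rightarrow> 'b) \<Rightarrow> real" where
  "opnorm X Y T = (SUP x\<in>{x \<in> vecs X. vnorm X x \<le> 1}. vnorm Y (T x))"

text \<open>The infimum is taken in \<^typ>\<open>ereal\<close>, so that non-isomorphic spaces have distance \<open>\<infinity>\<close>.\<close>

definition bm_dist :: "'a nspace \<Rightarrow> 'b nspace \<Rightarrow> ereal" where
  "bm_dist X Y =
     (INF T\<in>isomorphisms X Y. ereal (opnorm X Y T * opnorm Y X (inv_into (vecs X) T)))"

subsection \<open>The spaces \<open>\<ell>\<^sub>p\<^sup>n\<close> and script-\<open>L\<^sub>p\<close>-spaces\<close>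

definition lp_norm :: "ennreal \<Rightarrow> nat \<Rightarrow> (nat \<Rightarrow> real) \<Rightarrow> real" where
  "lp_norm p n x =
     (if p = \<infinity> then Max (insert 0 ((\<lambda>i. \<bar>x i\<bar>) ` {..<n}))
      else (\<Sum>i<n. \<bar>x i\<bar> powr enn2real p) powr (1 / enn2real p))"

definition lp_space :: "ennreal \<Rightarrow> nat \<Rightarrow> (nat \<Rightarrow> real) nspace" where
  "lp_space p n = \<lparr>vecs = {x. \<forall>i\<ge>n. x i = 0}, vzero = (\<lambda>i. 0),
     vadd = (\<lambda>x y i. x i + y i), vscale = (\<lambda>r x i. r * x i), vnorm = lp_norm p n\<rparr>"

definition script_Lp_const :: "ennreal \<Rightarrow> real \<Rightarrow> 'a nspace \<Rightarrow> bool" where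
  "script_Lp_const p K X \<longleftrightarrow>
     (\<forall>E. linear_subspace X E \<and> finite_dimensional (restrict_to X E) \<longrightarrow>
        (\<exists>G. linear_subspace X G \<and> finite_dimensional (restrict_to X G) \<and> E \<subseteq> G \<and>
             bm_dist (restrict_to X G) (lp_space p (vdim (restrict_to X G))) \<le> ereal K))"

definition script_Lp :: "ennreal \<Rightarrow> 'a nspace \<Rightarrow> bool" where
  "script_Lp p X \<longleftrightarrow> (\<exists>K\<ge>1. script_Lp_const p K X)"

subsection \<open>Quotients and completions\<close>

definition null_rel :: "'a nspace \<Rightarrow> ('a \<times> 'a) set" where
  "null_rel X = {(x, y). x \<in> vecs X \<and> y \<in> vecs X \<and> vdist X x y = 0}"

text \<open>
  The quotient of a seminormed space by the kernel of its seminorm. The elements are cosets;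
  the unions and \<^const>\<open>the_elem\<close> are over coinciding values.
\<close>

definition kernel_quotient :: "'a nspace \<Rightarrow> 'a set nspace" where
  "kernel_quotient X = \<lparr>vecs = vecs X // null_rel X,
     vzero = null_rel X `` {vzero X},
     vadd = (\<lambda>A B. \<Union>a\<in>A. \<Union>b\<in>B. null_rel X `` {vadd X a b}),
     vscale = (\<lambda>r A. \<Union>a\<in>A. null_rel X `` {vscale X r a}),
     vnorm = (\<lambda>A. the_elem (vnorm X ` A))\<rparr>"

definition cauchy_space :: "'a nspace \<Rightarrow> (nat \<Rightarrow> 'a) nspace" where
  "cauchy_space X = \<lparr>
     vecs = {s. (\<forall>n. s n \<in> vecs X) \<and> (\<forall>e>0. \<exists>N. \<forall>m\<ge>N. \<forall>n\<ge>N. vdist X (s m) (s n) < e)},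
     vzero = (\<lambda>n. vzero X),
     vadd = (\<lambda>s t n. vadd X (s n) (t n)),
     vscale = (\<lambda>r s n. vscale X r (s n)),
     vnorm = (\<lambda>s. lim (\<lambda>n. vnorm X (s n)))\<rparr>"

definition completion :: "'a nspace \<Rightarrow> (nat \<Rightarrow> 'a) set nspace" where
  "completion X = kernel_quotient (cauchy_space X)"

section \<open>The space of pseudonorms\<close>

text \<open>
  The space \<open>V\<close> is the type \<^typ>\<open>nat \<Rightarrow>\<^sub>0 rat\<close>, and the space \<open>c\<^sub>0\<^sub>0\<close> is \<^typ>\<open>nat \<Rightarrow>\<^sub>0 real\<close>.
\<close>

definition fs_scale :: "'k::mult_zero \<Rightarrow> (nat \<Rightarrow>\<^sub>0 'k) \<Rightarrow> (nat \<Rightarrow>\<^sub>0 'k)" where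
  "fs_scale a x = Poly_Mapping.map ((*) a) x"

definition pseudonorms :: "((nat \<Rightarrow>\<^sub>0 rat) \<Rightarrow> real) set" where
  "pseudonorms = {\<mu>. (\<forall>x. 0 \<le> \<mu> x) \<and> (\<forall>x y. \<mu> (x + y) \<le> \<mu> x + \<mu> y) \<and>
     (\<forall>a x. \<mu> (fs_scale a x) = real_of_rat \<bar>a\<bar> * \<mu> x)}"

definition pseudonorms_c00 :: "((nat \<Rightarrow>\<^sub>0 real) \<Rightarrow> real) set" where
  "pseudonorms_c00 = {\<nu>. (\<forall>x. 0 \<le> \<nu> x) \<and> (\<forall>x y. \<nu> (x + y) \<le> \<nu> x + \<nu> y) \<and>
     (\<forall>a x. \<nu> (fs_scale a x) = \<bar>a\<bar> * \<nu> x)}"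

text \<open>
  The extension exists and is unique: \<open>\<mu>\<close> is Lipschitz with respect to a weighted
  \<open>\<ell>\<^sub>1\<close>-norm, and so is every pseudonorm on \<open>c\<^sub>0\<^sub>0\<close>.
\<close>

definition extend :: "((nat \<Rightarrow>\<^sub>0 rat) \<Rightarrow> real) \<Rightarrow> (nat \<Rightarrow>\<^sub>0 real) \<Rightarrow> real" where
  "extend \<mu> = (THE \<nu>. \<nu> \<in> pseudonorms_c00 \<and>
                      (\<forall>x. \<nu> (Poly_Mapping.map real_of_rat x) = \<mu> x))"

definition c00_space :: "((nat \<Rightarrow>\<^sub>0 real) \<Rightarrow> real) \<Rightarrow> (nat \<Rightarrow>\<^sub>0 real) nspace" where
  "c00_space \<nu> = \<lparr>vecs = UNIV, vzero = 0, vadd = (+), vscale = fs_scale, vnorm = \<nu>\<rparr>"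

definition X_space ::
  "((nat \<Rightarrow>\<^sub>0 rat) \<Rightarrow> real) \<Rightarrow> (nat \<Rightarrow> (nat \<Rightarrow>\<^sub>0 real) set) set nspace" where
  "X_space \<mu> = completion (kernel_quotient (c00_space (extend \<mu>)))"

section \<open>Admissible topologies\<close>

text \<open>
  The Cantor space \<open>2\<^sup>\<omega>\<close> is \<^typ>\<open>nat \<Rightarrow> bool\<close> with the product topology. It is compact, so
  every continuous function on it is bounded.
\<close>

type_synonym cantor_fun = "(nat \<Rightarrow> bool) \<Rightarrow>\<^sub>C real"

definition SB :: "cantor_fun set set" where
  "SB = {F. subspace F \<and> closed F}"

definition E_plus :: "cantor_fun set \<Rightarrow> cantor_fun set set" where
  "E_plus U = {F \<in> SB. F \<inter> U \<noteq> {}}"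

definition admissible :: "cantor_fun set topology \<Rightarrow> bool" where
  "admissible \<tau> \<longleftrightarrow>
     topspace \<tau> = SB \<and> completely_metrizable_space \<tau> \<and> separable_space \<tau> \<and>
     (\<forall>U. open U \<longrightarrow> openin \<tau> (E_plus U)) \<and>
     (\<exists>\<S>. \<tau> = topology_generated_by \<S> \<and>
        (\<forall>B\<in>\<S>. \<exists>U W :: nat \<Rightarrow> cantor_fun set.
            (\<forall>n. open (U n) \<and> open (W n)) \<and> B = (\<Union>n. E_plus (U n) - E_plus (W n))))"

definition gdelta_sigma_in :: "'a topology \<Rightarrow> 'a set \<Rightarrow> bool" where
  "gdelta_sigma_in \<tau> = countable union_of gdelta_in \<tau>"

end

theory Submission
  imports Defs "HOL-Analysis.Finite_Function_Topology"
begin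

text \<open>
  A separable \<open>X\<close> is a script-\<open>L\<^sub>p\<close>-space iff for some \<open>K\<close> every finite subset of \<open>X\<close> lies in the span
  of a finite system that is \<open>K\<close>-equivalent to the unit vector basis of \<open>\<ell>\<^sub>p\<^sup>m\<close>. Up to a change of \<open>K\<close>
  the containment can be relaxed to approximation, and it suffices to approximate finite subsets of a
  dense set by systems taken from that set: the approximating span is moved by a perturbation of the
  identity, built from biorthogonal functionals, so that it contains the given vectors.
  The relaxed condition is a countable intersection over finite subsets and tolerances. Since
  \<open>K\<close>-equivalence can be tested, again up to a change of \<open>K\<close>, by strict inequalities at finitely many
  integer coefficient vectors, each of its members is open in \<open>\<P>\<close>, and in an
  admissible topology the union of a closed and an open set. The union over \<open>K\<close> gives the
  \<open>\<sigma>\<close>.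
\<close>

section \<open>The Hahn--Banach theorem and biorthogonal functionals\<close>

text \<open>Both halves reduce to subsets of one normed space: \<open>X_space \<mu>\<close> is
  realised inside l_infinity, with the image of V as dense set, while a member \<open>F\<close> of
  \<open>SB\<close> serves as its own dense set. For \<open>F\<close> the obstacle is that a
  countable family of tests must not depend on \<open>F\<close>. The tests are therefore indexed by
  lists from a fixed countable dense subset of C(2^omega), whose entries may be far from
  \<open>F\<close>. A test thus has to be an implication: either some entry is far from
  \<open>F\<close>, or all entries are approximated by a system in \<open>F\<close>. The first
  alternative is the closed set, which is a G_delta-set by metrizability. The length of the
  approximating system belongs to the witness and is not bounded in terms of the given vectors; this
  costs nothing, because the witnesses only enter through a union of open sets. The losses, a factor
  17 from the grid and a factor 3 from the perturbation, are absorbed by the existential quantifier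
  over \<open>K\<close>, and monotonicity in \<open>K\<close> allows natural
  \<open>K\<close>.\<close>

lemma hahn_banach_seminorm:
  fixes p :: "'a::real_vector \<Rightarrow> real"
  assumes nonneg: "\<And>x. 0 \<le> p x"
    and tri: "\<And>x y. p (x + y) \<le> p x + p y"
    and hom: "\<And>r x. p (r *\<^sub>R x) = \<bar>r\<bar> * p x"
  obtains f where "linear f" "f v = p v" "\<And>x. \<bar>f x\<bar> \<le> p x"
proof -
  \<comment> \<open>Competitors are subspaces of the product space rather than partial functions.
    Domination by \<open>p\<close> forces them to be graphs: a vertical vector (0, t) and its
    negative give t <= 0 and -t <= 0. Unions of chains and one-dimensional extensions are then plain
    unions and spans.\<close>
  define G where "G = {H :: ('a \<times> real) set. subspace H \<and> (v, p v) \<in> H \<and> (\<forall>(x, r)\<in>H. r \<le> p x)}"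
  have p0: "p 0 = 0"
    using hom[of 0 0] by simp
  have "\<forall>(x, r)\<in>span {(v, p v)}. r \<le> p x"
    by (auto simp: span_singleton hom intro!: mult_right_mono nonneg)
  then have "span {(v, p v)} \<in> G"
    by (auto simp: G_def span_base)
  then have "G \<noteq> {}" by blast
  moreover have "\<Union>C \<in> G" if "C \<noteq> {}" "subset.chain G C" for C
  proof -
    have sub: "C \<subseteq> G" and lin: "\<And>A B. A \<in> C \<Longrightarrow> B \<in> C \<Longrightarrow> A \<subseteq> B \<or> B \<subseteq> A"
      using that by (auto simp: subset.chain_def)
    have "subspace (\<Union>C)"
    proof (rule subspaceI)
      show "0 \<in> \<Union>C"
        using that(1) sub subspace_0 unfolding G_def by blast
      fix x y assume "x \<in> \<Union>C" "y \<in> \<Union>C"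
      then obtain A B where AB: "A \<in> C" "B \<in> C" "x \<in> A" "y \<in> B" by blast
      then have "\<exists>E\<in>C. x \<in> E \<and> y \<in> E"
        using lin[of A B] by blast
      then show "x + y \<in> \<Union>C"
        using sub subspace_add unfolding G_def by blast
    next
      fix c x assume "x \<in> \<Union>C"
      then show "c *\<^sub>R x \<in> \<Union>C"
        using sub subspace_scale unfolding G_def by blast
    qed
    then show ?thesis
      using that(1) sub unfolding G_def by blast
  qed
  ultimately obtain H where H: "H \<in> G" and maxi: "\<And>X. X \<in> G \<Longrightarrow> H \<subseteq> X \<Longrightarrow> X = H"
    using subset_Zorn_nonempty[of G] by blast
  have sH: "subspace H" and vH: "(v, p v) \<in> H" and leH: "\<And>x r. (x, r) \<in> H \<Longrightarrow> r \<le> p x"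
    using H by (auto simp: G_def)
  have total: "\<exists>c. (z, c) \<in> H" for z
  proof -
    have sep: "s - p (y - z) \<le> p (x + z) - r" if "(x, r) \<in> H" "(y, s) \<in> H" for x r y s
    proof -
      have "r + s \<le> p (x + y)"
        using leH[of "x + y" "r + s"] subspace_add[OF sH that] by simp
      also have "\<dots> \<le> p (x + z) + p (y - z)"
        using tri[of "x + z" "y - z"] by simp
      finally show ?thesis by simp
    qed
    have H0: "(0, 0) \<in> H"
      using subspace_0[OF sH] by (simp add: zero_prod_def)
    \<comment> \<open>By \<open>sep\<close> every lower bound for the value at \<open>z\<close> lies
      below every upper bound. \<open>z\<close> may already lie in the domain of \<open>H\<close>;
      maximality then still yields \<open>(z, c) \<in> H\<close>.\<close>
    define c where "c = (SUP (y, s)\<in>H. s - p (y - z))"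
    have bdd: "bdd_above ((\<lambda>(y, s). s - p (y - z)) ` H)"
      using sep[OF H0] by (intro bdd_aboveI[of _ "p (0 + z) - 0"]) auto
    have lo: "s - p (y - z) \<le> c" if "(y, s) \<in> H" for y s
      using cSUP_upper[OF that bdd] by (simp add: c_def)
    have up: "c \<le> p (x + z) - r" if "(x, r) \<in> H" for x r
      unfolding c_def using H0 sep[OF that] by (intro cSUP_least) auto
    have "span (insert (z, c) H) \<in> G"
      unfolding G_def
    proof (safe)
      show "(v, p v) \<in> span (insert (z, c) H)"
        using vH by (simp add: span_base)
      fix x r assume "(x, r) \<in> span (insert (z, c) H)"
      then obtain k where k: "(x, r) - k *\<^sub>R (z, c) \<in> H"
        using sH by (force simp: span_insert dest: span_eq_iff[THEN iffD2])
      then have k': "(x - k *\<^sub>R z, r - k * c) \<in> H" by simp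
      \<comment> \<open>Division by \<open>\<bar>k\<bar>\<close> turns the claim into the upper
        bound for \<open>c\<close> if \<open>k > 0\<close> and into the lower bound if
        \<open>k < 0\<close>.\<close>
      show "r \<le> p x"
      proof (cases "k = 0")
        case True
        then show ?thesis using k' leH by simp
      next
        case False
        have inH: "((1/\<bar>k\<bar>) *\<^sub>R (x - k *\<^sub>R z), (1/\<bar>k\<bar>) * (r - k * c)) \<in> H"
          using subspace_scale[OF sH k', of "1/\<bar>k\<bar>"] by simp
        show ?thesis
        proof (cases "k > 0")
          case True
          have "(1/k) *\<^sub>R (x - k *\<^sub>R z) + z = (1/k) *\<^sub>R x"
            using True by (simp add: scaleR_diff_right)
          then have "c \<le> p x / k - (r - k * c) / k"
            using up[OF inH] True by (simp add: hom)
          then show ?thesis using True by (simp add: field_simps)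
        next
          case f: False
          then have kn: "k < 0" using False by simp
          have "(1/\<bar>k\<bar>) *\<^sub>R (x - k *\<^sub>R z) - z = (1/\<bar>k\<bar>) *\<^sub>R x"
            using kn by (simp add: scaleR_diff_right)
          then have "(r - k * c) / \<bar>k\<bar> - p x / \<bar>k\<bar> \<le> c"
            using lo[OF inH] kn hom[of "- (1 / k)" x] by simp
          then have "(r - k * c - p x) / \<bar>k\<bar> \<le> c"
            by (simp add: diff_divide_distrib)
          then have "r - k * c - p x \<le> c * \<bar>k\<bar>"
            using kn by (subst (asm) pos_divide_le_eq) auto
          then show ?thesis using kn by (simp add: algebra_simps)
        qed
      qed
    qed
    then have "span (insert (z, c) H) = H"
      by (rule maxi) (auto intro: span_base)
    then show ?thesis
      using span_base[of "(z, c)" "insert (z, c) H"] by auto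
  qed
  have uniq: "r = s" if "(x, r) \<in> H" "(x, s) \<in> H" for x r s
    using leH[of 0 "r - s"] leH[of 0 "s - r"] subspace_diff[OF sH that] subspace_diff[OF sH that(2,1)] p0
    by simp
  define f where "f x = (THE r. (x, r) \<in> H)" for x
  have f: "(x, f x) \<in> H" for x
    unfolding f_def using total uniq by (metis (mono_tags, lifting) theI)
  have lin: "linear f"
  proof (rule linearI)
    show "f (x + y) = f x + f y" for x y
      using subspace_add[OF sH f[of x] f[of y]] uniq f by auto
    show "f (c *\<^sub>R x) = c *\<^sub>R f x" for c x
      using subspace_scale[OF sH f[of x], of c] uniq f by auto
  qed
  moreover have "f v = p v"
    using uniq f vH by blast
  moreover have "\<bar>f x\<bar> \<le> p x" for x
    using leH[OF f[of x]] leH[OF f[of "-x"]] hom[of "-1" x] linear_neg[OF lin, of x]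
    by (simp add: abs_le_iff)
  ultimately show ?thesis using that by blast
qed

text \<open>Induction on \<open>B\<close>: subtracting the expansion along the old vectors gives a
  map \<open>P\<close> that kills \<open>B\<close> but not the new vector \<open>v\<close>. A
  norming functional of \<open>P v\<close>, composed with \<open>P\<close> and normalised, is dual
  to \<open>v\<close>; the old functionals are then corrected by multiples of it so that they vanish
  at \<open>v\<close>.\<close>

lemma biorthogonal_functionals:
  fixes B :: "'a::real_normed_vector set"
  assumes "finite B" "independent B"
  obtains \<psi> :: "'a \<Rightarrow> 'a \<Rightarrow> real" where
    "\<And>b. b \<in> B \<Longrightarrow> bounded_linear (\<psi> b)"
    "\<And>b c. b \<in> B \<Longrightarrow> c \<in> B \<Longrightarrow> \<psi> b c = (if b = c then 1 else 0)"
  using assms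
proof (induction B arbitrary: thesis rule: finite_induct)
  case empty
  then show ?case by simp
next
  case (insert v B)
  then have ind: "independent B" and nsp: "v \<notin> span B"
    by (auto simp: independent_insert)
  obtain \<psi> where \<psi>: "\<And>b. b \<in> B \<Longrightarrow> bounded_linear (\<psi> b)"
    "\<And>b c. b \<in> B \<Longrightarrow> c \<in> B \<Longrightarrow> \<psi> b c = (if b = c then 1 else (0::real))"
    using insert.IH[OF _ ind] by blast
  define P where "P x = x - (\<Sum>b\<in>B. \<psi> b x *\<^sub>R b)" for x
  have P0: "P c = 0" if "c \<in> B" for c
  proof -
    have "(\<Sum>b\<in>B. \<psi> b c *\<^sub>R b) = (\<Sum>b\<in>B. if b = c then c else 0)"
      using that \<psi>(2) by (intro sum.cong) auto
    then show ?thesis using that insert.hyps by (simp add: P_def)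
  qed
  have Pv: "P v \<noteq> 0"
  proof
    assume "P v = 0"
    then have "v = (\<Sum>b\<in>B. \<psi> b v *\<^sub>R b)" by (simp add: P_def)
    also have "\<dots> \<in> span B" by (intro span_sum span_scale span_base)
    finally show False using nsp by simp
  qed
  have blP: "bounded_linear P"
    unfolding P_def
    by (intro bounded_linear_sub bounded_linear_sum bounded_linear_ident
        bounded_linear_compose[OF bounded_linear_scaleR_left] \<psi>)
  obtain f where f: "linear f" "f (P v) = norm (P v)" "\<And>x. \<bar>f x\<bar> \<le> norm x"
    using hahn_banach_seminorm[of norm "P v"] norm_triangle_ineq by (metis norm_ge_zero norm_scaleR)
  then have blf: "bounded_linear f"
    by (intro bounded_linear_intro[of f 1]) (auto simp: linear_add linear_scale)
  define g where "g x = f (P x) / norm (P v)" for x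
  have blg: "bounded_linear g"
    unfolding g_def
    by (intro bounded_linear_compose[OF bounded_linear_divide] bounded_linear_compose[OF blf] blP)
  have g: "g v = 1" "\<And>c. c \<in> B \<Longrightarrow> g c = 0"
    using f Pv by (auto simp: g_def P0 linear_0)
  define \<psi>' where "\<psi>' b = (if b = v then g else (\<lambda>x. \<psi> b x - \<psi> b v * g x))" for b
  have "bounded_linear (\<psi>' b)" if "b \<in> insert v B" for b
    using that \<psi>(1)[of b] blg
    by (auto simp: \<psi>'_def intro!: bounded_linear_sub bounded_linear_const_mult)
  moreover have "\<psi>' b c = (if b = c then 1 else 0)" if "b \<in> insert v B" "c \<in> insert v B" for b c
    using that \<psi>(2)[of b c] g insert.hyps by (auto simp: \<psi>'_def)
  ultimately show ?case using insert.prems(1) by blast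
qed

text \<open>The ambient space may be infinite-dimensional, so dimensions are counted inside
  \<open>span C\<close>: a vector missed by \<open>R\<close> would extend the image of a basis to an
  independent set that is too large.\<close>

lemma linear_inj_on_span_surj:
  fixes R :: "'a::real_vector \<Rightarrow> 'a"
  assumes "finite C" "linear R" "R ` span C \<subseteq> span C" "inj_on R (span C)"
  shows "R ` span C = span C"
proof
  obtain B where B: "B \<subseteq> C" "independent B" "span B = span C"
    using maximal_independent_subset[of C]
    by (metis span_eq span_superset subset_trans span_mono span_span)
  have finB: "finite B" using B assms finite_subset by blast
  have indR: "independent (R ` B)"
    using linear_independent_injective_image[OF assms(2)] B assms(4)
    by (metis assms(2) linear_inj_on_span_independent_image)
  have card: "card (R ` B) = card B"
    using B assms(4) by (metis card_image inj_on_subset span_superset)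
  show "span C \<subseteq> R ` span C"
  proof
    fix z assume z: "z \<in> span C"
    have "z \<in> span (R ` B)"
    proof (rule ccontr)
      assume nz: "z \<notin> span (R ` B)"
      then have "independent (insert z (R ` B))"
        using indR by (simp add: independent_insertI)
      moreover have "insert z (R ` B) \<subseteq> span B"
        using z B assms(3) span_superset[of B] by auto
      ultimately have "card (insert z (R ` B)) \<le> card B"
        using independent_span_bound[OF finB] by blast
      moreover have "z \<notin> R ` B" using nz span_base[of z "R ` B"] by auto
      ultimately show False using card finB by simp
    qed
    then show "z \<in> R ` span C"
      using linear_span_image[OF assms(2), of B] B(3) by simp
  qed
qed (use assms in auto)

section \<open>The norm of \<open>\<ell>\<^sub>p\<^sup>n\<close>\<close>

lemma enn2real_ge_1: "1 \<le> p \<Longrightarrow> p \<noteq> \<infinity> \<Longrightarrow> 1 \<le> enn2real p"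
  using enn2real_mono[of 1 p] by (simp add: less_top)

lemma lp_norm_nonneg: "0 \<le> lp_norm p m c"
  by (auto simp: lp_norm_def)

lemma lp_norm_mono:
  assumes "1 \<le> p" "\<And>i. i < m \<Longrightarrow> \<bar>c i\<bar> \<le> \<bar>d i\<bar>"
  shows "lp_norm p m c \<le> lp_norm p m d"
proof (cases "p = \<infinity>")
  case True
  have "x \<le> Max (insert 0 ((\<lambda>i. \<bar>d i\<bar>) ` {..<m}))" if x: "x \<in> insert 0 ((\<lambda>i. \<bar>c i\<bar>) ` {..<m})" for x
  proof (cases "x = 0")
    case False
    then obtain i where i: "i < m" "x = \<bar>c i\<bar>" using x by auto
    then have "x \<le> \<bar>d i\<bar>" using assms(2) by simp
    also have "\<dots> \<le> Max (insert 0 ((\<lambda>i. \<bar>d i\<bar>) ` {..<m}))" using i by (intro Max_ge) auto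
    finally show ?thesis .
  qed simp
  then show ?thesis using True by (simp add: lp_norm_def)
next
  case False
  show ?thesis using False assms enn2real_ge_1[OF assms(1) False]
    by (auto simp: lp_norm_def intro!: powr_mono2 sum_mono sum_nonneg)
qed

lemma lp_norm_cong: "(\<And>i. i < m \<Longrightarrow> c i = d i) \<Longrightarrow> lp_norm p m c = lp_norm p m d"
  by (auto simp: lp_norm_def intro!: arg_cong[of _ _ Max] arg_cong[of _ _ "\<lambda>x. x powr _"] sum.cong)

lemma lp_norm_scale:
  assumes "1 \<le> p"
  shows "lp_norm p m (\<lambda>i. r * c i) = \<bar>r\<bar> * lp_norm p m c"
proof (cases "p = \<infinity>")
  case True
  have "insert 0 ((\<lambda>i. \<bar>r * c i\<bar>) ` {..<m}) = (\<lambda>x. \<bar>r\<bar> * x) ` insert 0 ((\<lambda>i. \<bar>c i\<bar>) ` {..<m})"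
    by (auto simp: abs_mult image_iff)
  moreover have "mono (\<lambda>x. \<bar>r\<bar> * x)"
    by (auto intro!: monoI mult_left_mono)
  ultimately show ?thesis
    using True mono_Max_commute[of "\<lambda>x. \<bar>r\<bar> * x" "insert 0 ((\<lambda>i. \<bar>c i\<bar>) ` {..<m})"]
    by (simp add: lp_norm_def del: Max_insert image_insert)
next
  case False
  have "1 \<le> enn2real p" using assms False by (rule enn2real_ge_1)
  then have "\<bar>r\<bar> = (\<bar>r\<bar> powr enn2real p) powr (1 / enn2real p)"
    by (simp add: powr_powr)
  then show ?thesis using False
    by (auto simp: lp_norm_def abs_mult powr_mult sum_nonneg simp flip: sum_distrib_left)
qed

lemma lp_norm_single:
  assumes "1 \<le> p" "i < m"
  shows "lp_norm p m (\<lambda>j. if j = i then r else 0) = \<bar>r\<bar>"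
proof (cases "p = \<infinity>")
  case True
  then show ?thesis using assms
    by (auto simp: lp_norm_def intro!: Max_eqI)
next
  case False
  have P: "1 \<le> enn2real p" using assms False by (intro enn2real_ge_1)
  have "(\<Sum>j<m. \<bar>if j = i then r else 0\<bar> powr enn2real p) = (\<Sum>j<m. if j = i then \<bar>r\<bar> powr enn2real p else 0)"
    by (intro sum.cong) auto
  then show ?thesis using False P assms by (simp add: lp_norm_def powr_powr)
qed

lemma coord_le_lp_norm:
  assumes "1 \<le> p" "i < m"
  shows "\<bar>c i\<bar> \<le> lp_norm p m c"
  using lp_norm_mono[OF assms(1), of m "\<lambda>j. if j = i then c i else 0" c] lp_norm_single[OF assms]
  by (auto split: if_splits)

text \<open>The all-ones vector has norm m^(1/p) <= m, which gives a bound uniform in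
  \<open>p\<close>.\<close>

lemma lp_norm_le_const:
  assumes "1 \<le> p" "0 \<le> e" "\<And>i. i < m \<Longrightarrow> \<bar>c i\<bar> \<le> e"
  shows "lp_norm p m c \<le> real m * e"
proof (cases "m = 0")
  case True
  then show ?thesis by (auto simp: lp_norm_def)
next
  case m: False
  have "lp_norm p m c \<le> lp_norm p m (\<lambda>i. e * 1)"
    using assms by (intro lp_norm_mono) auto
  also have "\<dots> = e * lp_norm p m (\<lambda>i. 1)"
    using assms by (subst lp_norm_scale) auto
  finally have *: "lp_norm p m c \<le> e * lp_norm p m (\<lambda>i. 1)"
    using assms(2) by simp
  have "lp_norm p m (\<lambda>i. 1) \<le> real m"
  proof (cases "p = \<infinity>")
    case False
    have "1 \<le> enn2real p" using assms False by (intro enn2real_ge_1)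
    then have "real m powr (1 / enn2real p) \<le> real m powr 1"
      using m by (intro powr_mono) auto
    then show ?thesis using False by (simp add: lp_norm_def)
  qed (use m in \<open>auto simp: lp_norm_def\<close>)
  then have "e * lp_norm p m (\<lambda>i. 1) \<le> e * real m"
    using assms(2) by (rule mult_left_mono)
  with * show ?thesis by (simp add: mult.commute)
qed

lemma powr_add_le:
  fixes x y P :: real
  assumes "0 \<le> x" "0 \<le> y" "0 \<le> P"
  shows "(x + y) powr P \<le> 2 powr P * (x powr P + y powr P)"
proof -
  have "(x + y) powr P \<le> (2 * max x y) powr P"
    using assms by (intro powr_mono2) auto
  also have "\<dots> = 2 powr P * max x y powr P"
    using assms by (simp add: powr_mult)
  also have "max x y powr P \<le> x powr P + y powr P"
    by (auto simp: max_def)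
  finally show ?thesis by simp
qed

text \<open>After scaling to x + y = 1 this is t^P <= t on [0, 1].\<close>

lemma powr_add_le_root:
  fixes x y P :: real
  assumes "0 \<le> x" "0 \<le> y" "1 \<le> P"
  shows "(x powr P + y powr P) powr (1/P) \<le> x + y"
proof (cases "x + y = 0")
  case True
  then show ?thesis using assms by (simp add: add_nonneg_eq_0_iff)
next
  case False
  let ?s = "x + y"
  have s: "?s > 0" using False assms by linarith
  have le: "(z / ?s) powr P \<le> z / ?s" if "0 \<le> z" "z \<le> ?s" for z
    using that s assms powr_mono'[of 1 P "z / ?s"] by (cases "z = 0") auto
  have "x powr P + y powr P = ?s powr P * ((x / ?s) powr P + (y / ?s) powr P)"
    using s assms by (simp add: powr_divide distrib_left)
  also have "\<dots> \<le> ?s powr P * (x / ?s + y / ?s)"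
    using le[of x] le[of y] assms by (intro mult_left_mono add_mono) auto
  also have "x / ?s + y / ?s = 1"
    using s by (simp flip: add_divide_distrib)
  finally have "(x powr P + y powr P) powr (1/P) \<le> (?s powr P) powr (1/P)"
    using assms by (intro powr_mono2) auto
  then show ?thesis using assms s by (simp add: powr_powr)
qed

text \<open>The constant 2 spares Minkowski's inequality.\<close>

lemma lp_norm_quasi_triangle:
  assumes "1 \<le> p"
  shows "lp_norm p m (\<lambda>i. c i + d i) \<le> 2 * (lp_norm p m c + lp_norm p m d)"
proof (cases "p = \<infinity>")
  case True
  have "\<bar>c i + d i\<bar> \<le> 2 * (lp_norm p m c + lp_norm p m d)" if "i < m" for i
    using coord_le_lp_norm[OF assms that, of c] coord_le_lp_norm[OF assms that, of d]
    by (simp add: abs_le_iff)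
  then show ?thesis
    using True lp_norm_nonneg[of p m c] lp_norm_nonneg[of p m d] by (auto simp: lp_norm_def)
next
  case False
  define P where "P = enn2real p"
  have P: "1 \<le> P" unfolding P_def using assms False by (rule enn2real_ge_1)
  let ?C = "\<Sum>i<m. \<bar>c i\<bar> powr P" and ?D = "\<Sum>i<m. \<bar>d i\<bar> powr P"
  have CD: "0 \<le> ?C" "0 \<le> ?D" by (auto intro: sum_nonneg)
  have "(\<Sum>i<m. \<bar>c i + d i\<bar> powr P) \<le> (\<Sum>i<m. 2 powr P * (\<bar>c i\<bar> powr P + \<bar>d i\<bar> powr P))"
  proof (intro sum_mono)
    fix i
    have "\<bar>c i + d i\<bar> powr P \<le> (\<bar>c i\<bar> + \<bar>d i\<bar>) powr P"
      using P by (intro powr_mono2) auto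
    also have "\<dots> \<le> 2 powr P * (\<bar>c i\<bar> powr P + \<bar>d i\<bar> powr P)"
      using P by (intro powr_add_le) auto
    finally show "\<bar>c i + d i\<bar> powr P \<le> 2 powr P * (\<bar>c i\<bar> powr P + \<bar>d i\<bar> powr P)" .
  qed
  also have "\<dots> = 2 powr P * (?C + ?D)"
    by (simp add: sum.distrib sum_distrib_left distrib_left)
  finally have "(\<Sum>i<m. \<bar>c i + d i\<bar> powr P) powr (1/P) \<le> (2 powr P * (?C + ?D)) powr (1/P)"
    using P by (intro powr_mono2) (auto intro: sum_nonneg)
  also have "\<dots> = 2 * (?C + ?D) powr (1/P)"
    using P CD by (simp add: powr_mult powr_powr)
  also have "(?C + ?D) powr (1/P) \<le> ?C powr (1/P) + ?D powr (1/P)"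
    using powr_add_le_root[of "?C powr (1/P)" "?D powr (1/P)" P] P CD by (simp add: powr_powr)
  finally show ?thesis
    using False by (simp add: lp_norm_def P_def)
qed

section \<open>Bases equivalent to the unit vector basis\<close>

text \<open>Only the ratio of the two bounds matters, because an isomorphism onto l_p^m can be
  rescaled. The strict inequality \<open>b < K * a\<close> leaves room for moving the vectors
  slightly without changing \<open>K\<close>.\<close>

definition lp_basis :: "ennreal \<Rightarrow> real \<Rightarrow> nat \<Rightarrow> (nat \<Rightarrow> 'a::real_normed_vector) \<Rightarrow> bool" where
  "lp_basis p K m g \<longleftrightarrow> (\<exists>a b. 0 < a \<and> b < K * a \<and>
     (\<forall>c. a * lp_norm p m c \<le> norm (\<Sum>i<m. c i *\<^sub>R g i) \<and>
          norm (\<Sum>i<m. c i *\<^sub>R g i) \<le> b * lp_norm p m c))"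

definition has_lp_bases :: "ennreal \<Rightarrow> real \<Rightarrow> 'a::real_normed_vector set \<Rightarrow> bool" where
  "has_lp_bases p K S \<longleftrightarrow> (\<forall>B. finite B \<and> B \<subseteq> S \<longrightarrow>
     (\<exists>m g. (\<forall>i<m. g i \<in> S) \<and> B \<subseteq> span (g ` {..<m}) \<and> lp_basis p K m g))"

text \<open>The coefficients are rational so that, for a system of images of vectors of V, the
  approximant again comes from V, where \<open>\<mu>\<close> can be evaluated.\<close>

definition approx_lp_bases :: "ennreal \<Rightarrow> real \<Rightarrow> 'a::real_normed_vector set \<Rightarrow> bool" where
  "approx_lp_bases p K D \<longleftrightarrow> (\<forall>B \<epsilon>. finite B \<and> B \<subseteq> D \<and> 0 < \<epsilon> \<longrightarrow>
     (\<exists>m g. (\<forall>i<m. g i \<in> D) \<and> lp_basis p K m g \<and>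
        (\<forall>x\<in>B. \<exists>q. norm (x - (\<Sum>i<m. real_of_rat (q i) *\<^sub>R g i)) < \<epsilon>)))"

lemma lp_basis_mono: "lp_basis p K m g \<Longrightarrow> K \<le> K' \<Longrightarrow> lp_basis p K' m g"
  unfolding lp_basis_def by (meson less_le_trans less_imp_le mult_right_mono)

lemma has_lp_bases_mono: "has_lp_bases p K S \<Longrightarrow> K \<le> K' \<Longrightarrow> has_lp_bases p K' S"
  unfolding has_lp_bases_def using lp_basis_mono by meson

lemma span_image_lessThan:
  fixes g :: "nat \<Rightarrow> 'a::real_vector"
  shows "span (g ` {..<m}) = range (\<lambda>c. \<Sum>i<m. c i *\<^sub>R g i)" (is "_ = ?R")
proof
  show "?R \<subseteq> span (g ` {..<m})"
    by (safe, rule span_sum, rule span_scale, rule span_base) auto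
  have "subspace ?R"
  proof (rule subspaceI)
    show "0 \<in> ?R" by (rule image_eqI[of _ _ "\<lambda>_. 0"]) auto
  next
    fix x y assume "x \<in> ?R" "y \<in> ?R"
    then obtain c d where "x = (\<Sum>i<m. c i *\<^sub>R g i)" "y = (\<Sum>i<m. d i *\<^sub>R g i)" by auto
    then show "x + y \<in> ?R"
      by (intro image_eqI[of _ _ "\<lambda>i. c i + d i"]) (auto simp: scaleR_add_left sum.distrib)
  next
    fix r x assume "x \<in> ?R"
    then obtain c where "x = (\<Sum>i<m. c i *\<^sub>R g i)" by auto
    then show "r *\<^sub>R x \<in> ?R"
      by (intro image_eqI[of _ _ "\<lambda>i. r * c i"]) (auto simp: scaleR_sum_right)
  qed
  moreover have "g ` {..<m} \<subseteq> ?R"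
  proof safe
    fix i assume i: "i < m"
    have "(\<Sum>j<m. (if j = i then 1 else 0) *\<^sub>R g j) = (\<Sum>j<m. if j = i then g i else 0)"
      by (intro sum.cong) auto
    also have "\<dots> = g i" using i by simp
    finally show "g i \<in> ?R"
      by (intro image_eqI[of _ _ "\<lambda>j. if j = i then 1 else 0"]) (simp, simp)
  qed
  ultimately show "span (g ` {..<m}) \<subseteq> ?R"
    by (rule span_minimal[rotated])
qed

text \<open>Given approximations \<open>u b\<close> of basis vectors \<open>b\<close> in the span of \<open>w\<close>, the near-identity
  \<open>R\<close> maps each \<open>b\<close> to \<open>u b\<close>; the preimages of \<open>w\<close> under \<open>R\<close> then span a space
  containing every \<open>b\<close>.\<close>

lemma has_lp_bases_if_approx:
  fixes S :: "'a::real_normed_vector set"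
  assumes S: "subspace S" and D: "D \<subseteq> S" "S \<subseteq> closure D" and approx: "approx_lp_bases p K D"
  shows "has_lp_bases p (3 * K) S"
  unfolding has_lp_bases_def
proof (intro allI impI, elim conjE)
  fix B assume finB: "finite B" and BS: "B \<subseteq> S"
  obtain B0 where B0: "B0 \<subseteq> B" "independent B0" "span B0 = span B"
    using maximal_independent_subset[of B]
    by (metis span_eq span_superset subset_trans span_mono span_span)
  have finB0: "finite B0" using B0 finB finite_subset by blast
  obtain \<psi> :: "'a \<Rightarrow> 'a \<Rightarrow> real" where
    bl: "\<And>b. b \<in> B0 \<Longrightarrow> bounded_linear (\<psi> b)" and
    \<psi>: "\<And>b c. b \<in> B0 \<Longrightarrow> c \<in> B0 \<Longrightarrow> \<psi> b c = (if b = c then 1 else 0)"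
    using biorthogonal_functionals[OF finB0 B0(2)] by blast
  have "\<exists>M. \<forall>b\<in>B0. 0 < M b \<and> (\<forall>x. \<bar>\<psi> b x\<bar> \<le> norm x * M b)"
    using bounded_linear.pos_bounded[OF bl] by (intro bchoice) auto
  then obtain M where M: "\<And>b. b \<in> B0 \<Longrightarrow> 0 < M b" "\<And>b x. b \<in> B0 \<Longrightarrow> \<bar>\<psi> b x\<bar> \<le> norm x * M b"
    by blast
  \<comment> \<open>Chosen so that \<open>E\<close> below, with its coefficients bounded by
    \<open>M\<close> and its vectors \<open>b - u b\<close> shorter than \<open>\<epsilon>\<close>,
    has norm at most 1/2. The summand 1 keeps the denominator positive when \<open>B0\<close> is
    empty.\<close>
  define \<epsilon> where "\<epsilon> = 1 / (2 * (1 + (\<Sum>b\<in>B0. M b)))"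
  have sM: "0 \<le> (\<Sum>b\<in>B0. M b)" using M(1) by (intro sum_nonneg) (auto intro: less_imp_le)
  have \<epsilon>: "0 < \<epsilon>" "\<epsilon> * (\<Sum>b\<in>B0. M b) \<le> 1/2"
    using sM by (auto simp: \<epsilon>_def field_simps)
  \<comment> \<open>The hypothesis only approximates members of \<open>D\<close>, so each basis
    vector is first moved into \<open>D\<close>; the two steps share the tolerance
    \<open>\<epsilon>\<close>.\<close>
  have "\<exists>d. \<forall>b\<in>B0. d b \<in> D \<and> dist (d b) b < \<epsilon> / 2"
    using B0 BS D \<epsilon> by (intro bchoice) (meson closure_approachable half_gt_zero subsetD)
  then obtain d where d: "\<And>b. b \<in> B0 \<Longrightarrow> d b \<in> D" "\<And>b. b \<in> B0 \<Longrightarrow> dist (d b) b < \<epsilon> / 2"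
    by blast
  obtain m w where w: "\<And>i. i < m \<Longrightarrow> w i \<in> D" "lp_basis p K m w"
    and q: "\<forall>x\<in>d ` B0. \<exists>q. norm (x - (\<Sum>i<m. real_of_rat (q i) *\<^sub>R w i)) < \<epsilon> / 2"
    using approx[unfolded approx_lp_bases_def, rule_format, of "d ` B0" "\<epsilon> / 2"] finB0 d(1) \<epsilon>(1)
    by auto
  have "\<exists>u. \<forall>b\<in>B0. u b \<in> span (w ` {..<m}) \<and> norm (b - u b) < \<epsilon>"
  proof (intro bchoice ballI)
    fix b assume b: "b \<in> B0"
    then obtain q where "norm (d b - (\<Sum>i<m. real_of_rat (q i) *\<^sub>R w i)) < \<epsilon> / 2"
      using q by blast
    then have "norm (b - (\<Sum>i<m. real_of_rat (q i) *\<^sub>R w i)) < \<epsilon>"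
      using d(2)[OF b] norm_triangle_lt[of "b - d b" "d b - (\<Sum>i<m. real_of_rat (q i) *\<^sub>R w i)" \<epsilon>]
      by (simp add: dist_norm norm_minus_commute)
    moreover have "(\<Sum>i<m. real_of_rat (q i) *\<^sub>R w i) \<in> span (w ` {..<m})"
      by (rule span_sum, rule span_scale, rule span_base) auto
    ultimately show "\<exists>u. u \<in> span (w ` {..<m}) \<and> norm (b - u) < \<epsilon>"
      by blast
  qed
  then obtain u where u: "\<And>b. b \<in> B0 \<Longrightarrow> u b \<in> span (w ` {..<m})"
    "\<And>b. b \<in> B0 \<Longrightarrow> norm (b - u b) < \<epsilon>" by blast
  define E where "E x = (\<Sum>b\<in>B0. \<psi> b x *\<^sub>R (b - u b))" for x
  define R where "R x = x - E x" for x
  have linE: "linear E"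
    unfolding E_def
    by (intro linear_compose_sum ballI bounded_linear.linear[OF bounded_linear_compose[OF bounded_linear_scaleR_left]] bl)
  have linR: "linear R"
    unfolding R_def by (intro linear_compose_sub linear_id[unfolded id_def] linE)
  have normE: "norm (E x) \<le> norm x / 2" for x
  proof -
    have "norm (E x) \<le> (\<Sum>b\<in>B0. norm x * M b * \<epsilon>)"
      unfolding E_def using M u(2)
      by (intro sum_norm_le) (auto intro!: mult_mono less_imp_le[OF u(2)] mult_nonneg_nonneg less_imp_le[OF M(1)])
    also have "\<dots> = norm x * (\<epsilon> * (\<Sum>b\<in>B0. M b))"
      by (simp add: sum_distrib_left mult_ac)
    also have "\<dots> \<le> norm x * (1/2)"
      using \<epsilon>(2) by (intro mult_left_mono) auto
    finally show ?thesis by simp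
  qed
  \<comment> \<open>Since \<open>E\<close> has norm at most 1/2, the norm of \<open>R x\<close> lies
    between 1/2 and 3/2 times that of \<open>x\<close>. This distortion is the factor 3.\<close>
  have Rlow: "norm x \<le> 2 * norm (R x)" for x
    using normE[of x] norm_triangle_ineq2[of x "E x"] by (simp add: R_def)
  have Rup: "norm (R x) \<le> 3/2 * norm x" for x
    using normE[of x] norm_triangle_ineq4[of x "E x"] by (simp add: R_def)
  have injR: "inj R"
  proof (subst linear_injective_0[OF linR], intro allI impI)
    fix x assume "R x = 0"
    then show "x = 0" using Rlow[of x] by simp
  qed
  have Rb: "R b = u b" if "b \<in> B0" for b
  proof -
    have "E b = (\<Sum>c\<in>B0. if c = b then b - u b else 0)"
      unfolding E_def using that \<psi> by (intro sum.cong) auto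
    then show ?thesis using that finB0 by (simp add: R_def)
  qed
  let ?Z = "span (B0 \<union> w ` {..<m})"
  have ZS: "?Z \<subseteq> S"
    using B0 BS w(1) D(1) by (intro span_minimal S) auto
  have u': "u b \<in> ?Z" if "b \<in> B0" for b
    using u(1)[OF that] span_mono[of "w ` {..<m}" "B0 \<union> w ` {..<m}"] by auto
  have "R x \<in> ?Z" if "x \<in> ?Z" for x
    unfolding R_def E_def using that u'
    by (intro span_diff span_sum span_scale) (auto intro: span_base)
  then have surj: "R ` ?Z = ?Z"
    using finB0 injR by (intro linear_inj_on_span_surj linR) (auto intro: inj_on_subset)
  define g where "g i = inv_into ?Z R (w i)" for i
  have g: "g i \<in> ?Z" "R (g i) = w i" if "i < m" for i
  proof -
    have "w i \<in> R ` ?Z" using that unfolding surj by (auto intro: span_base)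
    then show "g i \<in> ?Z" "R (g i) = w i"
      unfolding g_def by (auto intro: inv_into_into f_inv_into_f)
  qed
  have Rsum: "R (\<Sum>i<m. c i *\<^sub>R g i) = (\<Sum>i<m. c i *\<^sub>R w i)" for c
    using g(2) by (simp add: linear_sum[OF linR] linear_scale[OF linR])
  have "B0 \<subseteq> span (g ` {..<m})"
  proof
    fix b assume b: "b \<in> B0"
    obtain c where "u b = (\<Sum>i<m. c i *\<^sub>R w i)"
      using u(1)[OF b] unfolding span_image_lessThan by auto
    then have "R b = R (\<Sum>i<m. c i *\<^sub>R g i)"
      unfolding Rb[OF b] Rsum .
    then have "b = (\<Sum>i<m. c i *\<^sub>R g i)"
      by (rule injD[OF injR])
    also have "\<dots> \<in> span (g ` {..<m})"
      by (rule span_sum, rule span_scale, rule span_base) auto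
    finally show "b \<in> span (g ` {..<m})" .
  qed
  then have "span B0 \<subseteq> span (g ` {..<m})"
    by (intro span_minimal subspace_span)
  then have "B \<subseteq> span (g ` {..<m})"
    using B0(3) span_superset by blast
  moreover have "lp_basis p (3 * K) m g"
  proof -
    obtain a b where ab: "0 < a" "b < K * a"
      "\<And>c. a * lp_norm p m c \<le> norm (\<Sum>i<m. c i *\<^sub>R w i)"
      "\<And>c. norm (\<Sum>i<m. c i *\<^sub>R w i) \<le> b * lp_norm p m c"
      using w(2) unfolding lp_basis_def by blast
    have "(2/3 * a) * lp_norm p m c \<le> norm (\<Sum>i<m. c i *\<^sub>R g i)
        \<and> norm (\<Sum>i<m. c i *\<^sub>R g i) \<le> (2 * b) * lp_norm p m c" for c
      using ab(3,4)[of c] Rlow[of "\<Sum>i<m. c i *\<^sub>R g i"] Rup[of "\<Sum>i<m. c i *\<^sub>R g i"]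
      by (simp add: Rsum)
    then show ?thesis
      using ab(1,2) unfolding lp_basis_def by (intro exI[of _ "2/3 * a"] exI[of _ "2 * b"]) auto
  qed
  ultimately show "\<exists>m g. (\<forall>i<m. g i \<in> S) \<and> B \<subseteq> span (g ` {..<m}) \<and> lp_basis p (3 * K) m g"
    using g(1) ZS by blast
qed

text \<open>Replacing each \<open>g i\<close> by a nearby vector of \<open>D\<close> changes a
  combination by at most \<open>\<delta>\<close> times the sum of the
  \<open>\<bar>c i\<bar>\<close>, hence by at most \<open>\<delta> * real m\<close> times the
  l_p-norm of \<open>c\<close>. The slack in \<open>b < K * a\<close> absorbs this, so
  \<open>K\<close> stays the same.\<close>

lemma approx_if_has_lp_bases:
  fixes S :: "'a::real_normed_vector set"
  assumes p: "1 \<le> p" and D: "D \<subseteq> S" "S \<subseteq> closure D" and has: "has_lp_bases p K S"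
  shows "approx_lp_bases p K D"
  unfolding approx_lp_bases_def
proof (intro allI impI, elim conjE)
  fix B and \<epsilon> :: real assume finB: "finite B" and BD: "B \<subseteq> D" and \<epsilon>: "0 < \<epsilon>"
  obtain m g where g: "\<And>i. i < m \<Longrightarrow> g i \<in> S" "B \<subseteq> span (g ` {..<m})" "lp_basis p K m g"
    using has finB BD D(1) unfolding has_lp_bases_def by (metis subset_trans)
  obtain a b where ab: "0 < a" "b < K * a"
      "\<And>c. a * lp_norm p m c \<le> norm (\<Sum>i<m. c i *\<^sub>R g i)"
      "\<And>c. norm (\<Sum>i<m. c i *\<^sub>R g i) \<le> b * lp_norm p m c"
    using g(3) unfolding lp_basis_def by blast
  have "\<forall>x\<in>B. \<exists>r. x = (\<Sum>i<m. r i *\<^sub>R g i)"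
    using g(2) unfolding span_image_lessThan by blast
  then obtain r where r: "\<And>x. x \<in> B \<Longrightarrow> x = (\<Sum>i<m. r x i *\<^sub>R g i)"
    using bchoice[of B "\<lambda>x r. x = (\<Sum>i<m. r i *\<^sub>R g i)"] by blast
  \<comment> \<open>A common bound for the coefficient sums of all members of \<open>B\<close>, so
    that one \<open>\<delta>\<close> serves them all.\<close>
  define Q where "Q = (\<Sum>x\<in>B. \<Sum>i<m. \<bar>r x i\<bar>)"
  \<comment> \<open>Apart from positivity of \<open>\<delta>\<close>, the required strict
    inequalities hold at \<open>\<delta> = 0\<close> and persist for small \<open>\<delta>\<close>
    by continuity.\<close>
  have "\<exists>\<delta>>0. \<delta> * Q < \<epsilon> / 2 \<and> 0 < a - \<delta> * real m \<and> b + \<delta> * real m < K * (a - \<delta> * real m)"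
  proof -
    have 1: "((\<lambda>\<delta>. \<delta> * Q) \<longlongrightarrow> 0 * Q) (at_right 0)"
      and 2: "((\<lambda>\<delta>. a - \<delta> * real m) \<longlongrightarrow> a - 0 * real m) (at_right 0)"
      and 3: "((\<lambda>\<delta>. K * (a - \<delta> * real m) - (b + \<delta> * real m)) \<longlongrightarrow> K * (a - 0 * real m) - (b + 0 * real m)) (at_right 0)"
      by (intro tendsto_intros)+
    have "\<forall>\<^sub>F \<delta> in at_right 0. \<delta> * Q < \<epsilon> / 2" by (rule order_tendstoD(2)[OF 1]) (use \<epsilon> in simp)
    moreover have "\<forall>\<^sub>F \<delta> in at_right 0. 0 < a - \<delta> * real m" by (rule order_tendstoD(1)[OF 2]) (use ab in simp)
    moreover have "\<forall>\<^sub>F \<delta> in at_right 0. 0 < K * (a - \<delta> * real m) - (b + \<delta> * real m)"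
      by (rule order_tendstoD(1)[OF 3]) (use ab in simp)
    moreover have "\<forall>\<^sub>F \<delta>::real in at_right 0. 0 < \<delta>" by (simp add: eventually_at_right_less)
    ultimately have "\<forall>\<^sub>F \<delta> in at_right 0. 0 < \<delta> \<and> \<delta> * Q < \<epsilon> / 2 \<and> 0 < a - \<delta> * real m \<and> b + \<delta> * real m < K * (a - \<delta> * real m)"
      by eventually_elim simp
    then show ?thesis
      using eventually_happens'[OF trivial_limit_at_right_real] by blast
  qed
  then obtain \<delta> where \<delta>: "\<delta> > 0" "\<delta> * Q < \<epsilon> / 2" "0 < a - \<delta> * real m" "b + \<delta> * real m < K * (a - \<delta> * real m)"
    by blast
  have "\<forall>i\<in>{..<m}. \<exists>y. y \<in> D \<and> norm (g i - y) < \<delta>"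
  proof
    fix i assume "i \<in> {..<m}"
    then have "g i \<in> closure D" using g(1) D(2) by auto
    then obtain y where "y \<in> D" "dist y (g i) < \<delta>"
      using \<delta>(1) by (auto simp: closure_approachable)
    then show "\<exists>y. y \<in> D \<and> norm (g i - y) < \<delta>"
      by (auto simp: dist_norm norm_minus_commute)
  qed
  then obtain w where w: "\<And>i. i < m \<Longrightarrow> w i \<in> D" "\<And>i. i < m \<Longrightarrow> norm (g i - w i) < \<delta>"
    by (metis lessThan_iff)
  have diff: "norm ((\<Sum>i<m. c i *\<^sub>R g i) - (\<Sum>i<m. c i *\<^sub>R w i)) \<le> \<delta> * (\<Sum>i<m. \<bar>c i\<bar>)" for c
  proof -
    have "norm (\<Sum>i<m. c i *\<^sub>R (g i - w i)) \<le> (\<Sum>i<m. \<bar>c i\<bar> * \<delta>)"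
      using less_imp_le[OF w(2)] by (intro sum_norm_le) (auto intro!: mult_left_mono)
    also have "\<dots> = \<delta> * (\<Sum>i<m. \<bar>c i\<bar>)"
      by (simp add: sum_distrib_left mult.commute)
    finally show ?thesis by (simp add: scaleR_diff_right sum_subtractf)
  qed
  have "lp_basis p K m w"
    unfolding lp_basis_def
  proof (intro exI conjI allI)
    fix c
    have "(\<Sum>i<m. \<bar>c i\<bar>) \<le> (\<Sum>i<m. lp_norm p m c)"
      using p by (intro sum_mono coord_le_lp_norm) auto
    then have "\<delta> * (\<Sum>i<m. \<bar>c i\<bar>) \<le> \<delta> * (real m * lp_norm p m c)"
      using \<delta>(1) by (intro mult_left_mono) auto
    then have *: "norm ((\<Sum>i<m. c i *\<^sub>R g i) - (\<Sum>i<m. c i *\<^sub>R w i)) \<le> \<delta> * real m * lp_norm p m c"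
      using diff[of c] by (simp add: mult.assoc)
    show "(a - \<delta> * real m) * lp_norm p m c \<le> norm (\<Sum>i<m. c i *\<^sub>R w i)"
      using * ab(3)[of c] norm_triangle_ineq2[of "\<Sum>i<m. c i *\<^sub>R g i" "\<Sum>i<m. c i *\<^sub>R w i"]
      by (simp add: left_diff_distrib)
    show "norm (\<Sum>i<m. c i *\<^sub>R w i) \<le> (b + \<delta> * real m) * lp_norm p m c"
      using * ab(4)[of c] norm_triangle_ineq2[of "\<Sum>i<m. c i *\<^sub>R w i" "\<Sum>i<m. c i *\<^sub>R g i"]
      by (simp add: distrib_right norm_minus_commute)
  qed (use \<delta> in auto)
  moreover have "\<exists>q. norm (x - (\<Sum>i<m. real_of_rat (q i) *\<^sub>R w i)) < \<epsilon>" if x: "x \<in> B" for x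
  proof -
    have "(\<Sum>i<m. \<bar>r x i\<bar>) \<le> Q"
      unfolding Q_def using finB x by (intro member_le_sum[of x B "\<lambda>x. \<Sum>i<m. \<bar>r x i\<bar>"]) (auto intro: sum_nonneg)
    then have "\<delta> * (\<Sum>i<m. \<bar>r x i\<bar>) \<le> \<delta> * Q"
      using \<delta>(1) by (intro mult_left_mono) auto
    then have 1: "norm (x - (\<Sum>i<m. r x i *\<^sub>R w i)) < \<epsilon> / 2"
      using diff[of "r x"] r[OF x] \<delta>(2) by simp
    define W where "W = (\<Sum>i<m. norm (w i))"
    have W: "0 \<le> W" by (auto simp: W_def intro: sum_nonneg)
    \<comment> \<open>Rounding the coefficients to rationals within \<open>\<eta>\<close> costs at
      most \<open>\<eta> * W\<close>, which is the remaining half of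
      \<open>\<epsilon>\<close>.\<close>
    define \<eta> where "\<eta> = \<epsilon> / (2 * (W + 1))"
    have \<eta>: "\<eta> > 0" using \<epsilon> W by (auto simp: \<eta>_def)
    have "\<forall>i. \<exists>q. \<bar>r x i - real_of_rat q\<bar> < \<eta>"
    proof
      fix i
      obtain q where "r x i - \<eta> < real_of_rat q" "real_of_rat q < r x i + \<eta>"
        using of_rat_dense[of "r x i - \<eta>" "r x i + \<eta>"] \<eta> by auto
      then have "\<bar>r x i - real_of_rat q\<bar> < \<eta>" by (simp add: abs_less_iff)
      then show "\<exists>q. \<bar>r x i - real_of_rat q\<bar> < \<eta>" ..
    qed
    then obtain q where q: "\<And>i. \<bar>r x i - real_of_rat (q i)\<bar> < \<eta>" by metis
    have "norm (\<Sum>i<m. (r x i - real_of_rat (q i)) *\<^sub>R w i) \<le> (\<Sum>i<m. \<eta> * norm (w i))"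
      using less_imp_le[OF q] by (intro sum_norm_le) (auto intro!: mult_right_mono)
    also have "\<dots> = \<eta> * W" by (simp add: W_def sum_distrib_left)
    also have "\<dots> \<le> \<epsilon> / 2" using W \<epsilon> by (simp add: \<eta>_def field_simps)
    finally have "norm ((\<Sum>i<m. r x i *\<^sub>R w i) - (\<Sum>i<m. real_of_rat (q i) *\<^sub>R w i)) \<le> \<epsilon> / 2"
      by (simp add: scaleR_diff_left sum_subtractf)
    then show ?thesis
      using 1 norm_triangle_lt[of "x - (\<Sum>i<m. r x i *\<^sub>R w i)"
          "(\<Sum>i<m. r x i *\<^sub>R w i) - (\<Sum>i<m. real_of_rat (q i) *\<^sub>R w i)" \<epsilon>]
      by (intro exI[of _ q]) simp
  qed
  ultimately show "\<exists>m g. (\<forall>i<m. g i \<in> D) \<and> lp_basis p K m g \<and>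
        (\<forall>x\<in>B. \<exists>q. norm (x - (\<Sum>i<m. real_of_rat (q i) *\<^sub>R g i)) < \<epsilon>)"
    using w(1) by blast
qed

section \<open>Script-\<open>L\<^sub>p\<close>-spaces in terms of bases\<close>

text \<open>This carries record spaces into a type of normed spaces, where spans and independence
  are at hand. The conjunct \<open>linear_subspace X (vecs X)\<close> says that the carrier is
  closed under the operations, which a record does not enforce.\<close>

definition isometric_embedding :: "'a nspace \<Rightarrow> ('a \<Rightarrow> 'b::real_normed_vector) \<Rightarrow> bool" where
  "isometric_embedding X \<theta> \<longleftrightarrow> linear_subspace X (vecs X) \<and> inj_on \<theta> (vecs X) \<and> \<theta> (vzero X) = 0 \<and>
     (\<forall>x\<in>vecs X. \<forall>y\<in>vecs X. \<theta> (vadd X x y) = \<theta> x + \<theta> y) \<and>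
     (\<forall>r. \<forall>x\<in>vecs X. \<theta> (vscale X r x) = r *\<^sub>R \<theta> x) \<and>
     (\<forall>x\<in>vecs X. vnorm X x = norm (\<theta> x))"

lemma isometric_embeddingD:
  assumes "isometric_embedding X \<theta>"
  shows "vzero X \<in> vecs X" "\<theta> (vzero X) = 0" "inj_on \<theta> (vecs X)"
    "\<And>x y. x \<in> vecs X \<Longrightarrow> y \<in> vecs X \<Longrightarrow> vadd X x y \<in> vecs X"
    "\<And>r x. x \<in> vecs X \<Longrightarrow> vscale X r x \<in> vecs X"
    "\<And>x y. x \<in> vecs X \<Longrightarrow> y \<in> vecs X \<Longrightarrow> \<theta> (vadd X x y) = \<theta> x + \<theta> y"
    "\<And>r x. x \<in> vecs X \<Longrightarrow> \<theta> (vscale X r x) = r *\<^sub>R \<theta> x"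
    "\<And>x. x \<in> vecs X \<Longrightarrow> vnorm X x = norm (\<theta> x)"
  using assms by (auto simp: isometric_embedding_def linear_subspace_def)

lemma isometric_embedding_restrict:
  assumes "isometric_embedding X \<theta>" "linear_subspace X E"
  shows "isometric_embedding (restrict_to X E) \<theta>"
  using assms unfolding isometric_embedding_def linear_subspace_def restrict_to_def
  by (auto simp: subset_iff intro: inj_on_subset)

lemma vecs_restrict_to [simp]: "vecs (restrict_to X E) = E"
  by (simp add: restrict_to_def)

lemma subspace_isometric_image:
  assumes "isometric_embedding X \<theta>"
  shows "subspace (\<theta> ` vecs X)"
proof (rule subspaceI)
  note X = isometric_embeddingD[OF assms]
  show "0 \<in> \<theta> ` vecs X" using X(1,2) by force
  fix x y assume "x \<in> \<theta> ` vecs X" "y \<in> \<theta> ` vecs X"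
  then show "x + y \<in> \<theta> ` vecs X" using X(4,6) by (auto simp flip: X(6))
next
  note X = isometric_embeddingD[OF assms]
  fix r x assume "x \<in> \<theta> ` vecs X"
  then show "r *\<^sub>R x \<in> \<theta> ` vecs X" using X(5,7) by (auto simp flip: X(7))
qed

lemma lincomb_isometric:
  assumes "isometric_embedding X \<theta>" "\<And>i. i < n \<Longrightarrow> b i \<in> vecs X"
  shows "lincomb X c b n \<in> vecs X \<and> \<theta> (lincomb X c b n) = (\<Sum>i<n. c i *\<^sub>R \<theta> (b i))"
  using assms(2) by (induction n) (auto simp: isometric_embeddingD[OF assms(1)])

lemma spanned_by_size_iff:
  assumes emb: "isometric_embedding X \<theta>"
  shows "spanned_by_size X n \<longleftrightarrow> (\<exists>v. \<theta> ` vecs X = span (v ` {..<n}))"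
proof
  assume "spanned_by_size X n"
  then obtain b where b: "\<And>i. i < n \<Longrightarrow> b i \<in> vecs X" "vecs X = range (\<lambda>c. lincomb X c b n)"
    by (auto simp: spanned_by_size_def)
  have "\<theta> ` vecs X = range (\<lambda>c. \<Sum>i<n. c i *\<^sub>R \<theta> (b i))"
    using lincomb_isometric[OF emb b(1)] by (subst b(2)) (auto simp: image_image)
  then show "\<exists>v. \<theta> ` vecs X = span (v ` {..<n})"
    by (intro exI[of _ "\<lambda>i. \<theta> (b i)"]) (simp add: span_image_lessThan)
next
  assume "\<exists>v. \<theta> ` vecs X = span (v ` {..<n})"
  then obtain v where v: "\<theta> ` vecs X = span (v ` {..<n})" by blast
  define b where "b i = inv_into (vecs X) \<theta> (v i)" for i
  have "v i \<in> \<theta> ` vecs X" if "i < n" for i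
    unfolding v using that by (auto intro: span_base)
  then have b: "\<And>i. i < n \<Longrightarrow> b i \<in> vecs X" "\<And>i. i < n \<Longrightarrow> \<theta> (b i) = v i"
    unfolding b_def by (auto intro: inv_into_into f_inv_into_f)
  note l = lincomb_isometric[OF emb b(1), of n]
  have "vecs X = range (\<lambda>c. lincomb X c b n)"
  proof safe
    fix x assume x: "x \<in> vecs X"
    then have "\<theta> x \<in> span (v ` {..<n})" using v by auto
    then obtain c where c: "\<theta> x = (\<Sum>i<n. c i *\<^sub>R v i)"
      by (auto simp: span_image_lessThan)
    then have "\<theta> x = \<theta> (lincomb X c b n)" using l b(2) by simp
    then have "x = lincomb X c b n"
      using isometric_embeddingD(3)[OF emb] x l by (meson inj_onD)
    then show "x \<in> range (\<lambda>c. lincomb X c b n)" by simp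
  qed (use l in auto)
  then show "spanned_by_size X n"
    using b(1) by (auto simp: spanned_by_size_def)
qed

lemma independent_family:
  fixes g :: "nat \<Rightarrow> 'a::real_vector"
  assumes "\<And>c i. (\<Sum>i<m. c i *\<^sub>R g i) = 0 \<Longrightarrow> i < m \<Longrightarrow> c i = 0"
  shows "independent (g ` {..<m}) \<and> inj_on g {..<m}"
  using assms
proof (induction m)
  case (Suc m)
  have "c i = 0" if "(\<Sum>i<m. c i *\<^sub>R g i) = 0" "i < m" for c i
  proof -
    have "(\<Sum>i<Suc m. (if i < m then c i else 0) *\<^sub>R g i) = 0"
      using that(1) by simp
    from Suc.prems[OF this, of i] show ?thesis using that(2) by simp
  qed
  then have IH: "independent (g ` {..<m})" "inj_on g {..<m}" using Suc.IH by blast+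
  have "g m \<notin> span (g ` {..<m})"
  proof
    assume "g m \<in> span (g ` {..<m})"
    then obtain c where "g m = (\<Sum>i<m. c i *\<^sub>R g i)" by (auto simp: span_image_lessThan)
    then have "(\<Sum>i<Suc m. (if i < m then c i else -1) *\<^sub>R g i) = 0" by simp
    from Suc.prems[OF this, of m] show False by simp
  qed
  then show ?case
    using IH span_base[of "g m" "g ` {..<m}"]
    by (auto simp: lessThan_Suc independent_insert)
qed (simp add: independent_empty)

lemma vdim_eq:
  fixes g :: "nat \<Rightarrow> 'b::real_normed_vector"
  assumes emb: "isometric_embedding X \<theta>" and g: "\<theta> ` vecs X = span (g ` {..<m})"
    and ind: "\<And>c i. (\<Sum>i<m. c i *\<^sub>R g i) = 0 \<Longrightarrow> i < m \<Longrightarrow> c i = 0"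
  shows "vdim X = m"
  unfolding vdim_def
proof (rule Least_equality)
  show "spanned_by_size X m" using spanned_by_size_iff[OF emb] g by blast
  fix n assume "spanned_by_size X n"
  then obtain v where v: "span (g ` {..<m}) = span (v ` {..<n})"
    using spanned_by_size_iff[OF emb] g by auto
  have i: "independent (g ` {..<m})" "inj_on g {..<m}"
    using independent_family[of g m] ind by blast+
  have "m = card (g ` {..<m})" using i(2) by (simp add: card_image)
  also have "\<dots> \<le> card (v ` {..<n})"
    using independent_span_bound[of "v ` {..<n}" "g ` {..<m}"] i(1) v span_superset[of "g ` {..<m}"] by auto
  also have "\<dots> \<le> n" using card_image_le[of "{..<n}" v] by simp
  finally show "m \<le> n" .
qed

section \<open>Operator norms and the Banach--Mazur distance to l_p^m\<close>

text \<open>The point \<open>x0\<close> keeps the set under the real-valued supremum nonempty, and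
  \<open>C\<close> bounds it; without both the supremum would say nothing.\<close>

lemma opnorm_bounds:
  assumes "x0 \<in> vecs X" "vnorm X x0 \<le> 1" "0 \<le> vnorm Y (T x0)"
    and "\<And>x. x \<in> vecs X \<Longrightarrow> vnorm X x \<le> 1 \<Longrightarrow> vnorm Y (T x) \<le> C"
  shows "0 \<le> opnorm X Y T" "opnorm X Y T \<le> C"
proof -
  have "bdd_above ((\<lambda>x. vnorm Y (T x)) ` {x \<in> vecs X. vnorm X x \<le> 1})"
    using assms(4) by (intro bdd_aboveI[of _ C]) auto
  then have "vnorm Y (T x0) \<le> opnorm X Y T"
    unfolding opnorm_def using assms(1,2) by (intro cSUP_upper) auto
  then show "0 \<le> opnorm X Y T" using assms(3) by linarith
  show "opnorm X Y T \<le> C"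
    unfolding opnorm_def using assms by (intro cSUP_least) auto
qed

lemma opnorm_bound:
  assumes bdd: "\<And>x. x \<in> vecs X \<Longrightarrow> vnorm Y (T x) \<le> C * vnorm X x"
    and sc: "\<And>r x. x \<in> vecs X \<Longrightarrow> vscale X r x \<in> vecs X \<and> vnorm X (vscale X r x) = \<bar>r\<bar> * vnorm X x
       \<and> vnorm Y (T (vscale X r x)) = \<bar>r\<bar> * vnorm Y (T x)"
    and nn: "\<And>x. x \<in> vecs X \<Longrightarrow> 0 \<le> vnorm X x"
    and x: "x \<in> vecs X"
  shows "vnorm Y (T x) \<le> opnorm X Y T * vnorm X x"
proof (cases "vnorm X x = 0")
  case True
  then show ?thesis using bdd[OF x] by simp
next
  case False
  then have pos: "0 < vnorm X x" using nn[OF x] by simp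
  have "vnorm Y (T y) \<le> \<bar>C\<bar>" if "y \<in> vecs X" "vnorm X y \<le> 1" for y
  proof -
    have "vnorm Y (T y) \<le> C * vnorm X y" using bdd that by blast
    also have "\<dots> \<le> \<bar>C\<bar> * vnorm X y" using nn[OF that(1)] by (intro mult_right_mono) auto
    also have "\<dots> \<le> \<bar>C\<bar>" using that(2) by (simp add: mult_left_le)
    finally show ?thesis .
  qed
  then have "bdd_above ((\<lambda>x. vnorm Y (T x)) ` {x \<in> vecs X. vnorm X x \<le> 1})"
    by (intro bdd_aboveI[of _ "\<bar>C\<bar>"]) auto
  moreover have "vscale X (1 / vnorm X x) x \<in> {x \<in> vecs X. vnorm X x \<le> 1}"
    using sc[OF x, of "1 / vnorm X x"] pos by simp
  ultimately have "vnorm Y (T (vscale X (1 / vnorm X x) x)) \<le> opnorm X Y T"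
    unfolding opnorm_def by (intro cSUP_upper)
  then show ?thesis
    using sc[OF x, of "1 / vnorm X x"] pos by (simp add: field_simps)
qed

lemma lp_space_simps [simp]:
  "vecs (lp_space p n) = {x. \<forall>i\<ge>n. x i = 0}" "vzero (lp_space p n) = (\<lambda>i. 0)"
  "vadd (lp_space p n) x y = (\<lambda>i. x i + y i)" "vscale (lp_space p n) r x = (\<lambda>i. r * x i)"
  "vnorm (lp_space p n) x = lp_norm p n x"
  by (simp_all add: lp_space_def)

text \<open>The coordinate map \<open>T\<close> of the basis is the witness: the two estimates bound
  \<open>T\<close> by \<open>1 / a\<close> and its inverse by \<open>b\<close>.\<close>

lemma bm_dist_le_if_lp_basis:
  fixes \<theta> :: "'a \<Rightarrow> 'b::real_normed_vector"
  assumes p: "1 \<le> p" and emb: "isometric_embedding X \<theta>" and g: "\<theta> ` vecs X = span (g ` {..<m})"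
    and basis: "lp_basis p K m g" and K: "0 \<le> K"
  shows "vdim X = m" "bm_dist X (lp_space p m) \<le> ereal K"
proof -
  note X = isometric_embeddingD[OF emb]
  obtain a b where ab: "0 < a" "b < K * a"
      "\<And>c. a * lp_norm p m c \<le> norm (\<Sum>i<m. c i *\<^sub>R g i)"
      "\<And>c. norm (\<Sum>i<m. c i *\<^sub>R g i) \<le> b * lp_norm p m c"
    using basis unfolding lp_basis_def by blast
  have ind: "c i = 0" if "(\<Sum>i<m. c i *\<^sub>R g i) = 0" "i < m" for c i
  proof -
    have "a * lp_norm p m c \<le> 0" using ab(3)[of c] that(1) by simp
    then have "lp_norm p m c \<le> 0" using ab(1) by (simp add: mult_le_0_iff)
    then show ?thesis using coord_le_lp_norm[OF p that(2), of c] by simp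
  qed
  show "vdim X = m" using vdim_eq[OF emb g] ind by blast
  let ?L = "vecs (lp_space p m)"
  define \<Phi> where "\<Phi> c = (\<Sum>i<m. c i *\<^sub>R g i)" for c
  have \<Phi>_add: "\<Phi> (\<lambda>i. c i + d i) = \<Phi> c + \<Phi> d" for c d
    by (simp add: \<Phi>_def scaleR_add_left sum.distrib)
  have \<Phi>_scale: "\<Phi> (\<lambda>i. r * c i) = r *\<^sub>R \<Phi> c" for r c
    by (simp add: \<Phi>_def scaleR_sum_right)
  have inj\<Phi>: "inj_on \<Phi> ?L"
  proof (rule inj_onI, rule ext)
    fix c d i assume cd: "c \<in> ?L" "d \<in> ?L" "\<Phi> c = \<Phi> d"
    show "c i = d i"
    proof (cases "i < m")
      case True
      have "(\<Sum>i<m. (c i - d i) *\<^sub>R g i) = 0"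
        using cd(3) by (simp add: \<Phi>_def scaleR_diff_left sum_subtractf)
      from ind[OF this True] show ?thesis by simp
    qed (use cd in auto)
  qed
  have "\<Phi> ` ?L = range \<Phi>"
  proof safe
    fix c
    have "\<Phi> c = \<Phi> (\<lambda>i. if i < m then c i else 0)" by (simp add: \<Phi>_def)
    then show "\<Phi> c \<in> \<Phi> ` ?L" using image_eqI[of "\<Phi> c" \<Phi> "\<lambda>i. if i < m then c i else 0" ?L] by simp
  qed auto
  then have im\<Phi>: "\<Phi> ` ?L = \<theta> ` vecs X"
    by (simp add: g span_image_lessThan \<Phi>_def[abs_def])
  define T where "T x = inv_into ?L \<Phi> (\<theta> x)" for x
  have T: "T x \<in> ?L" "\<Phi> (T x) = \<theta> x" if "x \<in> vecs X" for x
    using that im\<Phi> inv_into_into[of "\<theta> x" \<Phi> ?L] f_inv_into_f[of "\<theta> x" \<Phi> ?L]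
    unfolding T_def by (simp_all only: image_eqI[OF refl])
  have T_eq: "T x = c" if "x \<in> vecs X" "c \<in> ?L" "\<Phi> c = \<theta> x" for x c
    using that T[OF that(1)] inj_onD[OF inj\<Phi>] by metis
  have bij: "bij_betw T (vecs X) ?L"
  proof (rule bij_betw_imageI)
    show "inj_on T (vecs X)"
      using T(2) X(3) by (metis inj_on_def)
    show "T ` vecs X = ?L"
    proof (rule set_eqI, rule iffI)
      fix c assume c: "c \<in> ?L"
      then obtain x where x: "x \<in> vecs X" "\<Phi> c = \<theta> x" using im\<Phi> by (metis imageE image_eqI)
      then show "c \<in> T ` vecs X" using T_eq[OF x(1) c x(2)] by blast
    qed (use T in auto)
  qed
  have T_add: "T (vadd X x y) = vadd (lp_space p m) (T x) (T y)" if "x \<in> vecs X" "y \<in> vecs X" for x y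
    using that T[OF that(1)] T[OF that(2)] X(4,6) by (intro T_eq) (auto simp: \<Phi>_add)
  have T_scale: "T (vscale X r x) = vscale (lp_space p m) r (T x)" if "x \<in> vecs X" for r x
    using that T[OF that] X(5,7) by (intro T_eq) (auto simp: \<Phi>_scale)
  have low: "lp_norm p m (T x) \<le> (1/a) * vnorm X x" if "x \<in> vecs X" for x
    using ab(3)[of "T x"] ab(1) T(2)[OF that] X(8)[OF that] by (simp add: \<Phi>_def field_simps)
  have up: "vnorm X x \<le> b * lp_norm p m (T x)" if "x \<in> vecs X" for x
    using ab(4)[of "T x"] T(2)[OF that] X(8)[OF that] by (simp add: \<Phi>_def)
  have iso: "T \<in> isomorphisms X (lp_space p m)"
    unfolding isomorphisms_def mem_Collect_eq lp_space_simps(5)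
    using bij T_add T_scale low up by (intro conjI ballI allI exI[of _ "1/a"] exI[of _ b])
  have v0: "vnorm X (vzero X) = 0" using X(1,2,8) by simp
  have o1: "0 \<le> opnorm X (lp_space p m) T \<and> opnorm X (lp_space p m) T \<le> 1/a"
  proof -
    have "lp_norm p m (T x) \<le> 1 / a" if "x \<in> vecs X" "vnorm X x \<le> 1" for x
      using low[OF that(1)] mult_left_mono[OF that(2), of "1/a"] ab(1) by simp
    then show ?thesis
      using opnorm_bounds[of "vzero X" X "lp_space p m" T "1/a"] X(1) v0 lp_norm_nonneg by simp
  qed
  \<comment> \<open>For \<open>m = 0\<close> the bound \<open>b\<close> may be negative, hence
    \<open>max b 0\<close>.\<close>
  have o2: "opnorm (lp_space p m) X (inv_into (vecs X) T) \<le> max b 0"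
    "0 \<le> opnorm (lp_space p m) X (inv_into (vecs X) T)"
  proof -
    have *: "vnorm X (inv_into (vecs X) T c) \<le> max b 0"
      "0 \<le> vnorm X (inv_into (vecs X) T c)" if "c \<in> ?L" "lp_norm p m c \<le> 1" for c
    proof -
      let ?x = "inv_into (vecs X) T c"
      have x: "?x \<in> vecs X" "T ?x = c"
        using bij that(1) by (auto simp: bij_betw_def intro: inv_into_into f_inv_into_f)
      then show "0 \<le> vnorm X ?x" using X(8) by simp
      have "vnorm X ?x \<le> b * lp_norm p m c" using up[OF x(1)] x(2) by simp
      also have "\<dots> \<le> max b 0 * lp_norm p m c"
        by (intro mult_right_mono lp_norm_nonneg) auto
      also have "\<dots> \<le> max b 0" using that(2) lp_norm_nonneg[of p m c] by (simp add: mult_left_le)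
      finally show "vnorm X ?x \<le> max b 0" .
    qed
    have z: "(\<lambda>i. 0) \<in> ?L" "lp_norm p m (\<lambda>i. 0) \<le> 1"
      using lp_norm_scale[OF p, of m 0 "\<lambda>i. 0"] by auto
    show "opnorm (lp_space p m) X (inv_into (vecs X) T) \<le> max b 0"
      "0 \<le> opnorm (lp_space p m) X (inv_into (vecs X) T)"
      using opnorm_bounds[of "\<lambda>i. 0" "lp_space p m" X "inv_into (vecs X) T" "max b 0"] z *
      by simp_all
  qed
  have "opnorm X (lp_space p m) T * opnorm (lp_space p m) X (inv_into (vecs X) T) \<le> (1/a) * max b 0"
    using o1 o2 ab(1) by (intro mult_mono) auto
  also have "\<dots> \<le> K"
    using ab(1,2) K by (simp add: field_simps max_def)
  finally have "ereal (opnorm X (lp_space p m) T * opnorm (lp_space p m) X (inv_into (vecs X) T)) \<le> ereal K"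
    by simp
  then show "bm_dist X (lp_space p m) \<le> ereal K"
    unfolding bm_dist_def using iso by (meson INF_lower order_trans)
qed

text \<open>The infimum need not be attained, but a distance strictly below \<open>K\<close> yields
  an isomorphism \<open>T\<close> whose norm product is below \<open>K\<close>. The basis consists
  of the preimages of the unit vectors, with \<open>1 / \<parallel>T\<parallel>\<close> and the norm
  of the inverse as lower and upper bounds.\<close>

lemma lp_basis_if_bm_dist_less:
  fixes \<theta> :: "'a \<Rightarrow> 'b::real_normed_vector"
  assumes p: "1 \<le> p" and emb: "isometric_embedding X \<theta>" and bm: "bm_dist X (lp_space p m) < ereal K"
  shows "\<exists>g. \<theta> ` vecs X = span (g ` {..<m}) \<and> lp_basis p K m g"
proof -
  note X = isometric_embeddingD[OF emb]
  obtain T where iso: "T \<in> isomorphisms X (lp_space p m)" and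
    less: "opnorm X (lp_space p m) T * opnorm (lp_space p m) X (inv_into (vecs X) T) < K"
    using bm unfolding bm_dist_def INF_less_iff by auto
  let ?L = "vecs (lp_space p m)"
  let ?S = "inv_into (vecs X) T"
  have bij: "bij_betw T (vecs X) ?L"
    and T_add: "\<And>x y. x \<in> vecs X \<Longrightarrow> y \<in> vecs X \<Longrightarrow> T (vadd X x y) = (\<lambda>i. T x i + T y i)"
    and T_scale: "\<And>r x. x \<in> vecs X \<Longrightarrow> T (vscale X r x) = (\<lambda>i. r * T x i)"
    using iso by (simp_all add: isomorphisms_def)
  have "\<exists>C. \<forall>x\<in>vecs X. lp_norm p m (T x) \<le> C * vnorm X x"
    "\<exists>C. \<forall>x\<in>vecs X. vnorm X x \<le> C * lp_norm p m (T x)"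
    using iso by (simp_all add: isomorphisms_def)
  then obtain C1 C2 where C1: "\<And>x. x \<in> vecs X \<Longrightarrow> lp_norm p m (T x) \<le> C1 * vnorm X x"
    and C2: "\<And>x. x \<in> vecs X \<Longrightarrow> vnorm X x \<le> C2 * lp_norm p m (T x)"
    by blast
  have S: "?S c \<in> vecs X" "T (?S c) = c" if "c \<in> ?L" for c
    using bij that by (auto simp: bij_betw_def intro: inv_into_into f_inv_into_f)
  have S_eq: "?S c = x" if "x \<in> vecs X" "T x = c" for x c
    using bij that by (metis bij_betw_def inv_into_f_f)
  have S_add: "?S (\<lambda>i. c i + d i) = vadd X (?S c) (?S d)" if "c \<in> ?L" "d \<in> ?L" for c d
    using S[OF that(1)] S[OF that(2)] by (intro S_eq) (auto simp: X(4) T_add)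
  have S_scale: "?S (\<lambda>i. r * c i) = vscale X r (?S c)" if "c \<in> ?L" for r c
    using S[OF that] by (intro S_eq) (auto simp: X(5) T_scale)
  define g where "g i = \<theta> (?S (\<lambda>j. if j = i then 1 else 0))" for i
  \<comment> \<open>Additivity in a record space is binary, so the expansion is built up one
    coordinate at a time.\<close>
  have sums: "n \<le> m \<Longrightarrow> (\<Sum>i<n. c i *\<^sub>R g i) = \<theta> (?S (\<lambda>i. if i < n then c i else 0))" for n c
  proof (induction n)
    case 0
    have "T (vzero X) = (\<lambda>i. 0)"
      using T_scale[OF X(1), of 0] X(1,2,3,5,7) by (simp add: inj_on_def) (metis scaleR_zero_left)
    then show ?case using S_eq[OF X(1)] X(2) by simp
  next
    case (Suc n)
    have "(\<lambda>i. if i < Suc n then c i else 0) = (\<lambda>i. (if i < n then c i else 0) + c n * (if i = n then 1 else 0))"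
      by (auto simp: fun_eq_iff less_Suc_eq)
    then have "\<theta> (?S (\<lambda>i. if i < Suc n then c i else 0))
        = \<theta> (vadd X (?S (\<lambda>i. if i < n then c i else 0)) (vscale X (c n) (?S (\<lambda>i. if i = n then 1 else 0))))"
      using Suc.prems by (simp add: S_add S_scale)
    also have "\<dots> = \<theta> (?S (\<lambda>i. if i < n then c i else 0)) + c n *\<^sub>R g n"
      using Suc.prems S(1)[of "\<lambda>i. if i < n then c i else 0"] S(1)[of "\<lambda>i. if i = n then 1 else 0"]
      by (simp add: X(5,6,7) g_def)
    finally show ?case using Suc by simp
  qed
  have "\<theta> ` vecs X = range (\<lambda>c. \<Sum>i<m. c i *\<^sub>R g i)"
  proof safe
    fix x assume x: "x \<in> vecs X"
    then have "T x \<in> ?L" using bij by (auto simp: bij_betw_def)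
    then have "(\<lambda>i. if i < m then T x i else 0) = T x" by auto
    then have "\<theta> x = (\<Sum>i<m. T x i *\<^sub>R g i)" using sums[of m "T x"] S_eq[OF x refl] by simp
    then show "\<theta> x \<in> range (\<lambda>c. \<Sum>i<m. c i *\<^sub>R g i)"
      by (intro image_eqI[of _ _ "T x"]) simp_all
  next
    fix c show "(\<Sum>i<m. c i *\<^sub>R g i) \<in> \<theta> ` vecs X"
      using sums[of m c] S(1)[of "\<lambda>i. if i < m then c i else 0"] by simp
  qed
  \<comment> \<open>For \<open>m = 0\<close> the operator norm of \<open>T\<close> is 0 and has no
    reciprocal, so that case takes other constants.\<close>
  moreover have "lp_basis p K m g"
  proof (cases "m = 0")
    case True
    then have "lp_norm p m c = 0" for c by (simp add: lp_norm_def)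
    then show ?thesis using True unfolding lp_basis_def
      by (intro exI[of _ 1] exI[of _ "K - 1"]) auto
  next
    case m: False
    let ?\<alpha> = "opnorm X (lp_space p m) T" and ?\<beta> = "opnorm (lp_space p m) X ?S"
    have \<alpha>: "lp_norm p m (T x) \<le> ?\<alpha> * vnorm X x" if "x \<in> vecs X" for x
      using opnorm_bound[of X "lp_space p m" T C1 x] that C1
      by (simp add: X(5,7,8) T_scale lp_norm_scale[OF p])
    have \<beta>: "vnorm X (?S c) \<le> ?\<beta> * lp_norm p m c" if "c \<in> ?L" for c
    proof -
      have "vnorm X (?S c) \<le> C2 * lp_norm p m c" if "c \<in> ?L" for c
        using C2[OF S(1)[OF that]] S(2)[OF that] by simp
      then show ?thesis
        using opnorm_bound[of "lp_space p m" X ?S C2 c] that S(1)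
        by (simp add: X(5,7,8) S_scale lp_norm_scale[OF p] lp_norm_nonneg)
    qed
    have \<alpha>0: "0 < ?\<alpha>"
    proof (rule ccontr)
      assume "\<not> 0 < ?\<alpha>"
      let ?e = "\<lambda>j::nat. if j = 0 then 1 else (0::real)"
      have e: "?e \<in> ?L" using m by auto
      have "1 = lp_norm p m (T (?S ?e))"
        using S(2)[OF e] lp_norm_single[OF p, of 0 m 1] m by simp
      also have "\<dots> \<le> ?\<alpha> * vnorm X (?S ?e)" using \<alpha> S(1)[OF e] by blast
      also have "\<dots> \<le> 0" using \<open>\<not> 0 < ?\<alpha>\<close> X(8)[OF S(1)[OF e]] by (simp add: mult_nonpos_nonneg)
      finally show False by simp
    qed
    show ?thesis
      unfolding lp_basis_def
    proof (rule exI[of _ "1 / ?\<alpha>"], rule exI[of _ ?\<beta>], intro conjI allI)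
      show "0 < 1 / ?\<alpha>" using \<alpha>0 by simp
      show "?\<beta> < K * (1 / ?\<alpha>)" using \<alpha>0 less by (simp add: field_simps)
      fix c :: "nat \<Rightarrow> real"
      let ?c = "\<lambda>i. if i < m then c i else 0"
      have c: "?c \<in> ?L" by simp
      have n: "lp_norm p m ?c = lp_norm p m c" by (rule lp_norm_cong) simp
      have e: "norm (\<Sum>i<m. c i *\<^sub>R g i) = vnorm X (?S ?c)"
        using sums[of m c] X(8)[OF S(1)[OF c]] by simp
      show "1 / ?\<alpha> * lp_norm p m c \<le> norm (\<Sum>i<m. c i *\<^sub>R g i)"
        using \<alpha>[OF S(1)[OF c]] S(2)[OF c] \<alpha>0 unfolding e n by (simp add: n field_simps)
      show "norm (\<Sum>i<m. c i *\<^sub>R g i) \<le> ?\<beta> * lp_norm p m c"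
        using \<beta>[OF c] unfolding e n .
    qed
  qed
  ultimately show ?thesis by (intro exI[of _ g]) (simp add: span_image_lessThan)
qed

lemma linear_subspace_vimage:
  assumes emb: "isometric_embedding X \<theta>" and V: "subspace V" "V \<subseteq> \<theta> ` vecs X"
  shows "linear_subspace X {x \<in> vecs X. \<theta> x \<in> V}" "\<theta> ` {x \<in> vecs X. \<theta> x \<in> V} = V"
  using V isometric_embeddingD[OF emb]
  by (auto simp: linear_subspace_def subspace_0 subspace_add subspace_scale)

text \<open>A subspace contains a finite-dimensional \<open>E\<close> iff it contains a finite set
  spanning \<open>E\<close>, which trades subspaces for finite sets.\<close>

lemma script_Lp_iff_has_lp_bases:
  fixes \<theta> :: "'a \<Rightarrow> 'b::real_normed_vector"
  assumes p: "1 \<le> p" and emb: "isometric_embedding X \<theta>"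
  shows "script_Lp p X \<longleftrightarrow> (\<exists>K. has_lp_bases p K (\<theta> ` vecs X))"
proof
  have fd: "finite_dimensional (restrict_to X E) \<longleftrightarrow> (\<exists>n v. \<theta> ` E = span (v ` {..<n::nat}))"
    if "linear_subspace X E" for E
    unfolding finite_dimensional_def
    using spanned_by_size_iff[OF isometric_embedding_restrict[OF emb that]]
    by (intro iff_exI) simp
  note sub = subspace_isometric_image[OF emb]
  { assume "script_Lp p X"
    then obtain K where K: "script_Lp_const p K X" unfolding script_Lp_def by blast
    have "has_lp_bases p (K + 1) (\<theta> ` vecs X)"
      unfolding has_lp_bases_def
    proof (intro allI impI, elim conjE)
      fix B assume finB: "finite B" and B: "B \<subseteq> \<theta> ` vecs X"
      have sB: "span B \<subseteq> \<theta> ` vecs X" by (rule span_minimal[OF B sub])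
      let ?E = "{x \<in> vecs X. \<theta> x \<in> span B}"
      note E = linear_subspace_vimage[OF emb subspace_span sB]
      obtain n :: nat and v where "B = v ` {..<n}"
        using finite_imp_nat_seg_image_inj_on[OF finB] by (metis lessThan_def)
      then have "finite_dimensional (restrict_to X ?E)" using fd[OF E(1)] E(2) by blast
      then obtain G where G: "linear_subspace X G" "finite_dimensional (restrict_to X G)" "?E \<subseteq> G"
        "bm_dist (restrict_to X G) (lp_space p (vdim (restrict_to X G))) \<le> ereal K"
        using K E(1) unfolding script_Lp_const_def by blast
      define m where "m = vdim (restrict_to X G)"
      \<comment> \<open>The distance is only known to be at most \<open>K\<close>; enlarging the
        constant makes the inequality strict, so that an isomorphism exists.\<close>
      have "bm_dist (restrict_to X G) (lp_space p m) < ereal (K + 1)"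
        using G(4) unfolding m_def by (rule le_less_trans) simp
      from lp_basis_if_bm_dist_less[OF p isometric_embedding_restrict[OF emb G(1)] this]
      obtain g where g: "\<theta> ` G = span (g ` {..<m})" "lp_basis p (K + 1) m g"
        by (auto simp: restrict_to_def)
      have "B \<subseteq> \<theta> ` ?E" using E(2) span_superset by blast
      then have "B \<subseteq> span (g ` {..<m})" using G(3) g(1) by blast
      moreover have "g i \<in> \<theta> ` vecs X" if "i < m" for i
      proof -
        have "g i \<in> \<theta> ` G" unfolding g(1) using that by (auto intro: span_base)
        then show ?thesis using G(1) by (auto simp: linear_subspace_def)
      qed
      ultimately show "\<exists>m g. (\<forall>i<m. g i \<in> \<theta> ` vecs X) \<and> B \<subseteq> span (g ` {..<m}) \<and> lp_basis p (K + 1) m g"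
        using g(2) by blast
    qed
    then show "\<exists>K. has_lp_bases p K (\<theta> ` vecs X)" by blast }
  assume "\<exists>K. has_lp_bases p K (\<theta> ` vecs X)"
  then obtain K0 where K0: "has_lp_bases p K0 (\<theta> ` vecs X)" by blast
  \<comment> \<open>Raised to at least 1, as \<open>script_Lp\<close> demands.\<close>
  define K where "K = max K0 1"
  have K: "has_lp_bases p K (\<theta> ` vecs X)" using K0 by (rule has_lp_bases_mono) (simp add: K_def)
  have K1: "1 \<le> K" by (simp add: K_def)
  have "script_Lp_const p K X"
    unfolding script_Lp_const_def
  proof (intro allI impI, elim conjE)
    fix E assume E: "linear_subspace X E" "finite_dimensional (restrict_to X E)"
    then obtain n v where v: "\<theta> ` E = span (v ` {..<n::nat})" using fd by blast
    have EX: "E \<subseteq> vecs X" using E(1) by (simp add: linear_subspace_def)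
    have "v ` {..<n} \<subseteq> \<theta> ` vecs X"
      using span_superset[of "v ` {..<n}"] EX unfolding v[symmetric] by blast
    then obtain m g where g: "\<And>i. i < m \<Longrightarrow> g i \<in> \<theta> ` vecs X" "v ` {..<n} \<subseteq> span (g ` {..<m})" "lp_basis p K m g"
      using K[unfolded has_lp_bases_def, rule_format, of "v ` {..<n}"] by auto
    have sg: "span (g ` {..<m}) \<subseteq> \<theta> ` vecs X" using g(1) by (intro span_minimal sub) auto
    let ?G = "{x \<in> vecs X. \<theta> x \<in> span (g ` {..<m})}"
    note G = linear_subspace_vimage[OF emb subspace_span sg]
    have im: "\<theta> ` vecs (restrict_to X ?G) = span (g ` {..<m})" using G(2) by (simp add: restrict_to_def)
    have "span (v ` {..<n}) \<subseteq> span (g ` {..<m})" using g(2) by (intro span_minimal subspace_span)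
    then have "E \<subseteq> ?G" using EX v by blast
    moreover have "finite_dimensional (restrict_to X ?G)" using fd[OF G(1)] G(2) by blast
    moreover have "bm_dist (restrict_to X ?G) (lp_space p (vdim (restrict_to X ?G))) \<le> ereal K"
      using bm_dist_le_if_lp_basis[OF p isometric_embedding_restrict[OF emb G(1)] im g(3)] K1 by simp
    ultimately show "\<exists>G. linear_subspace X G \<and> finite_dimensional (restrict_to X G) \<and> E \<subseteq> G \<and>
             bm_dist (restrict_to X G) (lp_space p (vdim (restrict_to X G))) \<le> ereal K"
      using G(1) by blast
  qed
  then show "script_Lp p X" unfolding script_Lp_def using K1 by blast
qed

section \<open>Testing equivalence at finitely many coefficients\<close>

text \<open>The integer points on the boundary of the cube of radius \<open>N\<close>; divided by
  \<open>N\<close>, they are a 1/N-net of the unit sphere of l_infinity^m. Vanishing from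
  \<open>m\<close> on makes the set finite.\<close>

definition grid_index :: "nat \<Rightarrow> nat \<Rightarrow> (nat \<Rightarrow> int) set" where
  "grid_index m N = {k. (\<forall>i<m. \<bar>k i\<bar> \<le> int N) \<and> (\<exists>i<m. \<bar>k i\<bar> = int N) \<and> (\<forall>i\<ge>m. k i = 0)}"

text \<open>Strict inequalities at finitely many points make the condition open. The values are
  passed as a function \<open>h\<close>, so that the same test applies to norms of vectors and to
  values of a pseudonorm.\<close>

definition lp_grid :: "ennreal \<Rightarrow> nat \<Rightarrow> nat \<Rightarrow> real \<Rightarrow> real \<Rightarrow> ((nat \<Rightarrow> int) \<Rightarrow> real) \<Rightarrow> bool" where
  "lp_grid p m N a b h \<longleftrightarrow> (\<forall>k\<in>grid_index m N.
     a * lp_norm p m (\<lambda>i. real_of_int (k i)) < h k \<and> h k < b * lp_norm p m (\<lambda>i. real_of_int (k i)))"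

lemma finite_grid_index: "finite (grid_index m N)"
proof (rule finite_subset)
  show "grid_index m N \<subseteq> {k. \<forall>i. (i \<in> {..<m} \<longrightarrow> k i \<in> {- int N..int N}) \<and> (i \<notin> {..<m} \<longrightarrow> k i = 0)}"
    by (auto simp: grid_index_def abs_le_iff)
  show "finite {k. \<forall>i. (i \<in> {..<m} \<longrightarrow> k i \<in> {- int N..int N}) \<and> (i \<notin> {..<m} \<longrightarrow> k i = (0::int))}"
    by (rule finite_set_of_finite_funs) auto
qed

lemma open_lp_grid:
  fixes h :: "'x::topological_space \<Rightarrow> (nat \<Rightarrow> int) \<Rightarrow> real"
  assumes "\<And>k. continuous_on UNIV (\<lambda>x. h x k)"
  shows "open {x. lp_grid p m N a b (h x)}"
proof -
  have "{x. lp_grid p m N a b (h x)} = (\<Inter>k\<in>grid_index m N.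
      {x. a * lp_norm p m (\<lambda>i. real_of_int (k i)) < h x k} \<inter> {x. h x k < b * lp_norm p m (\<lambda>i. real_of_int (k i))})"
    by (auto simp: lp_grid_def)
  then show ?thesis
    using assms finite_grid_index
    by (auto intro!: open_INT open_Int open_Collect_less continuous_intros)
qed

lemma lp_grid_if_lp_basis:
  assumes p: "1 \<le> p" and basis: "lp_basis p K m g"
  obtains a b where "0 < a" "b < K * a"
    "\<And>N. 0 < N \<Longrightarrow> lp_grid p m N a b (\<lambda>k. norm (\<Sum>i<m. real_of_int (k i) *\<^sub>R g i))"
proof -
  obtain a b where ab: "0 < a" "b < K * a"
      "\<And>c. a * lp_norm p m c \<le> norm (\<Sum>i<m. c i *\<^sub>R g i)"
      "\<And>c. norm (\<Sum>i<m. c i *\<^sub>R g i) \<le> b * lp_norm p m c"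
    using basis unfolding lp_basis_def by blast
  \<comment> \<open>The first term keeps \<open>a - t\<close> positive; the second makes
    \<open>t * (1 + K)\<close> smaller than the slack \<open>K * a - b\<close>, so that widening
    both bounds by \<open>t\<close> respects \<open>K\<close>.\<close>
  define t where "t = min (a / 2) ((K * a - b) / (2 * (1 + \<bar>K\<bar>)))"
  have t: "0 < t" using ab by (simp add: t_def)
  have ta: "t \<le> a / 2" unfolding t_def by (rule min.cobounded1)
  have "t * (1 + K) \<le> t * (1 + \<bar>K\<bar>)" using t by (intro mult_left_mono) auto
  also have "\<dots> \<le> (K * a - b) / (2 * (1 + \<bar>K\<bar>)) * (1 + \<bar>K\<bar>)"
    by (intro mult_right_mono) (auto simp: t_def)
  also have "\<dots> = (K * a - b) / 2"
    by (simp add: field_simps)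
  also have "\<dots> < K * a - b" using ab by simp
  finally have lt: "b + t < K * (a - t)" by (simp add: algebra_simps)
  show ?thesis
  proof (rule that[of "a - t" "b + t"])
    show "0 < a - t" using ta ab by simp
    fix N :: nat assume N: "0 < N"
    show "lp_grid p m N (a - t) (b + t) (\<lambda>k. norm (\<Sum>i<m. real_of_int (k i) *\<^sub>R g i))"
      unfolding lp_grid_def
    proof
      fix k assume "k \<in> grid_index m N"
      then obtain i where i: "i < m" "\<bar>k i\<bar> = int N" by (auto simp: grid_index_def)
      then have "real N \<le> lp_norm p m (\<lambda>i. real_of_int (k i))"
        using coord_le_lp_norm[OF p i(1), of "\<lambda>i. real_of_int (k i)"] by (simp flip: of_int_abs)
      then have "0 < t * lp_norm p m (\<lambda>i. real_of_int (k i))" using N t by simp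
      then show "(a - t) * lp_norm p m (\<lambda>i. real_of_int (k i)) < norm (\<Sum>i<m. real_of_int (k i) *\<^sub>R g i) \<and>
        norm (\<Sum>i<m. real_of_int (k i) *\<^sub>R g i) < (b + t) * lp_norm p m (\<lambda>i. real_of_int (k i))"
        using ab(3,4)[of "\<lambda>i. real_of_int (k i)"] by (simp add: algebra_simps)
    qed
  qed (rule lt)
qed

text \<open>A vector with largest coordinate 1 is rounded towards 0 to a grid point divided by \<open>N\<close>;
  the upper bound at the multiples of the unit vectors controls the rounding error.\<close>

lemma lp_basis_if_lp_grid:
  assumes p: "1 \<le> p" and a: "0 < a" and b: "b < K * a" and N: "0 < N" "4 * real m \<le> real N" "8 * K * real m \<le> real N"
    and grid: "lp_grid p m N a b (\<lambda>k. norm (\<Sum>i<m. real_of_int (k i) *\<^sub>R g i))"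
  shows "lp_basis p (17 * K) m g"
proof (cases "m = 0")
  case True
  then have "lp_norm p m c = 0" for c by (simp add: lp_norm_def)
  then show ?thesis using True unfolding lp_basis_def
    by (intro exI[of _ 1] exI[of _ "17 * K - 1"]) auto
next
  case m: False
  have low: "a * lp_norm p m (\<lambda>i. real_of_int (k i)) \<le> norm (\<Sum>i<m. real_of_int (k i) *\<^sub>R g i)"
    and up: "norm (\<Sum>i<m. real_of_int (k i) *\<^sub>R g i) \<le> b * lp_norm p m (\<lambda>i. real_of_int (k i))"
    if "k \<in> grid_index m N" for k
    using grid that unfolding lp_grid_def by (auto intro: less_imp_le)
  have gi: "norm (g i) \<le> b" if i: "i < m" for i
  proof -
    let ?k = "\<lambda>j. if j = i then int N else 0"
    have "?k \<in> grid_index m N" using i by (auto simp: grid_index_def)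
    note up[OF this]
    also have "lp_norm p m (\<lambda>j. real_of_int (?k j)) = real N"
      using lp_norm_single[OF p i, of "real N"] by (simp add: if_distrib cong: if_cong)
    also have "(\<Sum>j<m. real_of_int (?k j) *\<^sub>R g j) = (\<Sum>j<m. if j = i then real N *\<^sub>R g i else 0)"
      by (intro sum.cong) auto
    also have "\<dots> = real N *\<^sub>R g i" using i by simp
    finally show ?thesis using N by (simp add: mult.commute)
  qed
  have b0: "0 \<le> b" using gi[of 0] m norm_ge_zero[of "g 0"] by linarith
  have unit: "a / 8 * lp_norm p m c \<le> norm (\<Sum>i<m. c i *\<^sub>R g i) \<and> norm (\<Sum>i<m. c i *\<^sub>R g i) \<le> 2 * b * lp_norm p m c"
    if c: "\<And>i. i < m \<Longrightarrow> \<bar>c i\<bar> \<le> 1" and c1: "\<exists>i<m. \<bar>c i\<bar> = 1" for c :: "nat \<Rightarrow> real"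
  proof -
    \<comment> \<open>Rounding towards 0 has two effects: no coordinate grows, so the l_p-norm does
      not either, and a coordinate of modulus 1 becomes exactly \<open>N\<close> in modulus, so
      \<open>k\<close> stays on the boundary of the cube.\<close>
    define k :: "nat \<Rightarrow> int" where
      "k i = (if i < m then if 0 \<le> c i then \<lfloor>real N * \<bar>c i\<bar>\<rfloor> else - \<lfloor>real N * \<bar>c i\<bar>\<rfloor> else 0)" for i
    define d where "d i = real_of_int (k i) / real N" for i
    have kN: "\<bar>real_of_int (k i)\<bar> \<le> real N * \<bar>c i\<bar>" "\<bar>real N * c i - real_of_int (k i)\<bar> \<le> 1" if "i < m" for i
    proof -
      define x where "x = real N * \<bar>c i\<bar>"
      have x: "0 \<le> \<lfloor>x\<rfloor>" "real_of_int \<lfloor>x\<rfloor> \<le> x" "x - real_of_int \<lfloor>x\<rfloor> \<le> 1"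
        by (simp add: x_def) linarith+
      have "real N * c i = (if 0 \<le> c i then x else - x)" "real_of_int (k i) = (if 0 \<le> c i then \<lfloor>x\<rfloor> else - \<lfloor>x\<rfloor>)"
        using that by (auto simp: k_def x_def)
      then show "\<bar>real_of_int (k i)\<bar> \<le> real N * \<bar>c i\<bar>" "\<bar>real N * c i - real_of_int (k i)\<bar> \<le> 1"
        using x unfolding x_def[symmetric] by auto
    qed
    have "\<bar>k i\<bar> \<le> int N" if "i < m" for i
    proof -
      have "real N * \<bar>c i\<bar> \<le> real N" using c[OF that] by (simp add: mult_left_le)
      then show ?thesis using kN(1)[OF that] by linarith
    qed
    moreover have "\<exists>i<m. \<bar>k i\<bar> = int N"
    proof -
      obtain i where "i < m" "\<bar>c i\<bar> = 1" using c1 by blast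
      then have "\<bar>k i\<bar> = int N" by (auto simp: k_def abs_if split: if_splits)
      then show ?thesis using \<open>i < m\<close> by blast
    qed
    ultimately have kg: "k \<in> grid_index m N" by (auto simp: grid_index_def k_def)
    have dN: "(\<Sum>i<m. real_of_int (k i) *\<^sub>R g i) = real N *\<^sub>R (\<Sum>i<m. d i *\<^sub>R g i)"
      using N(1) by (simp add: d_def scaleR_sum_right)
    have dn: "lp_norm p m (\<lambda>i. real_of_int (k i)) = real N * lp_norm p m d"
      using lp_norm_scale[OF p, of m "real N" d] N(1) by (simp add: d_def)
    have lowd: "a * lp_norm p m d \<le> norm (\<Sum>i<m. d i *\<^sub>R g i)"
      using low[OF kg] N(1) unfolding dN dn by simp
    have upd: "norm (\<Sum>i<m. d i *\<^sub>R g i) \<le> b * lp_norm p m d"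
      using up[OF kg] N(1) unfolding dN dn by simp
    have cd: "\<bar>c i - d i\<bar> \<le> 1 / real N" if "i < m" for i
    proof -
      have "c i - d i = (real N * c i - real_of_int (k i)) / real N" using N(1) by (simp add: d_def field_simps)
      then show ?thesis using kN(2)[OF that] N(1) by (simp add: divide_right_mono)
    qed
    have dc: "lp_norm p m d \<le> lp_norm p m c"
      using kN(1) N(1) by (intro lp_norm_mono[OF p]) (auto simp: d_def field_simps)
    have c_ge: "1 \<le> lp_norm p m c" using c1 coord_le_lp_norm[OF p, of _ m c] by fastforce
    \<comment> \<open>With \<open>4 * m \<le> N\<close> the rounding error is at most 1/4. The
      quasi-triangle inequality gives \<parallel>c\<parallel> <= 2 \<parallel>d\<parallel> + 1/2,
      and the 1/2 is at most \<parallel>c\<parallel> / 2.\<close>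
    have "lp_norm p m (\<lambda>i. c i - d i) \<le> real m * (1 / real N)"
      using cd by (intro lp_norm_le_const[OF p]) auto
    also have "\<dots> \<le> 1/4" using N by (simp add: field_simps)
    finally have "lp_norm p m c \<le> 2 * (lp_norm p m d + 1/4)"
      using lp_norm_quasi_triangle[OF p, of m d "\<lambda>i. c i - d i"] by simp
    then have cd4: "lp_norm p m c \<le> 4 * lp_norm p m d" using c_ge by simp
    \<comment> \<open>The rounding error measured in the normed space: \<open>m\<close> coordinates,
      each off by at most \<open>1 / N\<close>, times vectors of norm at most \<open>b\<close>. The
      condition \<open>8 * K * m \<le> N\<close> makes it at most \<open>a / 8\<close>, half of the
      lower bound \<open>a / 4\<close> obtained from \<open>d\<close>.\<close>
    define E where "E = real m / real N * b"
    have "norm (\<Sum>i<m. (c i - d i) *\<^sub>R g i) \<le> (\<Sum>i<m. 1 / real N * b)"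
    proof (intro sum_norm_le)
      fix i assume "i \<in> {..<m}"
      then show "norm ((c i - d i) *\<^sub>R g i) \<le> 1 / real N * b"
        using mult_mono[OF cd[of i] gi[of i]] by simp
    qed
    then have err: "norm ((\<Sum>i<m. c i *\<^sub>R g i) - (\<Sum>i<m. d i *\<^sub>R g i)) \<le> E"
      by (simp add: scaleR_diff_left sum_subtractf E_def)
    have mN: "real m / real N \<le> 1" using N by (simp add: field_simps)
    have "real m / real N * b \<le> 1 * b" using mN b0 by (intro mult_right_mono) auto
    also have "\<dots> \<le> b * lp_norm p m c" using b0 c_ge by (simp add: mult_le_cancel_left1)
    finally have e1: "E \<le> b * lp_norm p m c" unfolding E_def .
    have "real m / real N * b \<le> real m / real N * (K * a)" using b by (intro mult_left_mono) auto
    also have "\<dots> = (8 * K * real m) / real N * (a / 8)" by simp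
    also have "\<dots> \<le> 1 * (a / 8)" using N a by (intro mult_right_mono) auto
    also have "\<dots> \<le> a / 8 * lp_norm p m c" using a c_ge by simp
    finally have e2: "E \<le> a / 8 * lp_norm p m c" unfolding E_def .
    have "a / 4 * lp_norm p m c \<le> a * lp_norm p m d" using cd4 a by (simp add: field_simps)
    then have "a / 8 * lp_norm p m c \<le> norm (\<Sum>i<m. c i *\<^sub>R g i)"
      using e2 err lowd norm_triangle_ineq3[of "\<Sum>i<m. c i *\<^sub>R g i" "\<Sum>i<m. d i *\<^sub>R g i"] by simp
    moreover have "b * lp_norm p m d \<le> b * lp_norm p m c" using dc b0 by (rule mult_left_mono)
    then have "norm (\<Sum>i<m. c i *\<^sub>R g i) \<le> 2 * b * lp_norm p m c"
      using e1 err upd norm_triangle_ineq3[of "\<Sum>i<m. c i *\<^sub>R g i" "\<Sum>i<m. d i *\<^sub>R g i"] by simp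
    ultimately show ?thesis by blast
  qed
  show ?thesis
    unfolding lp_basis_def
  \<comment> \<open>The ratio of the bounds is 16 b / a, which is below \<open>17 * K\<close>
    because 0 <= b < K a.\<close>
  proof (rule exI[of _ "a / 8"], rule exI[of _ "2 * b"], intro conjI allI)
    show "0 < a / 8" using a by simp
    show "2 * b < 17 * K * (a / 8)" using b b0 by simp
    fix c :: "nat \<Rightarrow> real"
    define M where "M = Max ((\<lambda>i. \<bar>c i\<bar>) ` {..<m})"
    have fin: "finite ((\<lambda>i. \<bar>c i\<bar>) ` {..<m})" "(\<lambda>i. \<bar>c i\<bar>) ` {..<m} \<noteq> {}" using m by auto
    have M: "\<bar>c i\<bar> \<le> M" if "i < m" for i unfolding M_def using that by (intro Max_ge) auto
    obtain i0 where i0: "i0 < m" "\<bar>c i0\<bar> = M" using Max_in[OF fin] by (auto simp: M_def)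
    have "a / 8 * lp_norm p m c \<le> norm (\<Sum>i<m. c i *\<^sub>R g i) \<and> norm (\<Sum>i<m. c i *\<^sub>R g i) \<le> 2 * b * lp_norm p m c"
    proof (cases "M = 0")
      case True
      then have c0: "c i = 0" if "i < m" for i using M[OF that] by simp
      then have "lp_norm p m c \<le> real m * 0" by (intro lp_norm_le_const[OF p]) auto
      then have "lp_norm p m c = 0" using lp_norm_nonneg[of p m c] by simp
      then show ?thesis using c0 by simp
    next
      case False
      then have M0: "0 < M" using i0 by auto
      let ?c = "\<lambda>i. c i / M"
      have s: "(\<Sum>i<m. c i *\<^sub>R g i) = M *\<^sub>R (\<Sum>i<m. ?c i *\<^sub>R g i)" using False by (simp add: scaleR_sum_right)
      have n: "lp_norm p m c = M * lp_norm p m ?c"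
        using lp_norm_scale[OF p, of m M ?c] M0 by simp
      have "a / 8 * lp_norm p m ?c \<le> norm (\<Sum>i<m. ?c i *\<^sub>R g i) \<and> norm (\<Sum>i<m. ?c i *\<^sub>R g i) \<le> 2 * b * lp_norm p m ?c"
        using M M0 i0 by (intro unit) auto
      then show ?thesis unfolding s n using M0 by (simp add: mult_left_mono mult.left_commute[of _ M])
    qed
    then show "a / 8 * lp_norm p m c \<le> norm (\<Sum>i<m. c i *\<^sub>R g i)"
      "norm (\<Sum>i<m. c i *\<^sub>R g i) \<le> 2 * b * lp_norm p m c" by blast+
  qed
qed

section \<open>Quotients and completions\<close>

text \<open>The seminormed counterpart of \<open>isometric_embedding\<close>: null vectors go to 0,
  so injectivity appears only after passing to the kernel quotient.\<close>

definition isometric_map :: "'a nspace \<Rightarrow> ('a \<Rightarrow> 'b::real_normed_vector) \<Rightarrow> bool" where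
  "isometric_map X \<theta> \<longleftrightarrow> linear_subspace X (vecs X) \<and> \<theta> (vzero X) = 0 \<and>
     (\<forall>x\<in>vecs X. \<forall>y\<in>vecs X. \<theta> (vadd X x y) = \<theta> x + \<theta> y) \<and>
     (\<forall>r. \<forall>x\<in>vecs X. \<theta> (vscale X r x) = r *\<^sub>R \<theta> x) \<and>
     (\<forall>x\<in>vecs X. vnorm X x = norm (\<theta> x))"

lemma isometric_embedding_iff: "isometric_embedding X \<theta> \<longleftrightarrow> isometric_map X \<theta> \<and> inj_on \<theta> (vecs X)"
  by (auto simp: isometric_embedding_def isometric_map_def)

lemma isometric_mapD:
  assumes "isometric_map X \<theta>"
  shows "vzero X \<in> vecs X" "\<theta> (vzero X) = 0"
    "\<And>x y. x \<in> vecs X \<Longrightarrow> y \<in> vecs X \<Longrightarrow> vadd X x y \<in> vecs X"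
    "\<And>r x. x \<in> vecs X \<Longrightarrow> vscale X r x \<in> vecs X"
    "\<And>x y. x \<in> vecs X \<Longrightarrow> y \<in> vecs X \<Longrightarrow> \<theta> (vadd X x y) = \<theta> x + \<theta> y"
    "\<And>r x. x \<in> vecs X \<Longrightarrow> \<theta> (vscale X r x) = r *\<^sub>R \<theta> x"
    "\<And>x. x \<in> vecs X \<Longrightarrow> vnorm X x = norm (\<theta> x)"
    "\<And>x y. x \<in> vecs X \<Longrightarrow> y \<in> vecs X \<Longrightarrow> vdist X x y = norm (\<theta> x - \<theta> y)"
  using assms by (auto simp: isometric_map_def linear_subspace_def vdist_def)

lemma kernel_quotient_embedding:
  fixes \<theta> :: "'a \<Rightarrow> 'b::real_normed_vector"
  assumes "isometric_map X \<theta>"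
  shows "isometric_embedding (kernel_quotient X) (\<lambda>A. the_elem (\<theta> ` A))"
    "(\<lambda>A. the_elem (\<theta> ` A)) ` vecs (kernel_quotient X) = \<theta> ` vecs X"
proof -
  note X = isometric_mapD[OF assms]
  \<comment> \<open>The classes of \<open>null_rel\<close> are the fibres of
    \<open>\<theta>\<close>, because \<open>vdist\<close> is the distance of the images. Hence the
    unions and \<open>the_elem\<close> in the quotient run over coinciding values.\<close>
  define cls where "cls x = {y \<in> vecs X. \<theta> y = \<theta> x}" for x
  let ?\<theta> = "\<lambda>A. the_elem (\<theta> ` A)"
  have cls: "null_rel X `` {x} = cls x" if "x \<in> vecs X" for x
    using that by (auto simp: null_rel_def cls_def X(8))
  have vecs: "vecs (kernel_quotient X) = cls ` vecs X"
    using cls by (auto simp: kernel_quotient_def quotient_def image_iff)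
  have mem: "x \<in> cls x" if "x \<in> vecs X" for x using that by (simp add: cls_def)
  have \<theta>: "?\<theta> (cls x) = \<theta> x" if "x \<in> vecs X" for x
  proof -
    have "\<theta> ` cls x = {\<theta> x}" using mem[OF that] by (auto simp: cls_def)
    then show ?thesis by simp
  qed
  have norm: "vnorm (kernel_quotient X) (cls x) = norm (\<theta> x)" if "x \<in> vecs X" for x
  proof -
    have "vnorm X ` cls x = {norm (\<theta> x)}" using mem[OF that] by (auto simp: cls_def X(7) image_iff)
    then show ?thesis by (simp add: kernel_quotient_def)
  qed
  have eqI: "cls x = cls y" if "\<theta> x = \<theta> y" for x y
    using that by (simp add: cls_def)
  have add: "vadd (kernel_quotient X) (cls x) (cls y) = cls (vadd X x y)" if "x \<in> vecs X" "y \<in> vecs X" for x y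
  proof -
    have "null_rel X `` {vadd X a b} = cls (vadd X x y)" if "a \<in> cls x" "b \<in> cls y" for a b
      using that \<open>x \<in> vecs X\<close> \<open>y \<in> vecs X\<close> by (subst cls) (auto simp: cls_def X)
    then show ?thesis
      using mem[OF that(1)] mem[OF that(2)] by (auto simp: kernel_quotient_def)
  qed
  have scale: "vscale (kernel_quotient X) r (cls x) = cls (vscale X r x)" if "x \<in> vecs X" for r x
  proof -
    have "null_rel X `` {vscale X r a} = cls (vscale X r x)" if "a \<in> cls x" for a
      using that \<open>x \<in> vecs X\<close> by (subst cls) (auto simp: cls_def X)
    then show ?thesis
      using mem[OF that(1)] by (auto simp: kernel_quotient_def)
  qed
  have zero: "vzero (kernel_quotient X) = cls (vzero X)"
    using cls X(1) by (simp add: kernel_quotient_def)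
  show "?\<theta> ` vecs (kernel_quotient X) = \<theta> ` vecs X"
    unfolding vecs image_image using \<theta> by (intro image_cong) auto
  show "isometric_embedding (kernel_quotient X) ?\<theta>"
    unfolding isometric_embedding_def linear_subspace_def vecs zero
    using X by (auto simp: add scale \<theta> norm inj_on_def intro!: eqI imageI)
qed

text \<open>By completeness a sequence is Cauchy iff its image converges, and the seminorm of the
  sequence is the norm of that limit. Choosing preimages of an approximating sequence reaches the
  whole closure.\<close>

lemma cauchy_space_isometric_map:
  fixes \<theta> :: "'a \<Rightarrow> 'b::real_normed_vector"
  assumes "isometric_map X \<theta>" and complete: "complete (UNIV :: 'b set)"
  shows "isometric_map (cauchy_space X) (\<lambda>s. lim (\<lambda>n. \<theta> (s n)))"
    "(\<lambda>s. lim (\<lambda>n. \<theta> (s n))) ` vecs (cauchy_space X) = closure (\<theta> ` vecs X)"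
proof -
  note X = isometric_mapD[OF assms(1)]
  have Cauchy_convergent: "Cauchy u \<longleftrightarrow> convergent u" for u :: "nat \<Rightarrow> 'b"
    using complete unfolding complete_def convergent_def by (auto intro: LIMSEQ_imp_Cauchy)
  let ?L = "\<lambda>s. lim (\<lambda>n. \<theta> (s n))"
  have vecs: "s \<in> vecs (cauchy_space X) \<longleftrightarrow> (\<forall>n. s n \<in> vecs X) \<and> convergent (\<lambda>n. \<theta> (s n))" for s
  proof -
    have "(\<forall>e>0. \<exists>N. \<forall>m\<ge>N. \<forall>n\<ge>N. vdist X (s m) (s n) < e) \<longleftrightarrow> convergent (\<lambda>n. \<theta> (s n))" if "\<forall>n. s n \<in> vecs X"
      using that unfolding Cauchy_convergent[symmetric] Cauchy_def by (simp add: X(8) dist_norm)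
    then show ?thesis by (auto simp: cauchy_space_def)
  qed
  have lim: "(\<lambda>n. \<theta> (s n)) \<longlonglongrightarrow> ?L s" if "s \<in> vecs (cauchy_space X)" for s
    using that vecs by (simp add: convergent_LIMSEQ_iff)
  have ops: "vzero (cauchy_space X) = (\<lambda>n. vzero X)" "vadd (cauchy_space X) s t = (\<lambda>n. vadd X (s n) (t n))"
    "vscale (cauchy_space X) r s = (\<lambda>n. vscale X r (s n))" "vnorm (cauchy_space X) s = lim (\<lambda>n. vnorm X (s n))" for s t r
    by (simp_all add: cauchy_space_def)
  have add: "(\<lambda>n. \<theta> (vadd X (s n) (t n))) \<longlonglongrightarrow> ?L s + ?L t" if "s \<in> vecs (cauchy_space X)" "t \<in> vecs (cauchy_space X)" for s t
    using tendsto_add[OF lim[OF that(1)] lim[OF that(2)]] that by (simp add: vecs X)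
  have scale: "(\<lambda>n. \<theta> (vscale X r (s n))) \<longlonglongrightarrow> r *\<^sub>R ?L s" if "s \<in> vecs (cauchy_space X)" for r s
    using tendsto_scaleR[OF tendsto_const lim[OF that]] that by (simp add: vecs X)
  show "isometric_map (cauchy_space X) ?L"
    unfolding isometric_map_def linear_subspace_def ops
  proof (intro conjI ballI allI)
    fix s t r assume s: "s \<in> vecs (cauchy_space X)"
    show "(\<lambda>n. vscale X r (s n)) \<in> vecs (cauchy_space X)"
      using scale[OF s] s X by (auto simp: vecs convergent_def)
    show "?L (\<lambda>n. vscale X r (s n)) = r *\<^sub>R ?L s" using scale[OF s] by (rule limI)
    have "(\<lambda>n. vnorm X (s n)) \<longlonglongrightarrow> norm (?L s)"
      using tendsto_norm[OF lim[OF s]] s by (simp add: vecs X)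
    then show "lim (\<lambda>n. vnorm X (s n)) = norm (?L s)" by (rule limI)
    assume t: "t \<in> vecs (cauchy_space X)"
    show "(\<lambda>n. vadd X (s n) (t n)) \<in> vecs (cauchy_space X)"
      using add[OF s t] s t X by (auto simp: vecs convergent_def)
    show "?L (\<lambda>n. vadd X (s n) (t n)) = ?L s + ?L t" using add[OF s t] by (rule limI)
  qed (auto simp: vecs X convergent_const)
  show "?L ` vecs (cauchy_space X) = closure (\<theta> ` vecs X)"
  proof (intro set_eqI iffI)
    fix y assume "y \<in> ?L ` vecs (cauchy_space X)"
    then obtain s where "s \<in> vecs (cauchy_space X)" "y = ?L s" by blast
    then show "y \<in> closure (\<theta> ` vecs X)"
      using lim[of s] unfolding closure_sequential
      by (intro exI[of _ "\<lambda>n. \<theta> (s n)"]) (auto simp: vecs)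
  next
    fix y assume "y \<in> closure (\<theta> ` vecs X)"
    then obtain u where u: "\<And>n. u n \<in> \<theta> ` vecs X" "u \<longlonglongrightarrow> y"
      unfolding closure_sequential by blast
    define s where "s n = inv_into (vecs X) \<theta> (u n)" for n
    have s: "s n \<in> vecs X" "u n = \<theta> (s n)" for n
      using u(1)[of n] by (simp_all add: s_def inv_into_into f_inv_into_f)
    have *: "(\<lambda>n. \<theta> (s n)) \<longlonglongrightarrow> y" using u(2) by (simp flip: s(2))
    then have "s \<in> vecs (cauchy_space X)" using s(1) by (auto simp: vecs convergent_def)
    moreover have "y = ?L s" using limI[OF *] by simp
    ultimately show "y \<in> ?L ` vecs (cauchy_space X)" by blast
  qed
qed

text \<open>The completion is realised as the closure of the image of an isometric linear map into a
  complete normed space.\<close>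

lemma completion_embedding:
  fixes \<theta> :: "'a \<Rightarrow> 'b::real_normed_vector"
  assumes "isometric_map X \<theta>" "complete (UNIV :: 'b set)"
  shows "\<exists>\<Theta> :: _ \<Rightarrow> 'b. isometric_embedding (completion (kernel_quotient X)) \<Theta> \<and>
    \<Theta> ` vecs (completion (kernel_quotient X)) = closure (\<theta> ` vecs X)"
proof -
  note q = kernel_quotient_embedding[OF assms(1)]
  note c = cauchy_space_isometric_map[OF q(1)[unfolded isometric_embedding_iff, THEN conjunct1] assms(2)]
  note k = kernel_quotient_embedding[OF c(1)]
  show ?thesis
    using k c(2) q(2) unfolding completion_def by metis
qed

section \<open>Extension of pseudonorms\<close>

abbreviation real_vec :: "(nat \<Rightarrow>\<^sub>0 rat) \<Rightarrow> (nat \<Rightarrow>\<^sub>0 real)" where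
  "real_vec \<equiv> Poly_Mapping.map real_of_rat"

lemma lookup_map_zero: "f 0 = 0 \<Longrightarrow> Poly_Mapping.lookup (Poly_Mapping.map f x) i = f (Poly_Mapping.lookup x i)"
  by (simp add: map.rep_eq when_def)

lemma lookup_fs_scale: "Poly_Mapping.lookup (fs_scale a x) i = a * Poly_Mapping.lookup x i"
  by (simp add: fs_scale_def lookup_map_zero)

lemma lookup_scaleR: "Poly_Mapping.lookup (a *\<^sub>R x) i = a *\<^sub>R Poly_Mapping.lookup (x :: 'i \<Rightarrow>\<^sub>0 'a::real_vector) i"
proof -
  have "finite {i. a *\<^sub>R Poly_Mapping.lookup x i \<noteq> 0}"
    by (rule finite_subset[OF _ finite_keys[of x]]) (auto simp: in_keys_iff)
  then show ?thesis by (simp add: scaleR_poly_mapping_def)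
qed

lemma fs_scale_real: "fs_scale a x = a *\<^sub>R (x :: nat \<Rightarrow>\<^sub>0 real)"
  by (rule poly_mapping_eqI) (simp add: lookup_fs_scale lookup_scaleR)

lemma real_vec_add: "real_vec (v + w) = real_vec v + real_vec w"
  by (rule poly_mapping_eqI) (simp add: lookup_map_zero lookup_add of_rat_add)

lemma real_vec_diff: "real_vec (v - w) = real_vec v - real_vec w"
  by (rule poly_mapping_eqI) (simp add: lookup_map_zero lookup_minus of_rat_diff)

lemma real_vec_scale: "real_vec (fs_scale a v) = real_of_rat a *\<^sub>R real_vec v"
  by (rule poly_mapping_eqI) (simp add: lookup_map_zero lookup_fs_scale lookup_scaleR of_rat_mult)

lemma real_vec_sum: "real_vec (\<Sum>i\<in>A. f i) = (\<Sum>i\<in>A. real_vec (f i))"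
proof -
  have "real_vec 0 = 0" by (rule poly_mapping_eqI) (simp add: lookup_map_zero)
  then show ?thesis by (induction A rule: infinite_finite_induct) (auto simp: real_vec_add)
qed

lemma poly_mapping_eq_sum_single: "(x :: 'a \<Rightarrow>\<^sub>0 'b::comm_monoid_add) = (\<Sum>i\<in>Poly_Mapping.keys x. Poly_Mapping.single i (Poly_Mapping.lookup x i))"
  by (rule poly_mapping_eqI) (auto simp: lookup_sum lookup_single when_def in_keys_iff)

text \<open>Finite lists of index-value pairs enumerate all finitely supported functions.\<close>

lemma countable_finitely_supported: "countable (UNIV :: ('a::countable \<Rightarrow>\<^sub>0 'b::{countable,comm_monoid_add}) set)"
proof -
  let ?f = "\<lambda>l::('a \<times> 'b) list. \<Sum>(i, q)\<leftarrow>l. Poly_Mapping.single i q"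
  have "(\<Sum>i\<in>A. Poly_Mapping.single i (h i)) \<in> range ?f" if "finite A" for A and h :: "'a \<Rightarrow> 'b"
    using that
  proof induction
    case empty
    show ?case by (rule image_eqI[of _ _ "[]"]) auto
  next
    case (insert a A)
    then obtain l where "(\<Sum>i\<in>A. Poly_Mapping.single i (h i)) = ?f l" by blast
    then show ?case using insert by (intro image_eqI[of _ _ "(a, h a) # l"]) auto
  qed
  then have "x \<in> range ?f" for x
    using poly_mapping_eq_sum_single[of x] by (metis finite_keys)
  then show ?thesis by (intro countable_subset[of UNIV "range ?f"]) auto
qed

text \<open>With nonnegative weights this is the largest pseudonorm on c_00 taking the value
  \<open>M i\<close> at the i-th unit vector. It therefore controls every pseudonorm with these
  values.\<close>

definition weighted_l1 :: "(nat \<Rightarrow> real) \<Rightarrow> (nat \<Rightarrow>\<^sub>0 real) \<Rightarrow> real" where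
  "weighted_l1 M x = (\<Sum>i\<in>Poly_Mapping.keys x. \<bar>Poly_Mapping.lookup x i\<bar> * M i)"

lemma weighted_l1_eq: "finite A \<Longrightarrow> Poly_Mapping.keys x \<subseteq> A \<Longrightarrow> weighted_l1 M x = (\<Sum>i\<in>A. \<bar>Poly_Mapping.lookup x i\<bar> * M i)"
  unfolding weighted_l1_def by (intro sum.mono_neutral_left) (auto simp: in_keys_iff)

lemma weighted_l1_triangle:
  assumes "\<And>i. 0 \<le> M i"
  shows "weighted_l1 M (x + y) \<le> weighted_l1 M x + weighted_l1 M y"
proof -
  have "\<bar>Poly_Mapping.lookup (x + y) i\<bar> * M i \<le> \<bar>Poly_Mapping.lookup x i\<bar> * M i + \<bar>Poly_Mapping.lookup y i\<bar> * M i" for i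
    using mult_right_mono[OF abs_triangle_ineq[of "Poly_Mapping.lookup x i" "Poly_Mapping.lookup y i"] assms[of i]]
    by (simp add: lookup_add distrib_right)
  then show ?thesis
    using keys_add[of x y]
    by (simp add: weighted_l1_eq[of "Poly_Mapping.keys x \<union> Poly_Mapping.keys y"] sum_mono flip: sum.distrib)
qed

lemma weighted_l1_scale: "weighted_l1 M (a *\<^sub>R x) = \<bar>a\<bar> * weighted_l1 M x"
proof -
  have "Poly_Mapping.keys (a *\<^sub>R x) \<subseteq> Poly_Mapping.keys x" by (auto simp: in_keys_iff lookup_scaleR)
  then show ?thesis
    by (simp add: weighted_l1_eq[of "Poly_Mapping.keys x"] lookup_scaleR abs_mult sum_distrib_left mult_ac)
qed

lemma weighted_l1_nonneg: "(\<And>i. 0 \<le> M i) \<Longrightarrow> 0 \<le> weighted_l1 M x"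
  unfolding weighted_l1_def by (intro sum_nonneg) auto

lemma real_vec_dense:
  assumes M: "\<And>i. 0 \<le> M i" and e: "0 < e"
  shows "\<exists>v. weighted_l1 M (x - real_vec v) < e"
proof -
  define W where "W = (\<Sum>i\<in>Poly_Mapping.keys x. M i)"
  have W: "0 \<le> W" using M by (auto simp: W_def intro: sum_nonneg)
  define \<eta> where "\<eta> = e / (W + 1)"
  have \<eta>: "0 < \<eta>" using W e by (simp add: \<eta>_def)
  have "\<exists>q. \<bar>Poly_Mapping.lookup x i - real_of_rat q\<bar> < \<eta>" for i
  proof -
    obtain q where "Poly_Mapping.lookup x i - \<eta> < real_of_rat q" "real_of_rat q < Poly_Mapping.lookup x i + \<eta>"
      using of_rat_dense[of "Poly_Mapping.lookup x i - \<eta>" "Poly_Mapping.lookup x i + \<eta>"] \<eta> by auto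
    then have "\<bar>Poly_Mapping.lookup x i - real_of_rat q\<bar> < \<eta>" by (simp add: abs_less_iff)
    then show ?thesis ..
  qed
  then obtain q where q: "\<And>i. \<bar>Poly_Mapping.lookup x i - real_of_rat (q i)\<bar> < \<eta>" by metis
  define v where "v = (\<Sum>i\<in>Poly_Mapping.keys x. Poly_Mapping.single i (q i))"
  have v: "Poly_Mapping.lookup v i = (if i \<in> Poly_Mapping.keys x then q i else 0)" for i
    by (auto simp: v_def lookup_sum lookup_single when_def)
  have "Poly_Mapping.keys (x - real_vec v) \<subseteq> Poly_Mapping.keys x"
    by (auto simp: in_keys_iff lookup_minus lookup_map_zero v)
  then have "weighted_l1 M (x - real_vec v) = (\<Sum>i\<in>Poly_Mapping.keys x. \<bar>Poly_Mapping.lookup x i - real_of_rat (q i)\<bar> * M i)"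
    by (simp add: weighted_l1_eq[of "Poly_Mapping.keys x"] lookup_minus lookup_map_zero v)
  also have "\<dots> \<le> (\<Sum>i\<in>Poly_Mapping.keys x. \<eta> * M i)"
    using M less_imp_le[OF q] by (intro sum_mono mult_right_mono) auto
  also have "\<dots> = \<eta> * W" by (simp add: W_def sum_distrib_left)
  also have "\<dots> < e" using W e by (simp add: \<eta>_def field_simps)
  finally show ?thesis ..
qed

lemma pseudonormsD:
  assumes "\<mu> \<in> pseudonorms"
  shows "0 \<le> \<mu> x" "\<mu> (x + y) \<le> \<mu> x + \<mu> y" "\<mu> (fs_scale a x) = real_of_rat \<bar>a\<bar> * \<mu> x"
    "\<mu> 0 = 0" "\<mu> (- x) = \<mu> x"
proof -
  show h: "0 \<le> \<mu> x" "\<mu> (x + y) \<le> \<mu> x + \<mu> y" "\<mu> (fs_scale a x) = real_of_rat \<bar>a\<bar> * \<mu> x" for x y a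
    using assms by (auto simp: pseudonorms_def)
  have "fs_scale 0 x = (0 :: nat \<Rightarrow>\<^sub>0 rat)" "fs_scale (-1) x = (- x :: nat \<Rightarrow>\<^sub>0 rat)"
    by (rule poly_mapping_eqI; simp add: lookup_fs_scale)+
  then show "\<mu> 0 = 0" "\<mu> (- x) = \<mu> x" using h(3)[of 0 x] h(3)[of "-1" x] by simp_all
qed

lemma pseudonorms_c00D:
  assumes "\<nu> \<in> pseudonorms_c00"
  shows "0 \<le> \<nu> x" "\<nu> (x + y) \<le> \<nu> x + \<nu> y" "\<nu> (a *\<^sub>R x) = \<bar>a\<bar> * \<nu> x"
    "\<nu> 0 = 0" "\<nu> (x - y) = \<nu> (y - x)" "\<bar>\<nu> x - \<nu> y\<bar> \<le> \<nu> (x - y)"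
proof -
  show h: "0 \<le> \<nu> x" "\<nu> (x + y) \<le> \<nu> x + \<nu> y" "\<nu> (a *\<^sub>R x) = \<bar>a\<bar> * \<nu> x" for x y a
    using assms by (auto simp: pseudonorms_c00_def fs_scale_real)
  show "\<nu> 0 = 0" using h(3)[of 0 0] by simp
  show m: "\<nu> (x - y) = \<nu> (y - x)" for x y using h(3)[of "-1" "y - x"] by simp
  show "\<bar>\<nu> x - \<nu> y\<bar> \<le> \<nu> (x - y)" using h(2)[of "x - y" y] h(2)[of "y - x" x] m[of x y] by simp
qed

lemma le_weighted_l1:
  fixes \<nu> :: "(nat \<Rightarrow>\<^sub>0 real) \<Rightarrow> real"
  assumes "\<And>x y. \<nu> (x + y) \<le> \<nu> x + \<nu> y" "\<nu> 0 = 0" "\<And>i. \<nu> (Poly_Mapping.single i (Poly_Mapping.lookup x i)) \<le> \<bar>Poly_Mapping.lookup x i\<bar> * M i"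
  shows "\<nu> x \<le> weighted_l1 M x"
proof -
  have "\<nu> (\<Sum>i\<in>A. Poly_Mapping.single i (Poly_Mapping.lookup x i)) \<le> (\<Sum>i\<in>A. \<bar>Poly_Mapping.lookup x i\<bar> * M i)" if "finite A" for A
    using that
  proof induction
    case (insert i A)
    then show ?case
      using assms(1)[of "Poly_Mapping.single i (Poly_Mapping.lookup x i)" "\<Sum>i\<in>A. Poly_Mapping.single i (Poly_Mapping.lookup x i)"] assms(3)[of i]
      by simp
  qed (use assms(2) in simp)
  from this[of "Poly_Mapping.keys x"] show ?thesis
    unfolding weighted_l1_def by (simp flip: poly_mapping_eq_sum_single)
qed

lemma pseudonorm_le_weighted_l1:
  assumes "\<mu> \<in> pseudonorms"
  shows "\<mu> v \<le> weighted_l1 (\<lambda>i. \<mu> (Poly_Mapping.single i 1)) (real_vec v)"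
proof -
  note \<mu> = pseudonormsD[OF assms]
  have "\<mu> (\<Sum>i\<in>A. Poly_Mapping.single i (Poly_Mapping.lookup v i)) \<le> (\<Sum>i\<in>A. \<bar>Poly_Mapping.lookup (real_vec v) i\<bar> * \<mu> (Poly_Mapping.single i 1))" if "finite A" for A
    using that
  proof induction
    case (insert i A)
    have "Poly_Mapping.single i (Poly_Mapping.lookup v i) = fs_scale (Poly_Mapping.lookup v i) (Poly_Mapping.single i 1)"
      by (rule poly_mapping_eqI) (simp add: lookup_fs_scale lookup_single when_def)
    then have "\<mu> (Poly_Mapping.single i (Poly_Mapping.lookup v i)) = \<bar>Poly_Mapping.lookup (real_vec v) i\<bar> * \<mu> (Poly_Mapping.single i 1)"
      by (simp add: \<mu> lookup_map_zero)
    then show ?case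
      using insert \<mu>(2)[of "Poly_Mapping.single i (Poly_Mapping.lookup v i)" "\<Sum>i\<in>A. Poly_Mapping.single i (Poly_Mapping.lookup v i)"]
      by simp
  qed (simp add: \<mu>)
  from this[of "Poly_Mapping.keys v"] have "\<mu> v \<le> (\<Sum>i\<in>Poly_Mapping.keys v. \<bar>Poly_Mapping.lookup (real_vec v) i\<bar> * \<mu> (Poly_Mapping.single i 1))"
    by (simp flip: poly_mapping_eq_sum_single)
  also have "\<dots> = weighted_l1 (\<lambda>i. \<mu> (Poly_Mapping.single i 1)) (real_vec v)"
    by (rule weighted_l1_eq[symmetric]) (auto simp: in_keys_iff lookup_map_zero)
  finally show ?thesis .
qed

lemma pseudonorm_c00_le_weighted_l1:
  assumes "\<nu> \<in> pseudonorms_c00"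
  shows "\<nu> x \<le> weighted_l1 (\<lambda>i. \<nu> (Poly_Mapping.single i 1)) x"
proof (rule le_weighted_l1)
  note \<nu> = pseudonorms_c00D[OF assms]
  fix i
  have "Poly_Mapping.single i (Poly_Mapping.lookup x i) = Poly_Mapping.lookup x i *\<^sub>R Poly_Mapping.single i 1"
    by (rule poly_mapping_eqI) (simp add: lookup_scaleR lookup_single when_def)
  then show "\<nu> (Poly_Mapping.single i (Poly_Mapping.lookup x i)) \<le> \<bar>Poly_Mapping.lookup x i\<bar> * \<nu> (Poly_Mapping.single i 1)"
    by (simp add: \<nu>)
qed (use pseudonorms_c00D[OF assms] in auto)

lemma real_vec_single: "real_vec (Poly_Mapping.single i 1) = Poly_Mapping.single i 1"
  by (rule poly_mapping_eqI) (simp add: lookup_map_zero lookup_single when_def)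

text \<open>Existence is by the McShane formula for Lipschitz extensions.\<close>

lemma extend_pseudonorm:
  assumes \<mu>P: "\<mu> \<in> pseudonorms"
  shows "extend \<mu> \<in> pseudonorms_c00" "extend \<mu> (real_vec v) = \<mu> v"
proof -
  note \<mu> = pseudonormsD[OF \<mu>P]
  define M where "M i = \<mu> (Poly_Mapping.single i 1)" for i
  have M: "0 \<le> M i" for i by (simp add: M_def \<mu>)
  let ?L = "weighted_l1 M"
  note L = weighted_l1_triangle[of M, OF M] weighted_l1_scale[of M] weighted_l1_nonneg[of M, OF M]
  have L0: "?L 0 = 0" using L(2)[of 0 0] by simp
  have \<mu>L: "\<mu> v \<le> ?L (real_vec v)" for v
    using pseudonorm_le_weighted_l1[OF \<mu>P] by (simp add: M_def[abs_def])
  define \<nu> where "\<nu> x = (INF v. \<mu> v + ?L (x - real_vec v))" for x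
  have bdd: "bdd_below (range (\<lambda>v. \<mu> v + ?L (x - real_vec v)))" for x
    by (rule bdd_belowI[of _ 0]) (auto intro!: add_nonneg_nonneg \<mu> L)
  have le: "\<nu> x \<le> \<mu> v + ?L (x - real_vec v)" for x v
    unfolding \<nu>_def by (rule cINF_lower[OF bdd]) simp
  have ge: "c \<le> \<nu> x" if "\<And>v. c \<le> \<mu> v + ?L (x - real_vec v)" for c x
    unfolding \<nu>_def using that by (intro cINF_greatest) auto
  have nn: "0 \<le> \<nu> x" for x by (rule ge) (intro add_nonneg_nonneg \<mu> L)
  have ext: "\<nu> (real_vec v) = \<mu> v" for v
  proof (rule antisym)
    show "\<nu> (real_vec v) \<le> \<mu> v" using le[of "real_vec v" v] L0 by simp
    show "\<mu> v \<le> \<nu> (real_vec v)"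
    proof (rule ge)
      fix w show "\<mu> v \<le> \<mu> w + ?L (real_vec v - real_vec w)"
        using \<mu>(2)[of w "v - w"] \<mu>L[of "v - w"] by (simp add: real_vec_diff)
    qed
  qed
  have approx: "\<exists>v. \<mu> v + ?L (x - real_vec v) < \<nu> x + e" if "0 < e" for x e
    using cINF_less_iff[OF _ bdd[of x], of "\<nu> x + e"] that by (auto simp: \<nu>_def[symmetric])
  have tri: "\<nu> (x + y) \<le> \<nu> x + \<nu> y" for x y
  proof (rule field_le_epsilon)
    fix e :: real assume "0 < e"
    then obtain v w where v: "\<mu> v + ?L (x - real_vec v) < \<nu> x + e/2" and w: "\<mu> w + ?L (y - real_vec w) < \<nu> y + e/2"
      using approx[of "e/2"] by (meson half_gt_zero)
    have "\<nu> (x + y) \<le> \<mu> (v + w) + ?L (x - real_vec v + (y - real_vec w))"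
      using le[of "x + y" "v + w"] by (simp add: real_vec_add algebra_simps)
    also have "\<dots> \<le> \<mu> v + \<mu> w + (?L (x - real_vec v) + ?L (y - real_vec w))"
      by (intro add_mono \<mu> L)
    finally show "\<nu> (x + y) \<le> \<nu> x + \<nu> y + e" using v w by simp
  qed
  have \<nu>L: "\<nu> x \<le> ?L x" for x
    using le[of x 0] real_vec_sum[of "\<lambda>_. 0" "{}"] by (simp add: \<mu>)
  \<comment> \<open>Replacing \<open>v\<close> by \<open>r\<close> times \<open>v\<close> scales
    both summands under the infimum. Real factors follow by approximation, since \<open>v\<close>
    may only be scaled by rationals.\<close>
  have rat_le: "\<nu> (real_of_rat r *\<^sub>R x) \<le> \<bar>real_of_rat r\<bar> * \<nu> x" for r x
  proof (cases "r = 0")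
    case True
    then show ?thesis using ext[of 0] real_vec_sum[of "\<lambda>_. 0" "{}"] by (simp add: \<mu>)
  next
    case False
    then have r: "0 < \<bar>real_of_rat r\<bar>" by simp
    have "\<nu> (real_of_rat r *\<^sub>R x) / \<bar>real_of_rat r\<bar> \<le> \<nu> x"
    proof (rule ge)
      fix v
      have "\<nu> (real_of_rat r *\<^sub>R x) \<le> \<mu> (fs_scale r v) + ?L (real_of_rat r *\<^sub>R (x - real_vec v))"
        using le[of "real_of_rat r *\<^sub>R x" "fs_scale r v"] by (simp add: real_vec_scale scaleR_diff_right)
      also have "\<dots> = \<bar>real_of_rat r\<bar> * (\<mu> v + ?L (x - real_vec v))"
        by (simp add: \<mu>(3) L(2) distrib_left)
      finally show "\<nu> (real_of_rat r *\<^sub>R x) / \<bar>real_of_rat r\<bar> \<le> \<mu> v + ?L (x - real_vec v)"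
        using r by (simp add: pos_divide_le_eq mult.commute)
    qed
    then show ?thesis using r by (simp add: pos_divide_le_eq mult.commute)
  qed
  have hom_le: "\<nu> (a *\<^sub>R x) \<le> \<bar>a\<bar> * \<nu> x" for a x
  proof (rule field_le_epsilon)
    fix e :: real assume e: "0 < e"
    \<comment> \<open>Makes both errors, from enlarging \<open>\<bar>a\<bar>\<close> by
      \<open>\<eta>\<close> and from the remainder bounded by \<open>?L\<close>, sum up to at most
      \<open>e\<close>.\<close>
    define \<eta> where "\<eta> = e / (?L x + \<nu> x + 1)"
    have pos: "0 < ?L x + \<nu> x + 1" using nn[of x] L(3)[of x] by simp
    have \<eta>: "0 < \<eta>" using e pos by (simp add: \<eta>_def)
    obtain r where "a - \<eta> < real_of_rat r" "real_of_rat r < a + \<eta>"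
      using of_rat_dense[of "a - \<eta>" "a + \<eta>"] \<eta> by auto
    then have r: "\<bar>a - real_of_rat r\<bar> \<le> \<eta>" by (simp add: abs_le_iff)
    have r': "\<bar>real_of_rat r\<bar> \<le> \<bar>a\<bar> + \<eta>" using r by linarith
    have "\<nu> (a *\<^sub>R x) \<le> \<nu> (real_of_rat r *\<^sub>R x) + \<nu> ((a - real_of_rat r) *\<^sub>R x)"
      using tri[of "real_of_rat r *\<^sub>R x" "(a - real_of_rat r) *\<^sub>R x"] by (simp flip: scaleR_add_left)
    also have "\<dots> \<le> \<bar>real_of_rat r\<bar> * \<nu> x + \<bar>a - real_of_rat r\<bar> * ?L x"
      using rat_le \<nu>L[of "(a - real_of_rat r) *\<^sub>R x"] by (intro add_mono) (auto simp: L(2))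
    also have "\<dots> \<le> (\<bar>a\<bar> + \<eta>) * \<nu> x + \<eta> * ?L x"
      using r r' nn[of x] L(3)[of x] by (intro add_mono mult_right_mono)
    also have "\<dots> = \<bar>a\<bar> * \<nu> x + \<eta> * (?L x + \<nu> x)" by (simp add: algebra_simps)
    also have "\<eta> * (?L x + \<nu> x) \<le> e" using e pos by (simp add: \<eta>_def field_simps)
    finally show "\<nu> (a *\<^sub>R x) \<le> \<bar>a\<bar> * \<nu> x + e" by simp
  qed
  have hom: "\<nu> (a *\<^sub>R x) = \<bar>a\<bar> * \<nu> x" for a x
  proof (cases "a = 0")
    case True
    then show ?thesis using hom_le[of 0 x] nn[of "0 *\<^sub>R x"] by simp
  next
    case False
    then have "\<bar>a\<bar> * \<nu> x \<le> \<nu> (a *\<^sub>R x)"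
      using hom_le[of "1 / a" "a *\<^sub>R x"] by (simp add: field_simps)
    then show ?thesis using hom_le[of a x] by simp
  qed
  have \<nu>P: "\<nu> \<in> pseudonorms_c00"
    using nn tri hom by (auto simp: pseudonorms_c00_def fs_scale_real)
  have uniq: "\<nu>' = \<nu>" if P: "\<nu>' \<in> pseudonorms_c00" and ext': "\<forall>x. \<nu>' (real_vec x) = \<mu> x" for \<nu>'
  proof
    fix x
    \<comment> \<open>The unit vectors are rational and fix the weights, so both extensions are
      Lipschitz for the same weighted l_1-norm and can be compared at a nearby rational
      vector.\<close>
    have "(\<lambda>i. \<nu>' (Poly_Mapping.single i 1)) = M"
      using ext'[rule_format, of "Poly_Mapping.single _ 1"] by (simp add: M_def[abs_def] real_vec_single)
    then have \<nu>'L: "\<nu>' y \<le> ?L y" for y using pseudonorm_c00_le_weighted_l1[OF P] by simp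
    have "\<bar>\<nu>' x - \<nu> x\<bar> \<le> 0"
    proof (rule field_le_epsilon)
      fix e :: real assume "0 < e"
      then obtain v where v: "?L (x - real_vec v) < e / 2" using real_vec_dense[of M "e/2" x] M by auto
      have "\<bar>\<nu>' x - \<mu> v\<bar> \<le> ?L (x - real_vec v)"
        using pseudonorms_c00D(6)[OF P, of x "real_vec v"] \<nu>'L[of "x - real_vec v"] ext' by simp
      moreover have "\<bar>\<nu> x - \<mu> v\<bar> \<le> ?L (x - real_vec v)"
        using pseudonorms_c00D(6)[OF \<nu>P, of x "real_vec v"] \<nu>L[of "x - real_vec v"] ext by simp
      ultimately show "\<bar>\<nu>' x - \<nu> x\<bar> \<le> 0 + e" using v by simp
    qed
    then show "\<nu>' x = \<nu> x" by simp
  qed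
  have "extend \<mu> = \<nu>"
    unfolding extend_def
  proof (rule the_equality)
    show "\<nu> \<in> pseudonorms_c00 \<and> (\<forall>x. \<nu> (real_vec x) = \<mu> x)" using \<nu>P ext by simp
  qed (elim conjE, rule uniq)
  then show "extend \<mu> \<in> pseudonorms_c00" "extend \<mu> (real_vec v) = \<mu> v"
    using \<nu>P ext by auto
qed

lemma real_vec_dense_pseudonorm:
  assumes "\<nu> \<in> pseudonorms_c00" "0 < e"
  shows "\<exists>v. \<nu> (x - real_vec v) < e"
  using real_vec_dense[of "\<lambda>i. \<nu> (Poly_Mapping.single i 1)" e x] pseudonorm_c00_le_weighted_l1[OF assms(1)]
    pseudonorms_c00D(1)[OF assms(1)] assms(2) by (meson le_less_trans)

section \<open>The space of pseudonorms\<close>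

lemma countable_union_gdelta: "(\<And>k::nat. gdelta_in T (A k)) \<Longrightarrow> gdelta_sigma_in T (\<Union>k. A k)"
  unfolding gdelta_sigma_in_def union_of_def by (intro exI[of _ "range A"]) auto

text \<open>The classical embedding into l_infinity, here the bounded continuous functions on the
  discrete naturals: norming functionals are taken at the countably many rational vectors, and
  density makes the map isometric everywhere.\<close>

lemma pseudonorm_c00_isometry:
  assumes "\<nu> \<in> pseudonorms_c00"
  obtains \<theta> :: "(nat \<Rightarrow>\<^sub>0 real) \<Rightarrow> (nat \<Rightarrow>\<^sub>C real)" where "linear \<theta>" "\<And>x. norm (\<theta> x) = \<nu> x"
proof -
  note \<nu> = pseudonorms_c00D[OF assms]
  define v where "v n = real_vec (from_nat_into UNIV n)" for n
  have "\<exists>f. \<forall>n. linear (f n) \<and> f n (v n) = \<nu> (v n) \<and> (\<forall>x. \<bar>f n x\<bar> \<le> \<nu> x)"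
    using hahn_banach_seminorm[of \<nu>, OF \<nu>(1,2,3)] by (intro choice allI) metis
  then obtain f where f: "\<And>n. linear (f n)" "\<And>n. f n (v n) = \<nu> (v n)" "\<And>n x. \<bar>f n x\<bar> \<le> \<nu> x"
    by blast
  define \<theta> :: "(nat \<Rightarrow>\<^sub>0 real) \<Rightarrow> (nat \<Rightarrow>\<^sub>C real)" where "\<theta> x = Bcontfun (\<lambda>n. f n x)" for x
  have \<theta>: "apply_bcontfun (\<theta> x) n = f n x" for x n
  proof -
    have "(\<lambda>n. f n x) \<in> bcontfun"
      by (rule bcontfun_normI[of _ "\<nu> x"]) (use f(3) in auto)
    then show ?thesis by (simp add: \<theta>_def Bcontfun_inverse)
  qed
  have lin: "linear \<theta>"
    by (rule linearI; rule bcontfun_eqI)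
      (simp_all add: \<theta> plus_bcontfun.rep_eq scaleR_bcontfun.rep_eq linear_add[OF f(1)] linear_scale[OF f(1)])
  moreover have "norm (\<theta> x) = \<nu> x" for x
  proof (rule antisym)
    show "norm (\<theta> x) \<le> \<nu> x" by (rule norm_bound) (use f(3) \<theta> in simp)
    show "\<nu> x \<le> norm (\<theta> x)"
    proof (rule field_le_epsilon)
      fix e :: real assume "0 < e"
      then obtain w where w: "\<nu> (x - real_vec w) < e / 2"
        using real_vec_dense_pseudonorm[OF assms, of "e/2" x] by auto
      obtain n where n: "from_nat_into UNIV n = w"
        using from_nat_into_surj[OF countable_finitely_supported, of w] by auto
      have "\<nu> x \<le> \<nu> (v n) + \<nu> (x - v n)" using \<nu>(2)[of "v n" "x - v n"] by simp
      also have "\<nu> (v n) = f n x - f n (x - v n)" by (simp add: linear_diff[OF f(1)] f(2))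
      also have "\<dots> \<le> norm (\<theta> x) + \<nu> (x - v n)"
        using norm_bounded[of "\<theta> x" n] f(3)[of n "x - v n"] by (simp add: \<theta>)
      finally show "\<nu> x \<le> norm (\<theta> x) + e" using w by (simp add: v_def n)
    qed
  qed
  ultimately show ?thesis using that by blast
qed

lemma complete_bcontfun: "complete (UNIV :: ('a::topological_space \<Rightarrow>\<^sub>C 'b::complete_space) set)"
  unfolding complete_def
proof (intro allI impI, elim conjE)
  fix f :: "nat \<Rightarrow> 'a \<Rightarrow>\<^sub>C 'b" assume "Cauchy f"
  then have "\<exists>N. \<forall>m n x. N \<le> m \<and> N \<le> n \<longrightarrow> dist (f m x) (f n x) < e" if "0 < e" for e
    using that unfolding Cauchy_def by (meson dist_bounded le_less_trans)
  then obtain g where "uniform_limit UNIV (\<lambda>n. apply_bcontfun (f n)) g sequentially"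
    using uniformly_convergent_eq_cauchy[of "\<lambda>_. True" "\<lambda>n. apply_bcontfun (f n)"]
    unfolding uniform_limit_sequentially_iff by auto
  from uniform_limit_bcontfunE[OF this sequentially_bot]
  show "\<exists>l\<in>UNIV. f \<longlonglongrightarrow> l" by (metis UNIV_I)
qed

section \<open>Open conditions on pseudonorms\<close>

definition rat_comb :: "nat \<Rightarrow> (nat \<Rightarrow> (nat \<Rightarrow>\<^sub>0 rat)) \<Rightarrow> (nat \<Rightarrow> rat) \<Rightarrow> (nat \<Rightarrow>\<^sub>0 rat)" where
  "rat_comb m w q = (\<Sum>i<m. fs_scale (q i) (w i))"

text \<open>Stated for arbitrary real functions on V, so that it is open in the product space. For
  fixed witnesses, rational coefficients included, only finitely many values of \<open>\<mu>\<close>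
  enter. The bounds on \<open>N\<close> are those under which the grid test implies
  \<open>lp_basis\<close>.\<close>

definition pseudonorm_approx :: "ennreal \<Rightarrow> real \<Rightarrow> (nat \<Rightarrow>\<^sub>0 rat) list \<Rightarrow> nat \<Rightarrow> ((nat \<Rightarrow>\<^sub>0 rat) \<Rightarrow> real) set" where
  "pseudonorm_approx p K xs n = {\<mu>. \<exists>m w N a b. 0 < a \<and> b < K * a \<and>
     0 < N \<and> 4 * real m \<le> real N \<and> 8 * K * real m \<le> real N \<and>
     (\<forall>x\<in>set xs. \<exists>q. \<mu> (x - rat_comb m w q) < 1 / real (Suc n)) \<and>
     lp_grid p m N a b (\<lambda>k. \<mu> (rat_comb m w (\<lambda>i. rat_of_int (k i))))}"

lemma ex_grid_size: "\<exists>N. 0 < N \<and> 4 * real m \<le> real N \<and> 8 * K * real m \<le> real N"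
proof -
  obtain N1 N2 :: nat where "4 * real m \<le> real N1" "8 * K * real m \<le> real N2"
    using real_arch_simple by metis
  then show ?thesis by (intro exI[of _ "Suc (max N1 N2)"]) auto
qed

lemma open_pseudonorm_approx: "open (pseudonorm_approx p K xs n)"
proof -
  have cont: "continuous_on UNIV (\<lambda>\<mu> :: (nat \<Rightarrow>\<^sub>0 rat) \<Rightarrow> real. \<mu> x)" for x
    by simp
  have 1: "open {\<mu> :: (nat \<Rightarrow>\<^sub>0 rat) \<Rightarrow> real. \<forall>x\<in>set xs. \<exists>q. \<mu> (x - rat_comb m w q) < 1 / real (Suc n)}" for m w
  proof -
    have eq: "{\<mu> :: (nat \<Rightarrow>\<^sub>0 rat) \<Rightarrow> real. \<forall>x\<in>set xs. \<exists>q. \<mu> (x - rat_comb m w q) < 1 / real (Suc n)} =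
      (\<Inter>x\<in>set xs. \<Union>q. {\<mu>. \<mu> (x - rat_comb m w q) < 1 / real (Suc n)})" by auto
    show ?thesis unfolding eq
      by (intro open_INT open_UN ballI finite_set open_Collect_less cont continuous_on_const)
  qed
  have 2: "open {\<mu> :: (nat \<Rightarrow>\<^sub>0 rat) \<Rightarrow> real. lp_grid p m N a b (\<lambda>k. \<mu> (rat_comb m w (\<lambda>i. rat_of_int (k i))))}" for m w N a b
    by (intro open_lp_grid cont)
  show ?thesis
    unfolding pseudonorm_approx_def
    by (intro open_Collect_ex open_Collect_conj open_Collect_const 1 2)
qed

text \<open>A rational combination of images of vectors of V is the image of a vector of V, so its
  norm is a value of \<open>\<mu>\<close>. This is why the grid has integer coefficients.\<close>

lemma
  assumes p: "1 \<le> p" and lin: "linear \<theta>" and iso: "\<And>v. norm (\<theta> (real_vec v) :: 'b::real_normed_vector) = \<mu> v"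
  shows pseudonorm_approx_if: "approx_lp_bases p K (range (\<lambda>v. \<theta> (real_vec v))) \<Longrightarrow> \<mu> \<in> pseudonorm_approx p K xs n"
    and approx_if_pseudonorm_approx: "(\<And>xs n. \<mu> \<in> pseudonorm_approx p K xs n) \<Longrightarrow>
      approx_lp_bases p (17 * K) (range (\<lambda>v. \<theta> (real_vec v)))"
proof -
  let ?\<theta> = "\<lambda>v. \<theta> (real_vec v)"
  have comb: "?\<theta> (rat_comb m w q) = (\<Sum>i<m. real_of_rat (q i) *\<^sub>R ?\<theta> (w i))" for m w q
    by (simp add: rat_comb_def real_vec_sum real_vec_scale linear_sum[OF lin] linear_scale[OF lin])
  have err: "norm (?\<theta> x - (\<Sum>i<m. real_of_rat (q i) *\<^sub>R ?\<theta> (w i))) = \<mu> (x - rat_comb m w q)" for x m w q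
    by (simp add: comb[symmetric] linear_diff[OF lin, symmetric] real_vec_diff[symmetric] iso)
  have grid: "norm (\<Sum>i<m. real_of_int (k i) *\<^sub>R ?\<theta> (w i)) = \<mu> (rat_comb m w (\<lambda>i. rat_of_int (k i)))" for m k w
    using comb[of m w "\<lambda>i. rat_of_int (k i)"] iso[of "rat_comb m w (\<lambda>i. rat_of_int (k i))"] by simp
  { assume approx: "approx_lp_bases p K (range ?\<theta>)"
    obtain m g where g: "\<forall>i<m. g i \<in> range ?\<theta>" "lp_basis p K m g"
      and q: "\<forall>y\<in>?\<theta> ` set xs. \<exists>q. norm (y - (\<Sum>i<m. real_of_rat (q i) *\<^sub>R g i)) < 1 / real (Suc n)"
      using approx[unfolded approx_lp_bases_def, rule_format, of "?\<theta> ` set xs" "1 / real (Suc n)"] by auto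
    define w where "w i = inv ?\<theta> (g i)" for i
    have w: "g i = ?\<theta> (w i)" if "i < m" for i
      using g(1) that f_inv_into_f[of "g i" ?\<theta> UNIV] by (simp add: w_def)
    have gw: "(\<Sum>i<m. c i *\<^sub>R g i) = (\<Sum>i<m. c i *\<^sub>R ?\<theta> (w i))" for c
      using w by (intro sum.cong) auto
    obtain a b where ab: "0 < a" "b < K * a"
      "\<And>N. 0 < N \<Longrightarrow> lp_grid p m N a b (\<lambda>k. norm (\<Sum>i<m. real_of_int (k i) *\<^sub>R g i))"
      using lp_grid_if_lp_basis[OF p g(2)] by blast
    obtain N where N: "0 < N" "4 * real m \<le> real N" "8 * K * real m \<le> real N"
      using ex_grid_size by blast
    have "\<forall>x\<in>set xs. \<exists>q. \<mu> (x - rat_comb m w q) < 1 / real (Suc n)"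
      using q unfolding gw err[symmetric] by simp
    moreover have "lp_grid p m N a b (\<lambda>k. \<mu> (rat_comb m w (\<lambda>i. rat_of_int (k i))))"
      using ab(3)[OF N(1)] unfolding gw grid .
    ultimately show "\<mu> \<in> pseudonorm_approx p K xs n"
      unfolding pseudonorm_approx_def mem_Collect_eq using ab(1,2) N by blast }
  assume good: "\<And>xs n. \<mu> \<in> pseudonorm_approx p K xs n"
  show "approx_lp_bases p (17 * K) (range ?\<theta>)"
    unfolding approx_lp_bases_def
  proof (intro allI impI, elim conjE)
    fix B and \<epsilon> :: real assume finB: "finite B" and B: "B \<subseteq> range ?\<theta>" and \<epsilon>: "0 < \<epsilon>"
    obtain C where C: "finite C" "B = ?\<theta> ` C"
      using finite_subset_image[OF finB B] by blast
    obtain xs where xs: "set xs = C" using finite_list[OF C(1)] by blast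
    obtain n where n: "1 / real (Suc n) < \<epsilon>" using nat_approx_posE[OF \<epsilon>] by auto
    obtain m w N a b where *: "0 < a" "b < K * a" "0 < N" "4 * real m \<le> real N" "8 * K * real m \<le> real N"
      "\<forall>x\<in>set xs. \<exists>q. \<mu> (x - rat_comb m w q) < 1 / real (Suc n)"
      "lp_grid p m N a b (\<lambda>k. \<mu> (rat_comb m w (\<lambda>i. rat_of_int (k i))))"
      using good[of xs n] unfolding pseudonorm_approx_def by blast
    have "lp_basis p (17 * K) m (\<lambda>i. ?\<theta> (w i))"
      by (rule lp_basis_if_lp_grid[OF p *(1-5)]) (use *(7) in \<open>simp only: grid\<close>)
    moreover have "\<forall>y\<in>B. \<exists>q. norm (y - (\<Sum>i<m. real_of_rat (q i) *\<^sub>R ?\<theta> (w i))) < \<epsilon>"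
      using *(6) n unfolding C(2) xs ball_simps err by (meson less_trans)
    ultimately show "\<exists>m g. (\<forall>i<m. g i \<in> range ?\<theta>) \<and> lp_basis p (17 * K) m g \<and>
        (\<forall>y\<in>B. \<exists>q. norm (y - (\<Sum>i<m. real_of_rat (q i) *\<^sub>R g i)) < \<epsilon>)"
      by (intro exI[of _ m] exI[of _ "\<lambda>i. ?\<theta> (w i)"]) auto
  qed
qed

lemma script_Lp_X_space_iff:
  assumes p: "1 \<le> p" and \<mu>: "\<mu> \<in> pseudonorms"
  shows "script_Lp p (X_space \<mu>) \<longleftrightarrow> (\<exists>K::nat. \<forall>xs n. \<mu> \<in> pseudonorm_approx p (real K) xs n)"
proof -
  define \<nu> where "\<nu> = extend \<mu>"
  have \<nu>: "\<nu> \<in> pseudonorms_c00" and ext: "\<And>v. \<nu> (real_vec v) = \<mu> v"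
    using extend_pseudonorm[OF \<mu>] by (simp_all add: \<nu>_def)
  obtain \<theta> :: "(nat \<Rightarrow>\<^sub>0 real) \<Rightarrow> (nat \<Rightarrow>\<^sub>C real)" where lin: "linear \<theta>" and iso: "\<And>x. norm (\<theta> x) = \<nu> x"
    using pseudonorm_c00_isometry[OF \<nu>] by blast
  have "isometric_map (c00_space \<nu>) \<theta>"
    using lin iso by (auto simp: isometric_map_def linear_subspace_def c00_space_def fs_scale_real
        linear_0 linear_add linear_scale)
  from completion_embedding[OF this complete_bcontfun] obtain \<Theta> :: "_ \<Rightarrow> (nat \<Rightarrow>\<^sub>C real)" where
    \<Theta>: "isometric_embedding (X_space \<mu>) \<Theta>" "\<Theta> ` vecs (X_space \<mu>) = closure (range \<theta>)"
    by (auto simp: X_space_def \<nu>_def c00_space_def)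
  let ?S = "closure (range \<theta>)" and ?D = "range (\<lambda>v. \<theta> (real_vec v))"
  have S: "subspace ?S" using subspace_isometric_image[OF \<Theta>(1)] \<Theta>(2) by simp
  have DS: "?D \<subseteq> ?S" using closure_subset[of "range \<theta>"] by blast
  have "range \<theta> \<subseteq> closure ?D"
  proof safe
    fix x
    show "\<theta> x \<in> closure ?D"
      unfolding closure_approachable
    proof (intro allI impI)
      fix e :: real assume "0 < e"
      then obtain v where "\<nu> (x - real_vec v) < e" using real_vec_dense_pseudonorm[OF \<nu>] by blast
      then have "dist (\<theta> (real_vec v)) (\<theta> x) < e"
        using iso[of "x - real_vec v"] by (simp add: dist_norm norm_minus_commute linear_diff[OF lin])
      then show "\<exists>y\<in>?D. dist y (\<theta> x) < e" by blast
    qed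
  qed
  then have SD: "?S \<subseteq> closure ?D" by (rule closure_minimal) simp
  have iso': "norm (\<theta> (real_vec v)) = \<mu> v" for v by (simp add: iso ext)
  have "script_Lp p (X_space \<mu>) \<longleftrightarrow> (\<exists>K. has_lp_bases p K ?S)"
    using script_Lp_iff_has_lp_bases[OF p \<Theta>(1)] \<Theta>(2) by simp
  also have "\<dots> \<longleftrightarrow> (\<exists>K::nat. \<forall>xs n. \<mu> \<in> pseudonorm_approx p (real K) xs n)"
  proof
    assume "\<exists>K. has_lp_bases p K ?S"
    then obtain K0 where K0: "has_lp_bases p K0 ?S" by blast
    \<comment> \<open>Rounding \<open>K0\<close> up to a natural number keeps the union over
      constants countable.\<close>
    obtain K :: nat where "K0 \<le> real K" using real_arch_simple by blast
    then have "approx_lp_bases p (real K) ?D"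
      using approx_if_has_lp_bases[OF p DS SD] has_lp_bases_mono[OF K0] by blast
    then show "\<exists>K::nat. \<forall>xs n. \<mu> \<in> pseudonorm_approx p (real K) xs n"
      using pseudonorm_approx_if[OF p lin iso'] by blast
  next
    assume "\<exists>K::nat. \<forall>xs n. \<mu> \<in> pseudonorm_approx p (real K) xs n"
    then obtain K :: nat where "\<And>xs n. \<mu> \<in> pseudonorm_approx p (real K) xs n" by blast
    then have "approx_lp_bases p (17 * real K) ?D"
      by (rule approx_if_pseudonorm_approx[OF p lin iso'])
    then show "\<exists>K. has_lp_bases p K ?S"
      using has_lp_bases_if_approx[OF S DS SD] by blast
  qed
  finally show ?thesis .
qed

lemma gdelta_sigma_pseudonorms:
  assumes "1 \<le> p"
  shows "gdelta_sigma_in (top_of_set pseudonorms) {\<mu> \<in> pseudonorms. script_Lp p (X_space \<mu>)}"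
proof -
  define A where "A K = (\<Inter>(xs, n)\<in>UNIV. pseudonorms \<inter> pseudonorm_approx p (real K) xs n)" for K
  have "{\<mu> \<in> pseudonorms. script_Lp p (X_space \<mu>)} = (\<Union>K. A K)"
    using script_Lp_X_space_iff[OF assms] by (force simp: A_def)
  moreover have "countable (UNIV :: ((nat \<Rightarrow>\<^sub>0 rat) list \<times> nat) set)"
    using countable_SIGMA[OF countable_lists[OF countable_finitely_supported[where 'a = nat and 'b = rat]], of "\<lambda>_. UNIV :: nat set"]
    by simp
  then have "gdelta_in (top_of_set pseudonorms) (A K)" for K
    unfolding A_def
    by (intro gdelta_in_Inter) (auto intro!: open_imp_gdelta_in openin_open_Int open_pseudonorm_approx)
  ultimately show ?thesis using countable_union_gdelta by metis
qed

section \<open>Admissible topologies\<close>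

lemma open_cylinder: "open {y :: nat \<Rightarrow> 'a::discrete_topology. \<forall>i<n. y i = x i}"
proof -
  have "{y :: nat \<Rightarrow> 'a. \<forall>i<n. y i = x i} = (\<Inter>i\<in>{..<n}. (\<lambda>y. y i) -` {x i})"
    by auto
  moreover have "open ((\<lambda>y :: nat \<Rightarrow> 'a. y i) -` {x i})" for i
    by (intro open_vimage open_discrete continuous_on_product_coordinates)
  ultimately show ?thesis by (simp add: open_INT)
qed

lemma ex_cylinder_subset:
  fixes U :: "(nat \<Rightarrow> 'a::topological_space) set"
  assumes "open U" "x \<in> U"
  shows "\<exists>n. {y. \<forall>i<n. y i = x i} \<subseteq> U"
proof -
  have "openin (product_topology (\<lambda>i::nat. euclidean) UNIV) U"
    using assms(1) by (simp add: open_fun_def)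
  from product_topology_open_contains_basis[OF this assms(2)]
  obtain X where X: "x \<in> (\<Pi>\<^sub>E i\<in>UNIV. X i)" "finite {i. X i \<noteq> (UNIV :: 'a set)}" "(\<Pi>\<^sub>E i\<in>UNIV. X i) \<subseteq> U"
    by auto
  obtain n where n: "{i. X i \<noteq> UNIV} \<subseteq> {..<n}"
    using X(2) finite_nat_iff_bounded by blast
  have "y \<in> (\<Pi>\<^sub>E i\<in>UNIV. X i)" if y: "\<forall>i<n. y i = x i" for y
  proof -
    have "y i \<in> X i" for i
    proof (cases "i < n")
      case True
      then show ?thesis using X(1) y by (auto simp: PiE_iff)
    next
      case False
      then have "X i = UNIV" using n by blast
      then show ?thesis by simp
    qed
    then show ?thesis by auto
  qed
  then show ?thesis using X(3) by (intro exI[of _ n]) blast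
qed

lemma compact_Cantor: "compact (UNIV :: (nat \<Rightarrow> bool) set)"
proof -
  have "compact_space (euclidean :: bool topology)"
    by (simp add: compact_space_def compactin_euclidean_iff finite_imp_compact)
  then have "compact_space (product_topology (\<lambda>i::nat. euclidean :: bool topology) UNIV)"
    by (simp add: compact_space_product_topology)
  then show ?thesis
    by (simp add: euclidean_product_topology compact_space_def compactin_euclidean_iff)
qed

text \<open>Finitely many cylinders on which \<open>f\<close> varies little cover the Cantor space;
  the longest of their lengths serves all points.\<close>

lemma Cantor_uniform_continuity:
  fixes f :: cantor_fun
  assumes e: "0 < e"
  obtains n where "\<And>x y. (\<And>i. i < n \<Longrightarrow> x i = y i) \<Longrightarrow> \<bar>f x - f y\<bar> < e"
proof -
  have "\<exists>n. \<forall>y. (\<forall>i<n. y i = x i) \<longrightarrow> \<bar>f y - f x\<bar> < e / 2" for x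
  proof -
    have "open (apply_bcontfun f -` ball (f x) (e / 2))"
      by (intro open_vimage open_ball continuous_on_apply_bcontfun)
    from ex_cylinder_subset[OF this, of x] e obtain n where
      n: "{y. \<forall>i<n. y i = x i} \<subseteq> apply_bcontfun f -` ball (f x) (e / 2)" by auto
    show ?thesis
    proof (intro exI[of _ n] allI impI)
      fix y assume "\<forall>i<n. y i = x i"
      then have "f y \<in> ball (f x) (e / 2)" using n by blast
      then show "\<bar>f y - f x\<bar> < e / 2" by (simp add: dist_real_def abs_minus_commute)
    qed
  qed
  then obtain n where n: "\<And>x y. (\<And>i. i < n x \<Longrightarrow> y i = x i) \<Longrightarrow> \<bar>f y - f x\<bar> < e / 2" by metis
  define C where "C x = {y. \<forall>i<n x. y i = x i}" for x
  obtain Z where Z: "finite Z" "UNIV \<subseteq> (\<Union>z\<in>Z. C z)"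
  proof (rule compactE_image[OF compact_Cantor])
    show "open (C x)" for x unfolding C_def by (rule open_cylinder)
    show "UNIV \<subseteq> (\<Union>x\<in>UNIV. C x)" by (auto simp: C_def)
  qed
  obtain m where m: "n ` Z \<subseteq> {..m}"
    using Z(1) finite_nat_iff_bounded_le[of "n ` Z"] by blast
  show ?thesis
  proof (rule that[of m])
    fix x y :: "nat \<Rightarrow> bool" assume xy: "\<And>i. i < m \<Longrightarrow> x i = y i"
    obtain z where z: "z \<in> Z" "x \<in> C z" using Z(2) by blast
    have "n z \<le> m" using m z(1) by auto
    have zx: "x i = z i" if "i < n z" for i using z(2) that by (simp add: C_def)
    have "\<bar>f x - f z\<bar> < e / 2" by (rule n) (rule zx)
    moreover have "y i = z i" if "i < n z" for i
      using zx[OF that] xy[of i] that \<open>n z \<le> m\<close> by simp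
    then have "\<bar>f y - f z\<bar> < e / 2" by (rule n)
    ultimately show "\<bar>f x - f y\<bar> < e" by linarith
  qed
qed

lemma Cantor_functions_separable:
  obtains D :: "cantor_fun set" where "countable D" "\<And>f e. 0 < e \<Longrightarrow> \<exists>d\<in>D. dist d f < e"
proof -
  define I where "I n = {l :: bool list. length l = n}" for n
  define fn :: "nat \<Rightarrow> (bool list \<Rightarrow> rat) \<Rightarrow> (nat \<Rightarrow> bool) \<Rightarrow> real"
    where "fn n q x = real_of_rat (q (map x [0..<n]))" for n q x
  \<comment> \<open>Rational-valued functions of the first \<open>n\<close> coordinates. Extensional
    functions on the finite set \<open>I n\<close> form a countable index set, which all functions
    on lists would not.\<close>
  define D where "D = (\<Union>n. (\<lambda>q. Bcontfun (fn n q)) ` (I n \<rightarrow>\<^sub>E UNIV))"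
  have finI: "finite (I n)" for n
    using finite_lists_length_eq[of "UNIV :: bool set" n] by (simp add: I_def)
  have "countable D"
    unfolding D_def by (intro countable_UN countable_image countable_PiE finI) auto
  moreover have "\<exists>d\<in>D. dist d f < e" if e: "0 < e" for f e
  proof -
    obtain n where n: "\<And>x y. (\<And>i. i < n \<Longrightarrow> x i = y i) \<Longrightarrow> \<bar>f x - f y\<bar> < e / 4"
      using Cantor_uniform_continuity[of "e / 4" f] e by auto
    \<comment> \<open>The argument of \<open>f\<close> is the word \<open>l\<close> continued by
      \<open>False\<close>, a representative of its cylinder.\<close>
    have "\<exists>q. \<bar>f (\<lambda>i. i < n \<and> l ! i) - real_of_rat q\<bar> < e / 4" for l
    proof -
      let ?r = "f (\<lambda>i. i < n \<and> l ! i)"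
      obtain q where "?r - e / 4 < real_of_rat q" "real_of_rat q < ?r + e / 4"
        using of_rat_dense[of "?r - e / 4" "?r + e / 4"] e by auto
      then have "\<bar>?r - real_of_rat q\<bar> < e / 4" by linarith
      then show ?thesis ..
    qed
    then obtain q0 where q0: "\<And>l. \<bar>f (\<lambda>i. i < n \<and> l ! i) - real_of_rat (q0 l)\<bar> < e / 4" by metis
    define q where "q = restrict q0 (I n)"
    have close: "\<bar>f x - fn n q x\<bar> \<le> e / 2" for x
    proof -
      let ?l = "map x [0..<n]"
      have "fn n q x = real_of_rat (q0 ?l)" by (simp add: fn_def q_def I_def)
      moreover have "\<bar>f x - f (\<lambda>i. i < n \<and> ?l ! i)\<bar> < e / 4" by (rule n) simp
      ultimately show ?thesis using q0[of ?l] by linarith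
    qed
    have "fn n q \<in> bcontfun"
    proof (rule bcontfun_normI)
      show "continuous_on UNIV (fn n q)"
        unfolding continuous_on_def
      proof
        fix x
        have const: "fn n q y = fn n q x" if "y \<in> {y. \<forall>i<n. y i = x i}" for y
        proof -
          have "map y [0..<n] = map x [0..<n]" using that by simp
          then show ?thesis by (simp only: fn_def)
        qed
        have "\<forall>\<^sub>F y in nhds x. y \<in> {y. \<forall>i<n. y i = x i}"
          by (rule eventually_nhds_in_open[OF open_cylinder]) simp
        then have "\<forall>\<^sub>F y in nhds x. fn n q y = fn n q x"
          by (rule eventually_mono) (rule const)
        then show "(fn n q \<longlongrightarrow> fn n q x) (at x within UNIV)"
          by (intro tendsto_eventually) (simp add: eventually_nhds_conv_at)
      qed
      fix x show "norm (fn n q x) \<le> norm f + e / 2"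
        using close[of x] norm_bounded[of f x] unfolding real_norm_def by linarith
    qed
    then have ap: "apply_bcontfun (Bcontfun (fn n q)) = fn n q" by (rule Bcontfun_inverse)
    have "dist (Bcontfun (fn n q)) f \<le> e / 2"
      by (rule dist_bound) (use close in \<open>simp add: ap dist_real_def abs_minus_commute\<close>)
    moreover have "Bcontfun (fn n q) \<in> D"
      unfolding D_def by (intro UN_I[of n] imageI) (auto simp: q_def)
    ultimately show ?thesis using e by (intro bexI[of _ "Bcontfun (fn n q)"]) auto
  qed
  ultimately show ?thesis using that by blast
qed

section \<open>Conditions on closed subspaces in an admissible topology\<close>

lemma openin_meets_open:
  fixes W :: "(nat \<Rightarrow> cantor_fun) set"
  assumes adm: "admissible \<tau>" and W: "open W"
  shows "openin \<tau> {F \<in> SB. \<exists>w\<in>W. \<forall>i<m. w i \<in> F}"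
proof (subst openin_subopen, intro ballI)
  have top: "topspace \<tau> = SB" and Ep: "\<And>U. open U \<Longrightarrow> openin \<tau> (E_plus U)"
    using adm by (auto simp: admissible_def)
  fix F assume F: "F \<in> {F \<in> SB. \<exists>w\<in>W. \<forall>i<m. w i \<in> F}"
  then obtain w where w: "w \<in> W" "\<And>i. i < m \<Longrightarrow> w i \<in> F" by auto
  have "openin (product_topology (\<lambda>i::nat. euclidean) UNIV) W"
    using W by (simp add: open_fun_def)
  from product_topology_open_contains_basis[OF this w(1)]
  obtain U where U: "w \<in> (\<Pi>\<^sub>E i\<in>UNIV. U i)" "\<And>i. open (U i)" "(\<Pi>\<^sub>E i\<in>UNIV. U i) \<subseteq> W"
    by auto
  \<comment> \<open>A box inside \<open>W\<close> splits the condition into finitely many hitting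
    conditions. The intersection with the carrier covers \<open>m = 0\<close>, where the indexed
    intersection is everything.\<close>
  define T where "T = topspace \<tau> \<inter> (\<Inter>i<m. E_plus (U i))"
  have "openin \<tau> T"
  proof (cases "m = 0")
    case False
    then show ?thesis unfolding T_def
      using U(2) Ep by (intro openin_Int openin_topspace openin_INT2) auto
  qed (simp add: T_def)
  moreover have "F \<in> T"
    using F w(2) U(1) by (auto simp: T_def top E_plus_def)
  moreover have "T \<subseteq> {F \<in> SB. \<exists>w\<in>W. \<forall>i<m. w i \<in> F}"
  proof
    fix G assume G: "G \<in> T"
    then have "\<forall>i\<in>{..<m}. \<exists>y. y \<in> G \<inter> U i" by (auto simp: T_def E_plus_def)
    then obtain y where y: "\<And>i. i < m \<Longrightarrow> y i \<in> G \<inter> U i" by (metis lessThan_iff)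
    \<comment> \<open>Membership in \<open>G\<close> is asked only below \<open>m\<close>; the other
      coordinates are kept from \<open>w\<close> to stay in the box.\<close>
    have "(\<lambda>i. if i < m then y i else w i) \<in> (\<Pi>\<^sub>E i\<in>UNIV. U i)"
      using y U(1) by (auto simp: PiE_iff)
    then have "(\<lambda>i. if i < m then y i else w i) \<in> W" using U(3) by blast
    moreover have "\<forall>i<m. (if i < m then y i else w i) \<in> G" using y by simp
    moreover have "G \<in> SB" using G by (simp add: T_def top)
    ultimately show "G \<in> {F \<in> SB. \<exists>w\<in>W. \<forall>i<m. w i \<in> F}"
      by (intro CollectI conjI bexI[of _ "\<lambda>i. if i < m then y i else w i"])
  qed
  ultimately show "\<exists>T. openin \<tau> T \<and> F \<in> T \<and> T \<subseteq> {F \<in> SB. \<exists>w\<in>W. \<forall>i<m. w i \<in> F}"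
    by blast
qed

text \<open>The tolerance is twice 1/(n+1), because the test vectors lie only near the subspace: one
  part is spent on moving them into it, the other on the approximation there.\<close>

definition grid_tuples :: "ennreal \<Rightarrow> cantor_fun list \<Rightarrow> nat \<Rightarrow> nat \<Rightarrow> nat \<Rightarrow> real \<Rightarrow> real \<Rightarrow> (nat \<Rightarrow> cantor_fun) set" where
  "grid_tuples p ds n m N a b = {w. (\<forall>x\<in>set ds. \<exists>q. norm (x - (\<Sum>i<m. real_of_rat (q i) *\<^sub>R w i)) < 2 / real (Suc n)) \<and>
     lp_grid p m N a b (\<lambda>k. norm (\<Sum>i<m. real_of_int (k i) *\<^sub>R w i))}"

text \<open>The first union is closed and the second one open in an admissible topology.\<close>

definition subspace_approx :: "ennreal \<Rightarrow> real \<Rightarrow> cantor_fun list \<Rightarrow> nat \<Rightarrow> cantor_fun set set" where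
  "subspace_approx p K ds n = (\<Union>d\<in>set ds. SB - E_plus (ball d (1 / real (Suc n)))) \<union>
     (\<Union>(m, N, a, b)\<in>{(m, N, a, b). 0 < a \<and> b < K * a \<and> 0 < N \<and> 4 * real m \<le> real N \<and> 8 * K * real m \<le> real N}.
        {F \<in> SB. \<exists>w\<in>grid_tuples p ds n m N a b. \<forall>i<m. w i \<in> F})"

lemma open_grid_tuples: "open (grid_tuples p ds n m N a b)"
proof -
  have cont: "continuous_on UNIV (\<lambda>w :: nat \<Rightarrow> cantor_fun. \<Sum>i<m. c i *\<^sub>R w i)" for c
    by (intro continuous_on_sum continuous_on_scaleR continuous_on_const continuous_on_product_coordinates)
  have 1: "open {w :: nat \<Rightarrow> cantor_fun. \<forall>x\<in>set ds. \<exists>q. norm (x - (\<Sum>i<m. real_of_rat (q i) *\<^sub>R w i)) < 2 / real (Suc n)}"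
  proof -
    have eq: "{w :: nat \<Rightarrow> cantor_fun. \<forall>x\<in>set ds. \<exists>q. norm (x - (\<Sum>i<m. real_of_rat (q i) *\<^sub>R w i)) < 2 / real (Suc n)} =
      (\<Inter>x\<in>set ds. \<Union>q. {w. norm (x - (\<Sum>i<m. real_of_rat (q i) *\<^sub>R w i)) < 2 / real (Suc n)})" by auto
    show ?thesis unfolding eq
      by (intro open_INT open_UN ballI finite_set open_Collect_less continuous_on_norm continuous_on_diff
          cont continuous_on_const)
  qed
  have 2: "open {w :: nat \<Rightarrow> cantor_fun. lp_grid p m N a b (\<lambda>k. norm (\<Sum>i<m. real_of_int (k i) *\<^sub>R w i))}"
    by (intro open_lp_grid continuous_on_norm cont)
  show ?thesis
    unfolding grid_tuples_def by (intro open_Collect_conj 1 2)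
qed

lemma gdelta_subspace_approx:
  assumes adm: "admissible \<tau>"
  shows "gdelta_in \<tau> (subspace_approx p K ds n)"
  unfolding subspace_approx_def
proof (rule gdelta_in_Un)
  have top: "topspace \<tau> = SB" and Ep: "\<And>U. open U \<Longrightarrow> openin \<tau> (E_plus U)" and met: "metrizable_space \<tau>"
    using adm by (auto simp: admissible_def intro: completely_metrizable_imp_metrizable_space)
  have "closedin \<tau> (SB - E_plus (ball d (1 / real (Suc n))))" for d
    using Ep[OF open_ball, of d "1 / real (Suc n)"] unfolding top[symmetric] by blast
  then have "closedin \<tau> (\<Union>d\<in>set ds. SB - E_plus (ball d (1 / real (Suc n))))"
    by (intro closedin_Union) auto
  then show "gdelta_in \<tau> (\<Union>d\<in>set ds. SB - E_plus (ball d (1 / real (Suc n))))"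
    \<comment> \<open>In a metrizable space a closed set is the intersection of its neighbourhoods
      of radius 1/k.\<close>
    by (rule closed_imp_gdelta_in[OF met])
  show "gdelta_in \<tau> (\<Union>(m, N, a, b)\<in>{(m, N, a, b). 0 < a \<and> b < K * a \<and> 0 < N \<and> 4 * real m \<le> real N \<and> 8 * K * real m \<le> real N}.
        {F \<in> SB. \<exists>w\<in>grid_tuples p ds n m N a b. \<forall>i<m. w i \<in> F})"
    by (intro open_imp_gdelta_in openin_Union)
      (auto intro: openin_meets_open[OF adm open_grid_tuples])
qed

text \<open>If no test vector is far from \<open>F\<close>, each has a neighbour \<open>y d\<close>
  in \<open>F\<close>, and the hypothesis is applied to these neighbours.\<close>

lemma subspace_approx_if:
  assumes p: "1 \<le> p" and F: "F \<in> SB" and approx: "approx_lp_bases p K F"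
  shows "F \<in> subspace_approx p K ds n"
proof (cases "\<exists>d\<in>set ds. F \<inter> ball d (1 / real (Suc n)) = {}")
  case True
  then show ?thesis using F by (auto simp: subspace_approx_def E_plus_def)
next
  case False
  then have "\<forall>d\<in>set ds. \<exists>y. y \<in> F \<and> dist d y < 1 / real (Suc n)" by auto
  then obtain y where y: "\<And>d. d \<in> set ds \<Longrightarrow> y d \<in> F" "\<And>d. d \<in> set ds \<Longrightarrow> dist d (y d) < 1 / real (Suc n)"
    by metis
  obtain m g where g: "\<forall>i<m. g i \<in> F" "lp_basis p K m g"
    and q: "\<forall>x\<in>y ` set ds. \<exists>q. norm (x - (\<Sum>i<m. real_of_rat (q i) *\<^sub>R g i)) < 1 / real (Suc n)"
    using approx[unfolded approx_lp_bases_def, rule_format, of "y ` set ds" "1 / real (Suc n)"] y(1) by auto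
  obtain a b where ab: "0 < a" "b < K * a"
    "\<And>N. 0 < N \<Longrightarrow> lp_grid p m N a b (\<lambda>k. norm (\<Sum>i<m. real_of_int (k i) *\<^sub>R g i))"
    using lp_grid_if_lp_basis[OF p g(2)] by blast
  obtain N where N: "0 < N" "4 * real m \<le> real N" "8 * K * real m \<le> real N"
    using ex_grid_size by blast
  have "\<exists>q. norm (d - (\<Sum>i<m. real_of_rat (q i) *\<^sub>R g i)) < 2 / real (Suc n)" if d: "d \<in> set ds" for d
  proof -
    obtain r where "norm (y d - (\<Sum>i<m. real_of_rat (r i) *\<^sub>R g i)) < 1 / real (Suc n)" using q d by blast
    then have "norm ((d - y d) + (y d - (\<Sum>i<m. real_of_rat (r i) *\<^sub>R g i))) < 1 / real (Suc n) + 1 / real (Suc n)"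
      using y(2)[OF d] by (intro norm_add_less) (auto simp: dist_norm)
    then show ?thesis by (intro exI[of _ r]) simp
  qed
  then have "g \<in> grid_tuples p ds n m N a b"
    using ab(3)[OF N(1)] by (simp add: grid_tuples_def)
  then have "F \<in> {F \<in> SB. \<exists>w\<in>grid_tuples p ds n m N a b. \<forall>i<m. w i \<in> F}"
    using F g(1) by blast
  then show ?thesis
    unfolding subspace_approx_def using ab(1,2) N by (intro UnI2 UN_I[of "(m, N, a, b)"]) auto
qed

text \<open>Test vectors are chosen close to the given members of \<open>F\<close>, which rules out
  the closed alternative and leaves the approximating system.\<close>

lemma approx_if_subspace_approx:
  assumes p: "1 \<le> p" and F: "F \<in> SB" and D: "\<And>f e. 0 < e \<Longrightarrow> \<exists>d\<in>D. dist d f < e"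
    and approx: "\<And>ds n. ds \<in> lists D \<Longrightarrow> F \<in> subspace_approx p K ds n"
  shows "approx_lp_bases p (17 * K) F"
  unfolding approx_lp_bases_def
proof (intro allI impI, elim conjE)
  fix B and \<epsilon> :: real assume finB: "finite B" and B: "B \<subseteq> F" and \<epsilon>: "0 < \<epsilon>"
  \<comment> \<open>One third of \<open>\<epsilon>\<close> moves \<open>x\<close> to its test
    vector; the other two are the tolerance in \<open>grid_tuples\<close>.\<close>
  obtain n where "1 / real (Suc n) < \<epsilon> / 3" using nat_approx_posE[of "\<epsilon> / 3"] \<epsilon> by auto
  then have n: "1 / real (Suc n) + 2 / real (Suc n) < \<epsilon>" by simp
  have "\<forall>x. \<exists>d. d \<in> D \<and> dist d x < 1 / real (Suc n)" using D[of "1 / real (Suc n)"] by force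
  then obtain d where d: "\<And>x. d x \<in> D" "\<And>x. dist (d x) x < 1 / real (Suc n)" by metis
  obtain ds where ds: "set ds = d ` B" using finite_list[of "d ` B"] finB by auto
  have "ds \<in> lists D" using d(1) by (auto simp: lists_eq_set ds)
  from approx[OF this, of n] have "F \<in> subspace_approx p K ds n" .
  moreover have "F \<notin> SB - E_plus (ball (d x) (1 / real (Suc n)))" if "x \<in> B" for x
    using that B d(2)[of x] F by (auto simp: E_plus_def)
  ultimately obtain m N a b w where *: "0 < a" "b < K * a" "0 < N" "4 * real m \<le> real N" "8 * K * real m \<le> real N"
    and w: "w \<in> grid_tuples p ds n m N a b" "\<forall>i<m. w i \<in> F"
    unfolding subspace_approx_def ds by blast
  have "lp_basis p (17 * K) m w"
    using w(1) by (intro lp_basis_if_lp_grid[OF p *]) (simp add: grid_tuples_def)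
  moreover have "\<exists>q. norm (x - (\<Sum>i<m. real_of_rat (q i) *\<^sub>R w i)) < \<epsilon>" if x: "x \<in> B" for x
  proof -
    obtain q where q: "norm (d x - (\<Sum>i<m. real_of_rat (q i) *\<^sub>R w i)) < 2 / real (Suc n)"
      using w(1) x ds by (auto simp: grid_tuples_def)
    have "norm ((x - d x) + (d x - (\<Sum>i<m. real_of_rat (q i) *\<^sub>R w i))) < 1 / real (Suc n) + 2 / real (Suc n)"
      using d(2)[of x] q by (intro norm_add_less) (auto simp: dist_norm norm_minus_commute)
    then have "norm (x - (\<Sum>i<m. real_of_rat (q i) *\<^sub>R w i)) < 1 / real (Suc n) + 2 / real (Suc n)"
      by simp
    then show ?thesis using n less_trans by blast
  qed
  ultimately show "\<exists>m g. (\<forall>i<m. g i \<in> F) \<and> lp_basis p (17 * K) m g \<and>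
        (\<forall>x\<in>B. \<exists>q. norm (x - (\<Sum>i<m. real_of_rat (q i) *\<^sub>R g i)) < \<epsilon>)"
    using w(2) by blast
qed

lemma gdelta_sigma_SB:
  assumes p: "1 \<le> p" and adm: "admissible \<tau>"
  shows "gdelta_sigma_in \<tau> {F \<in> SB. script_Lp p (nspace_of F)}"
proof -
  obtain D :: "cantor_fun set" where D: "countable D" "\<And>f e. 0 < e \<Longrightarrow> \<exists>d\<in>D. dist d f < e"
    using Cantor_functions_separable by blast
  define A where "A K = (\<Inter>(ds, n)\<in>lists D \<times> UNIV. subspace_approx p (real K) ds n)" for K
  have sub: "subspace_approx p K ds n \<subseteq> SB" for K ds n
    by (auto simp: subspace_approx_def)
  have iff: "script_Lp p (nspace_of F) \<longleftrightarrow> (\<exists>K. F \<in> A K)" if F: "F \<in> SB" for F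
  proof -
    have sF: "subspace F" using F by (simp add: SB_def)
    have "isometric_embedding (nspace_of F) (\<lambda>x. x)"
      using sF by (auto simp: isometric_embedding_def linear_subspace_def nspace_of_def
          subspace_0 subspace_add subspace_scale)
    from script_Lp_iff_has_lp_bases[OF p this]
    have "script_Lp p (nspace_of F) \<longleftrightarrow> (\<exists>K. has_lp_bases p K F)"
      by (simp add: nspace_of_def)
    also have "\<dots> \<longleftrightarrow> (\<exists>K. F \<in> A K)"
    proof
      assume "\<exists>K. has_lp_bases p K F"
      then obtain K0 where K0: "has_lp_bases p K0 F" by blast
      obtain K :: nat where "K0 \<le> real K" using real_arch_simple by blast
      \<comment> \<open>\<open>F\<close> is used as its own dense subset; \<open>D\<close> only
        supplies the test vectors.\<close>
      then have "approx_lp_bases p (real K) F"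
        using approx_if_has_lp_bases[OF p subset_refl closure_subset] has_lp_bases_mono[OF K0] by blast
      then have "F \<in> A K"
        using subspace_approx_if[OF p F] by (auto simp: A_def)
      then show "\<exists>K. F \<in> A K" ..
    next
      assume "\<exists>K. F \<in> A K"
      then obtain K where "F \<in> A K" ..
      then have "approx_lp_bases p (17 * real K) F"
        by (intro approx_if_subspace_approx[OF p F D(2)]) (auto simp: A_def)
      then show "\<exists>K. has_lp_bases p K F"
        using has_lp_bases_if_approx[OF sF subset_refl closure_subset] by blast
    qed
    finally show ?thesis .
  qed
  \<comment> \<open>Each index set contains the empty list, so the intersection over lists stays
    inside \<open>SB\<close>.\<close>
  have "A K \<subseteq> SB" for K
    using sub[of "real K" "[]" 0] by (auto simp: A_def)
  then have "{F \<in> SB. script_Lp p (nspace_of F)} = (\<Union>K. A K)"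
    using iff by blast
  moreover have "gdelta_in \<tau> (A K)" for K
    unfolding A_def
    by (intro gdelta_in_Inter)
      (auto intro!: gdelta_subspace_approx[OF adm] countable_image countable_SIGMA countable_lists D(1))
  ultimately show ?thesis using countable_union_gdelta by metis
qed

theorem corollary3p7:
  fixes p :: ennreal
  assumes "1 \<le> p"
  shows "gdelta_sigma_in (top_of_set pseudonorms) {\<mu> \<in> pseudonorms. script_Lp p (X_space \<mu>)} \<and>
    (\<forall>\<tau>. admissible \<tau> \<longrightarrow> gdelta_sigma_in \<tau> {F \<in> SB. script_Lp p (nspace_of F)})"
  using gdelta_sigma_pseudonorms[OF assms] gdelta_sigma_SB[OF assms] by blast

end
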